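(* Let $A_1,\dots,A_k$ be contracting non-singular $d\times d$ matrices with $\|A_i\|<\tfrac12$ for all $i=1,\dots,k$, and let $\overline q\in\Sigma=\{1,\dots,k\}^{\mathbb N}$. Assume that all the matrices $A_i=\operatorname{diag}(a^i_1,\dots,a^i_d)$ are diagonal. Let $s_0$ be such that $P(s_0)=0$. For $(v_1,\dots,v_k)\in\mathbb R^{dk}$ let $\Lambda$ be the self-affine set corresponding to the iterated function system $\{A_1+v_1,\dots,A_k+v_k\}$, and let $\Lambda_q=\pi(\Sigma_{[\overline q|_q]})$ be the survivor set with hole $[\overline q|_q]$, $q$ a positive integer. Then, for Lebesgue almost all $(v_1,\dots,v_k)\in\mathbb R^{dk}$, \[ \dim_H\Lambda_q=\max_{D\in S_d}t_q^D , \] where $t_q^D$ is the zero of the reduced $D$-pressure $P_{D,q}$. Moreover, if $\overline q$ is not periodic then \[ \lim_{q\to\infty}\frac{\dim\Lambda-\dim\Lambda_q}{\min_{D\in S_d;\,P_D(s_0)=0}Z(D)\,\mu_D([\overline q|_q])}=1, \] while if $\overline q$ has period $\ell$ then \[ \lim_{q\to\infty}\frac{\dim\Lambda-\dim\Lambda_q}{\min_{D\in S_d;\,P_D(s_0)=0}Z(D)\,(1-\mu_D([\overline q|_\ell]))\,\mu_D([\overline q|_q])}=1 . \]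
   Context: Here $\dim=\dim_H$ is Hausdorff dimension. $\Sigma=\{1,\dots,k\}^{\mathbb N}$ with left shift $\sigma$; $\Sigma_n=\{1,\dots,k\}^n$; for a finite word $\overline\imath$, $[\overline\imath]\subset\Sigma$ is the cylinder of infinite words beginning with $\overline\imath$; $\overline\imath|_n$ is the word of the first $n$ symbols of $\overline\imath$; $A_{\overline\imath}=A_{i_1}\cdots A_{i_n}$ for $\overline\imath=(i_1,\dots,i_n)$, and $A_\emptyset=\mathrm{Id}$. The self-affine set $\Lambda$ is the unique non-empty compact set with $\Lambda=\bigcup_i f_i(\Lambda)$, $f_i(x)=A_ix+v_i$. The natural projection $\pi:\Sigma\to\Lambda$ is $\pi(\overline\imath)=\sum_{m\ge1}A_{\overline\imath|_{m-1}}v_{i_m}$. For a cylinder $U\subset\Sigma$, $\Sigma_U=\{\overline\imath\in\Sigma:\sigma^j(\overline\imath)\notin U\text{ for all }j\}$, and $\Sigma_{n,q}=\{\overline\imath|_n:\overline\imath\in\Sigma_{[\overline q|_q]}\}\subset\Sigma_n$. $\sigma_1(A)\ge\dots\ge\sigma_d(A)$ are the singular values of $A$; for $s\ge0$, $\phi^s(A)=\sigma_1(A)\cdots\sigma_{\lfloor s\rfloor}(A)\,\sigma_{\lceil s\rceil}(A)^{s-\lfloor s\rfloor}$ (last factor $1$ for integer $s$). The pressure is $P(s)=\lim_n\frac1n\log\sum_{\overline\imath\in\Sigma_n}\phi^s(A_{\overline\imath})$. $S_d$ is the set of permutations of $\{1,\dots,d\}$. For $D=(e_1,\dots,e_d)\in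 S_d$ and a diagonal matrix $A=\operatorname{diag}(a_1,\dots,a_d)$, put $\phi^s_D(A)=a_{e_1}\cdots a_{e_{\lfloor s\rfloor}}\,a_{e_{\lfloor s\rfloor+1}}^{s-\lfloor s\rfloor}$ (last factor $1$ for integer $s$). The $D$-pressure and reduced $D$-pressure are \[ P_D(s)=\lim_n\tfrac1n\log\sum_{\overline\imath\in\Sigma_n}\phi_D^s(A_{\overline\imath}),\qquad P_{D,q}(s)=\lim_n\tfrac1n\log\sum_{\overline\imath\in\Sigma_{n,q}}\phi_D^s(A_{\overline\imath}). \] For $D$ with $P_D(s_0)=0$, $\mu_D$ is the Bernoulli measure on $\Sigma$ with probability vector $(\phi_D^{s_0}(A_1),\dots,\phi_D^{s_0}(A_k))$, and \[ Z(D)=-\Big(\lim_{h\searrow0}\tfrac1h\big(P_D(s_0)-P_D(s_0-h)\big)\Big)^{-1}=\frac{-1}{\langle(\log a^1_{e_{\lceil s_0\rceil}},\dots,\log a^k_{e_{\lceil s_0\rceil}}),\alpha^{s_0}\rangle}, \] where $\alpha^{s_0}$ (depending on $D$) is the point of the simplex of probability vectors of length $k$ at which $\alpha\mapsto-\sum_i\alpha(i)\log\alpha(i)+\sum_i\alpha(i)\log\phi_D^{s_0}(A_i)$ attains its maximum. "$\overline q$ has period $\ell$" means that $\ell\ge1$ is the least integer with $\sigma^\ell(\overline q)=\overline q$; if no such integer exists, $\overline q$ is not periodic.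
   Formalization: The diagonal entries are replaced by their absolute values in φ_D^s (and so in P_D, μ_D, Z(D)), since real powers of negative entries are undefined; k≥2 and 0≤s_0≤d are made explicit, as otherwise Z(D) or φ^{s_0} is undefined. *)

theory Defs
  imports "HOL-Probability.Probability" "HOL-Combinatorics.Multiset_Permutations"
begin

text \<open>Conventions: $|\emptyset|^s = 0$ and $|U|^0 = 1$ for nonempty $U$
  (in HOL, \<^term>\<open>0 powr 0 = (0::real)\<close>).\<close>

definition diam_pow :: "real \<Rightarrow> 'a::euclidean_space set \<Rightarrow> real" where
  "diam_pow s U = (if U = {} then 0 else if s = 0 then 1 else diameter U powr s)"

text \<open>Boundedness has to be required of the covering sets, since
  \<^const>\<open>diameter\<close> is unspecified on unbounded sets.\<close>

definition hausdorff_premeasure :: "real \<Rightarrow> real \<Rightarrow> 'a::euclidean_space set \<Rightarrow> ennreal" where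
  "hausdorff_premeasure \<delta> s E =
     (INF U \<in> {U :: nat \<Rightarrow> 'a set. E \<subseteq> (\<Union>i. U i) \<and> (\<forall>i. bounded (U i) \<and> diameter (U i) \<le> \<delta>)}.
        \<Sum>i. ennreal (diam_pow s (U i)))"

definition hausdorff_measure :: "real \<Rightarrow> 'a::euclidean_space set \<Rightarrow> ennreal" where
  "hausdorff_measure s E = (SUP \<delta> \<in> {0<..}. hausdorff_premeasure \<delta> s E)"

definition hausdorff_dim :: "'a::euclidean_space set \<Rightarrow> real" where
  "hausdorff_dim E = Inf {s. 0 \<le> s \<and> hausdorff_measure s E = 0}"

text \<open>The alphabet $\{1,\dots,k\}$ is a finite type \<open>'k\<close>, $\Sigma$ is \<open>'k stream\<close>, the shift
  $\sigma^j$ is \<^term>\<open>sdrop j\<close> and the restriction to the first $n$ symbols is \<^term>\<open>stake n\<close>.\<close>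

definition words :: "nat \<Rightarrow> 'k list set" where
  "words n = {w. length w = n}"

definition cylinder :: "'k list \<Rightarrow> 'k stream set" where
  "cylinder w = {x. stake (length w) x = w}"

definition survivors :: "'k stream set \<Rightarrow> 'k stream set" where
  "survivors U = {x. \<forall>j. sdrop j x \<notin> U}"

definition survivor_words :: "'k stream \<Rightarrow> nat \<Rightarrow> nat \<Rightarrow> 'k list set" where
  "survivor_words qs q n = stake n ` survivors (cylinder (stake q qs))"

definition has_period :: "'k stream \<Rightarrow> nat \<Rightarrow> bool" where
  "has_period x l \<longleftrightarrow> 1 \<le> l \<and> sdrop l x = x \<and> (\<forall>m. 1 \<le> m \<and> m < l \<longrightarrow> sdrop m x \<noteq> x)"

definition word_matrix :: "('k \<Rightarrow> real^'d^'d) \<Rightarrow> 'k list \<Rightarrow> real^'d^'d" where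
  "word_matrix A w = foldr (\<lambda>i M. A i ** M) w (mat 1)"

definition self_affine_set :: "('k \<Rightarrow> real^'d^'d) \<Rightarrow> real^'d^'k \<Rightarrow> (real^'d) set" where
  "self_affine_set A v =
     (THE L. compact L \<and> L \<noteq> {} \<and> L = (\<Union>i. (\<lambda>x. A i *v x + v $ i) ` L))"

definition projection :: "('k \<Rightarrow> real^'d^'d) \<Rightarrow> real^'d^'k \<Rightarrow> 'k stream \<Rightarrow> real^'d" where
  "projection A v x = (\<Sum>m. word_matrix A (stake m x) *v (v $ (x !! m)))"

definition survivor_set ::
    "('k \<Rightarrow> real^'d^'d) \<Rightarrow> real^'d^'k \<Rightarrow> 'k stream \<Rightarrow> nat \<Rightarrow> (real^'d) set" where
  "survivor_set A v qs q = projection A v ` survivors (cylinder (stake q qs))"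

text \<open>The singular values are the nonnegative square roots of the eigenvalues of $A^T A$, repeated
  according to multiplicity (for a symmetric matrix, the dimension of the eigenspace) and listed in
  decreasing order. \<open>singular_value A i\<close> is $\sigma_i(A)$, with $1 \le i \le d$.\<close>

definition singular_values :: "real^'d^'d \<Rightarrow> real list" where
  "singular_values A =
     (let E = (\<lambda>r. {x. (transpose A ** A) *v x = r\<^sup>2 *\<^sub>R x})
      in rev (sorted_list_of_multiset
           (\<Sum>r\<in>{r. 0 \<le> r \<and> E r \<noteq> {0}}. replicate_mset (dim (E r)) r)))"

definition singular_value :: "real^'d^'d \<Rightarrow> nat \<Rightarrow> real" where
  "singular_value A i = singular_values A ! (i - 1)"

text \<open>The functions below are meaningful for $0 \le s \le d$.\<close>

definition sv_function :: "real \<Rightarrow> real^'d^'d \<Rightarrow> real" where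
  "sv_function s A =
     (\<Prod>i = 1..nat \<lfloor>s\<rfloor>. singular_value A i) *
     (if s \<in> \<int> then 1 else singular_value A (nat \<lceil>s\<rceil>) powr (s - of_int \<lfloor>s\<rfloor>))"

definition pressure :: "('k::finite \<Rightarrow> real^'d^'d) \<Rightarrow> real \<Rightarrow> real" where
  "pressure A s = lim (\<lambda>n. 1 / real n * ln (\<Sum>w\<in>words n. sv_function s (word_matrix A w)))"

text \<open>An element $D = (e_1,\dots,e_d)$ of $S_d$ is a list enumerating the coordinate index type
  \<open>'d\<close> without repetition, with $e_i$ the list entry \<open>D ! (i - 1)\<close>.\<close>

abbreviation orderings :: "'d::finite list set" where
  "orderings \<equiv> permutations_of_set UNIV"

text \<open>Absolute values of the diagonal entries are taken, so that the real powers and logarithms make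
  sense for diagonal matrices with negative entries; for positive entries they have no effect.\<close>

definition D_function :: "'d list \<Rightarrow> real \<Rightarrow> real^'d^'d \<Rightarrow> real" where
  "D_function D s A =
     (let a = (\<lambda>i. \<bar>A $ (D ! (i - 1)) $ (D ! (i - 1))\<bar>)
      in (\<Prod>i = 1..nat \<lfloor>s\<rfloor>. a i) *
         (if s \<in> \<int> then 1 else a (nat \<lfloor>s\<rfloor> + 1) powr (s - of_int \<lfloor>s\<rfloor>)))"

definition D_pressure :: "('k::finite \<Rightarrow> real^'d^'d) \<Rightarrow> 'd list \<Rightarrow> real \<Rightarrow> real" where
  "D_pressure A D s = lim (\<lambda>n. 1 / real n * ln (\<Sum>w\<in>words n. D_function D s (word_matrix A w)))"

definition reduced_D_pressure ::
    "('k::finite \<Rightarrow> real^'d^'d) \<Rightarrow> 'd list \<Rightarrow> 'k stream \<Rightarrow> nat \<Rightarrow> real \<Rightarrow> real" where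
  "reduced_D_pressure A D qs q s =
     lim (\<lambda>n. 1 / real n * ln (\<Sum>w\<in>survivor_words qs q n. D_function D s (word_matrix A w)))"

definition reduced_D_zero ::
    "('k::finite \<Rightarrow> real^'d^'d) \<Rightarrow> 'd::finite list \<Rightarrow> 'k stream \<Rightarrow> nat \<Rightarrow> real" where
  "reduced_D_zero A D qs q =
     (THE t. 0 \<le> t \<and> t \<le> real CARD('d) \<and> reduced_D_pressure A D qs q t = 0)"

text \<open>When \<open>D_pressure A D s0 = 0\<close>, the weights \<open>D_function D s0 (A i)\<close> sum to 1.\<close>

definition bernoulli_measure ::
    "('k::finite \<Rightarrow> real^'d^'d) \<Rightarrow> real \<Rightarrow> 'd list \<Rightarrow> 'k stream measure" where
  "bernoulli_measure A s0 D =
     stream_space (point_measure UNIV (\<lambda>i. ennreal (D_function D s0 (A i))))"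

definition Z_const :: "('k::finite \<Rightarrow> real^'d^'d) \<Rightarrow> real \<Rightarrow> 'd list \<Rightarrow> real" where
  "Z_const A s0 D =
     - inverse (Lim (at_right 0) (\<lambda>h. 1 / h * (D_pressure A D s0 - D_pressure A D (s0 - h))))"

end

theory Submission
  imports Defs "HOL-Library.Sublist" "HOL-Real_Asymp.Real_Asymp"
begin

text \<open>
  For diagonal matrices $\phi^s=\max_D\phi_D^s$ and every $\phi_D^s$ is multiplicative, so each $D$ gives a
  Bernoulli weight on words, and the survivor set is coded by the words avoiding $w=\overline q|_q$.
  Let $f_n$ be the total weight of the avoiding words of length $n$, $P$ the sum of the letter weights and
  $c(z)$ the autocorrelation polynomial of $w$. Cutting at the first occurrence of $w$ yields
  $\sum_n f_nz^n\,((1-zP)c(z)+p(w)z^q)=c(z)$, so at the zero $t_q^D$ of the reduced pressure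
  $P-1=p(w)/c(1)$. As $q\to\infty$ the left side is asymptotic to $(s_0-t_q^D)/Z(D)$, while $c(1)$ tends to
  $1$, or to the geometric series with ratio $\mu_D([\overline q|_\ell])$ if $\overline q$ has period $\ell$.

  For the dimension, the upper bound covers cylinders by cubes. For the lower bound, normalising the generating
  functions of the continuations of a word as $z\nearrow1$ gives a measure on the survivors with
  $\mu[u]\le\phi_D^t(A_u)$. Transversality is elementary in the diagonal case: if $x$ and $y$ differ in the
  first letter, each coordinate of $\pi(x)-\pi(y)$ is a linear form in the translations which takes a value
  bounded away from $0$ at $e_{x_1}-e_{y_1}$ because $\|A_i\|<1/2$.
\<close>

section \<open>Words avoiding a factor\<close>

text \<open>The hole changes with \<open>q\<close>, so a perturbation argument would need bounds
  uniform in the hole; the generating-function identity is exact for every \<open>w\<close> and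
  leaves elementary limits only. It serves twice: at \<open>z = 1\<close> it determines the gap, at
  a fixed \<open>z < 1\<close> it shows that the gap tends to zero at all. Submultiplicativity turns
  zero pressure into level sums of at least 1, so the generating function diverges at 1. This
  divergence replaces irreducibility of the avoiding language, which can fail (over two letters a, b
  the words avoiding ab are b..ba..a). Both dimension bounds rest on one duality: for all r > 0 and
  all \<open>D\<close>, \<open>phi D s b\<close> is at most r^s times the product of max(1,
  |b_c|/r), with equality for a decreasing ordering and a suitable r. Equality counts the cubes of
  side r covering a cylinder; the inequality, in reciprocal form, bounds the volume of bad
  translations. Hence the lower bound works with one fixed \<open>D\<close>, although the ordering
  that is decreasing for a word varies with the word. For large \<open>q\<close> only the orderings
  with P_D(s_0) = 0 compete: the other zeros stay below some number less than s_0.\<close>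

definition wt :: "('k \<Rightarrow> real) \<Rightarrow> 'k list \<Rightarrow> real" where
  "wt p w = prod_list (map p w)"

lemma wt_simps [simp]:
  "wt p [] = 1" "wt p (i # w) = p i * wt p w" "wt p (u @ w) = wt p u * wt p w"
  by (simp_all add: wt_def)

lemma wt_nonneg: "(\<And>i. 0 \<le> p i) \<Longrightarrow> 0 \<le> wt p w"
  by (induction w) auto

lemma wt_pos: "(\<And>i. 0 < p i) \<Longrightarrow> 0 < wt p w"
  by (induction w) auto

definition level :: "'k list set \<Rightarrow> nat \<Rightarrow> 'k list set" where
  "level V n = {u \<in> V. length u = n}"

definition level_sum :: "('k \<Rightarrow> real) \<Rightarrow> 'k list set \<Rightarrow> nat \<Rightarrow> real" where
  "level_sum p V n = (\<Sum>u\<in>level V n. wt p u)"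

text \<open>The two instances are \<open>UNIV\<close> and \<open>avoiding w\<close>, so that the
  attractor and the survivor set are treated by the same lemmas. Closure under factors is what makes
  level sums submultiplicative.\<close>

definition factorial_language :: "'k list set \<Rightarrow> bool" where
  "factorial_language V \<longleftrightarrow> [] \<in> V \<and> (\<forall>u v. u @ v \<in> V \<longrightarrow> u \<in> V \<and> v \<in> V)"

definition avoiding :: "'k list \<Rightarrow> 'k list set" where
  "avoiding w = {u. \<not> sublist w u}"

text \<open>For nonempty \<open>w\<close>, these are the words whose only occurrence of
  \<open>w\<close> is the terminal one: the orbit is stopped at the moment it has read the
  hole.\<close>

definition first_hits :: "'k list \<Rightarrow> nat \<Rightarrow> 'k list set" where
  "first_hits w n = {u. length u = n \<and> suffix w u \<and> \<not> sublist w (butlast u)}"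

definition hit_sum :: "('k \<Rightarrow> real) \<Rightarrow> 'k list \<Rightarrow> nat \<Rightarrow> real" where
  "hit_sum p w n = (\<Sum>u\<in>first_hits w n. wt p u)"

text \<open>The exponents of the autocorrelation polynomial of \<open>w\<close>; the shift 0 belongs
  to them whenever \<open>w\<close> is nonempty.\<close>

definition overlaps :: "'k list \<Rightarrow> nat set" where
  "overlaps w = {j. j < length w \<and> drop j w = take (length w - j) w}"

lemma finite_words_length: "finite {u :: 'k::finite list. length u = n}"
  using finite_lists_length_eq[of "UNIV :: 'k set" n] by simp

lemma finite_level [simp]: "finite (level V n :: 'k::finite list set)"
  by (rule finite_subset[OF _ finite_words_length[of n]]) (auto simp: level_def)

lemma finite_first_hits [simp]: "finite (first_hits w n :: 'k::finite list set)"
  by (rule finite_subset[OF _ finite_words_length[of n]]) (auto simp: first_hits_def)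

lemma finite_overlaps [simp]: "finite (overlaps w)"
  by (auto simp: overlaps_def)

lemma factorial_language_UNIV [simp]: "factorial_language UNIV"
  by (simp add: factorial_language_def)

lemma factorial_language_avoiding: "w \<noteq> [] \<Longrightarrow> factorial_language (avoiding w)"
  by (auto simp: factorial_language_def avoiding_def sublist_append)

lemma level_sum_nonneg: "(\<And>i. 0 \<le> p i) \<Longrightarrow> 0 \<le> level_sum p V n"
  by (auto simp: level_sum_def intro!: sum_nonneg wt_nonneg)

lemma sum_wt_snoc:
  fixes p :: "'k::finite \<Rightarrow> real"
  assumes "finite W"
  shows "(\<Sum>u\<in>{u. u \<noteq> [] \<and> butlast u \<in> W}. wt p u) = (\<Sum>u\<in>W. wt p u) * sum p UNIV"
proof -
  have "(\<Sum>u\<in>{u. u \<noteq> [] \<and> butlast u \<in> W}. wt p u) = (\<Sum>(u, i)\<in>W \<times> UNIV. wt p u * p i)"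
  proof (rule sum.reindex_bij_witness[where i = "\<lambda>(u, i). u @ [i]" and j = "\<lambda>u. (butlast u, last u)"])
    fix u assume "u \<in> {u. u \<noteq> [] \<and> butlast u \<in> W}"
    then have "u = butlast u @ [last u]" by simp
    then have "wt p u = wt p (butlast u) * p (last u)"
      by (metis mult.right_neutral wt_simps)
    then show "(case (butlast u, last u) of (u, i) \<Rightarrow> wt p u * p i) = wt p u" by simp
  qed auto
  also have "\<dots> = (\<Sum>u\<in>W. wt p u) * sum p UNIV"
    by (simp add: sum.cartesian_product[symmetric] sum_product)
  finally show ?thesis .
qed

lemma level_sum_UNIV: "level_sum p UNIV n = sum p (UNIV :: 'k::finite set) ^ n"
proof (induction n)
  case (Suc n)
  have "level UNIV (Suc n) = {u :: 'k list. u \<noteq> [] \<and> butlast u \<in> level UNIV n}"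
    by (auto simp: level_def)
  then show ?case
    using sum_wt_snoc[OF finite_level, of p UNIV n] Suc by (simp only: level_sum_def power_Suc2)
qed (simp add: level_sum_def level_def)

text \<open>One more letter either keeps an avoiding word avoiding or completes an occurrence of
  \<open>w\<close>, which is then the first one and terminal. This is the first of two linear
  relations between level sums and hit sums.\<close>

lemma level_sum_step:
  fixes p :: "'k::finite \<Rightarrow> real"
  assumes "w \<noteq> []"
  shows "level_sum p (avoiding w) n * sum p UNIV = level_sum p (avoiding w) (Suc n) + hit_sum p w (Suc n)"
proof -
  have sub: "sublist w u \<longleftrightarrow> sublist w (butlast u) \<or> suffix w u" if "u \<noteq> []" for u
  proof -
    obtain v i where u: "u = v @ [i]" using \<open>u \<noteq> []\<close> by (metis append_butlast_last_id)
    show ?thesis unfolding u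
      by (metis butlast_snoc sublist_snoc)
  qed
  have "{u. u \<noteq> [] \<and> butlast u \<in> level (avoiding w) n} =
      level (avoiding w) (Suc n) \<union> first_hits w (Suc n)"
  proof (rule set_eqI)
    fix u :: "'k list"
    show "u \<in> {u. u \<noteq> [] \<and> butlast u \<in> level (avoiding w) n} \<longleftrightarrow>
        u \<in> level (avoiding w) (Suc n) \<union> first_hits w (Suc n)"
      using sub[of u] by (cases "u = []") (auto simp: level_def avoiding_def first_hits_def)
  qed
  moreover have "level (avoiding w) (Suc n) \<inter> first_hits w (Suc n) = {}"
    by (auto simp: level_def avoiding_def first_hits_def)
  ultimately show ?thesis
    using sum_wt_snoc[OF finite_level, of p "avoiding w" n]
    by (simp add: level_sum_def hit_sum_def sum.union_disjoint)
qed

text \<open>Append \<open>w\<close> to a word that avoids it and cut at the end of the first occurrence of \<open>w\<close>: the letters cut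
  off are the last \<open>j\<close> letters of \<open>w\<close>, where \<open>j\<close> is a self-overlap shift of \<open>w\<close>.\<close>

lemma first_occurrence:
  assumes w: "w \<noteq> []" and u: "\<not> sublist w u"
  obtains j where "j \<in> overlaps w"
    "take (length u + length w - j) (u @ w) \<in> first_hits w (length u + length w - j)"
proof -
  define N where "N = (LEAST N. sublist w (take N (u @ w)))"
  have ex: "sublist w (take (length u + length w) (u @ w))" by simp
  have N: "sublist w (take N (u @ w))"
    unfolding N_def by (rule LeastI[of "\<lambda>N. sublist w (take N (u @ w))", OF ex])
  have Nle: "N \<le> length u + length w"
    unfolding N_def by (rule Least_le[of "\<lambda>N. sublist w (take N (u @ w))", OF ex])
  have least: "\<not> sublist w (take m (u @ w))" if "m < N" for m
    using that not_less_Least unfolding N_def by blast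
  have Ngt: "length u < N"
  proof (rule ccontr)
    assume "\<not> length u < N"
    then have "take N (u @ w) = take N u" by simp
    then show False using N u by (metis sublist_order.order_trans sublist_take)
  qed
  let ?x = "take N (u @ w)"
  have lx: "length ?x = N" using Nle by simp
  have bl: "butlast ?x = take (N - 1) (u @ w)"
    using Nle by (simp add: butlast_take del: take_append)
  have nb: "\<not> sublist w (butlast ?x)" unfolding bl using least[of "N - 1"] Ngt by simp
  have suf: "suffix w ?x"
  proof -
    have "?x \<noteq> []" using Ngt lx by auto
    then obtain v i where v: "?x = v @ [i]" by (metis append_butlast_last_id)
    show ?thesis using N nb unfolding v by (metis butlast_snoc sublist_snoc)
  qed
  define j where "j = length u + length w - N"
  have Nj: "N = length u + length w - j" and jl: "j < length w"
    using Nle Ngt by (auto simp: j_def)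
  obtain y where y: "?x = y @ w" using suf by (auto simp: suffix_def)
  have "length y + length w = N" using lx unfolding y by simp
  then have ly: "length y + j = length u" using Nj jl by linarith
  \<comment> \<open>The prefix up to the first occurrence is read in two ways, as \<open>u\<close>
    followed by an initial piece of \<open>w\<close> and as a word ending in \<open>w\<close>.
    Cancelling \<open>u\<close> leaves the overlap condition.\<close>
  have "?x = u @ take (N - length u) w" using Ngt by simp
  also have "N - length u = length w - j" using Nj jl by linarith
  finally have "u @ take (length w - j) w = (y @ take j w) @ drop j w" using y by simp
  moreover have "length u = length (y @ take j w)" using ly jl by simp
  ultimately have "take (length w - j) w = drop j w" using append_eq_append_conv by blast
  then have "j \<in> overlaps w" using jl by (simp add: overlaps_def)
  moreover have "?x \<in> first_hits w N" using lx suf nb by (simp add: first_hits_def)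
  ultimately show ?thesis using that[of j] by (simp only: Nj[symmetric])
qed

text \<open>Removing either piece from \<open>w\<close> leaves the same border, and weights commute.
  The letters cut off after the first occurrence can thus be traded for \<open>take j w\<close>,
  which in the limit is a prefix of the stream.\<close>

lemma wt_drop_overlap:
  assumes "j \<in> overlaps w" and pos: "\<And>i. 0 < p i"
  shows "wt p (drop (length w - j) w) = wt p (take j w)"
proof -
  have "wt p w = wt p (take j w) * wt p (drop j w)"
    by (metis append_take_drop_id wt_simps(3))
  moreover have "wt p w = wt p (drop j w) * wt p (drop (length w - j) w)"
    using assms(1) wt_simps(3)[of p "take (length w - j) w" "drop (length w - j) w"]
    by (simp add: overlaps_def del: wt_simps)
  ultimately show ?thesis using wt_pos[of p "drop j w"] pos by (simp add: less_imp_neq[symmetric])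
qed

text \<open>Double counting of the words \<open>u @ w\<close> with \<open>u\<close> avoiding, sorted
  by the overlap at which their first occurrence of \<open>w\<close> ends: the second linear
  relation. The bijection sends a stopped word to its first \<open>n\<close> letters.\<close>

lemma hit_sum_overlaps:
  fixes p :: "'k::finite \<Rightarrow> real"
  assumes w: "w \<noteq> []" and pos: "\<And>i. 0 < p i"
  shows "wt p w * level_sum p (avoiding w) n =
    (\<Sum>j\<in>overlaps w. hit_sum p w (n + length w - j) * wt p (take j w))"
proof -
  let ?q = "length w"
  \<comment> \<open>Inverse of the cut: completing a stopped word by the last \<open>j\<close>
    letters of \<open>w\<close> makes \<open>w\<close> reappear at the end. Since
    \<open>j < length w\<close>, the first \<open>n\<close> letters omit at least the last letter of
    \<open>x\<close>, hence avoid \<open>w\<close>.\<close>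
  have extend: "x @ drop (?q - j) w = take n x @ w \<and> take n x \<in> level (avoiding w) n"
    if j: "j \<in> overlaps w" and x: "x \<in> first_hits w (n + ?q - j)" for j x
  proof -
    have jq: "j < ?q" and dj: "drop j w = take (?q - j) w" using j by (auto simp: overlaps_def)
    have lx: "length x = n + ?q - j" and bx: "\<not> sublist w (butlast x)"
      using x by (auto simp: first_hits_def)
    obtain y where y: "x = y @ w" using x by (auto simp: first_hits_def suffix_def)
    have ly: "length y + j = n" using lx y jq by simp
    have "w @ drop (?q - j) w = take j w @ w"
      by (metis append.assoc append_take_drop_id dj)
    then have e: "x @ drop (?q - j) w = (y @ take j w) @ w" by (simp add: y)
    have t: "take n x = y @ take j w" using ly jq by (auto simp: y)
    have "take n x = take n (butlast x)"
      using lx jq by (simp add: butlast_conv_take min_def)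
    then have "sublist (take n x) (butlast x)" by simp
    then have "\<not> sublist w (take n x)"
      using bx sublist_order.order_trans by blast
    then show ?thesis using e t ly jq by (simp add: level_def avoiding_def)
  qed
  have xtake: "x = take (n + ?q - j) (take n x @ w)"
    if "j \<in> overlaps w" "x \<in> first_hits w (n + ?q - j)" for j x
  proof -
    have "take (n + ?q - j) (take n x @ w) = take (n + ?q - j) (x @ drop (?q - j) w)"
      using extend[OF that] by simp
    then show ?thesis using that(2) by (simp add: first_hits_def)
  qed
  \<comment> \<open>Two different overlaps would give stopped words of different lengths with one a
    proper prefix of the other, so the longer one would contain \<open>w\<close> too early.\<close>
  have jle: "j' \<le> j" if j: "j \<in> overlaps w" "x \<in> first_hits w (n + ?q - j)"
    and j': "j' \<in> overlaps w" "x' \<in> first_hits w (n + ?q - j')" and eq: "take n x = take n x'"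
  for j j' x x'
  proof (rule ccontr)
    assume "\<not> j' \<le> j"
    then have lt: "n + ?q - j' \<le> n + ?q - j - 1" and "j < j'"
      using j' by (auto simp: overlaps_def)
    have lx: "length x = n + ?q - j" using j by (auto simp: first_hits_def)
    have "x' = take (n + ?q - j') x"
    proof -
      have "take (n + ?q - j') x = take (n + ?q - j') (take (n + ?q - j) (take n x @ w))"
        using xtake[OF j] by simp
      also have "\<dots> = take (n + ?q - j') (take n x' @ w)"
        unfolding take_take eq using \<open>j < j'\<close> by (simp add: min_def)
      finally show ?thesis using xtake[OF j'] by simp
    qed
    then have "x' = take (n + ?q - j') (butlast x)"
      using lt lx by (simp add: butlast_conv_take)
    then have "sublist x' (butlast x)" by simp
    moreover have "sublist w x'" using j' by (auto simp: first_hits_def)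
    ultimately show False using j by (auto simp: first_hits_def dest: sublist_order.order_trans)
  qed
  have bij: "bij_betw (\<lambda>(j, x). take n x) (SIGMA j:overlaps w. first_hits w (n + ?q - j))
      (level (avoiding w) n)"
  proof (rule bij_betw_imageI)
    show "inj_on (\<lambda>(j, x). take n x) (SIGMA j:overlaps w. first_hits w (n + ?q - j))"
    proof (rule inj_onI, clarify)
      fix j x j' x'
      assume a: "j \<in> overlaps w" "x \<in> first_hits w (n + ?q - j)"
        "j' \<in> overlaps w" "x' \<in> first_hits w (n + ?q - j')" "take n x = take n x'"
      then have "j = j'" by (metis jle le_antisym)
      then show "j = j' \<and> x = x'" using a xtake by metis
    qed
    show "(\<lambda>(j, x). take n x) ` (SIGMA j:overlaps w. first_hits w (n + ?q - j)) = level (avoiding w) n"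
    proof (rule subset_antisym; rule subsetI)
      fix u assume "u \<in> (\<lambda>(j, x). take n x) ` (SIGMA j:overlaps w. first_hits w (n + ?q - j))"
      then show "u \<in> level (avoiding w) n" using extend by auto
    next
      fix u assume u: "u \<in> level (avoiding w) n"
      then have "\<not> sublist w u" "length u = n" by (auto simp: level_def avoiding_def)
      with w obtain j where j: "j \<in> overlaps w"
        "take (n + ?q - j) (u @ w) \<in> first_hits w (n + ?q - j)"
        by (metis first_occurrence)
      have "take n (take (n + ?q - j) (u @ w)) = u"
        using \<open>length u = n\<close> j(1) by (auto simp: overlaps_def)
      then show "u \<in> (\<lambda>(j, x). take n x) ` (SIGMA j:overlaps w. first_hits w (n + ?q - j))"
        using j by (intro image_eqI[of _ _ "(j, take (n + ?q - j) (u @ w))"]) auto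
    qed
  qed
  have "(\<Sum>j\<in>overlaps w. hit_sum p w (n + ?q - j) * wt p (take j w)) =
     (\<Sum>j\<in>overlaps w. \<Sum>x\<in>first_hits w (n + ?q - j). wt p (x @ drop (?q - j) w))"
    by (simp add: hit_sum_def sum_distrib_right wt_drop_overlap[OF _ pos])
  also have "\<dots> = (\<Sum>(j, x)\<in>(SIGMA j:overlaps w. first_hits w (n + ?q - j)). wt p (x @ drop (?q - j) w))"
    by (rule sum.Sigma) auto
  also have "\<dots> = (\<Sum>(j, x)\<in>(SIGMA j:overlaps w. first_hits w (n + ?q - j)). wt p (take n x @ w))"
  proof (rule sum.cong[OF refl], clarify)
    fix j x assume "j \<in> overlaps w" "x \<in> first_hits w (n + ?q - j)"
    then show "wt p (x @ drop (?q - j) w) = wt p (take n x @ w)"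
      using extend by metis
  qed
  also have "\<dots> = (\<Sum>u\<in>level (avoiding w) n. wt p (u @ w))"
    using sum.reindex_bij_betw[OF bij, of "\<lambda>u. wt p (u @ w)"] by (simp add: case_prod_unfold)
  finally show ?thesis
    by (simp add: level_sum_def sum_distrib_left mult.commute)
qed

section \<open>Generating functions of avoiding words\<close>

definition correlation :: "('k \<Rightarrow> real) \<Rightarrow> 'k list \<Rightarrow> real \<Rightarrow> real" where
  "correlation p w z = (\<Sum>j\<in>overlaps w. wt p (take j w) * z ^ j)"

lemma hit_sum_eq_0: "n < length w \<Longrightarrow> hit_sum p w n = 0"
  by (auto simp: hit_sum_def first_hits_def suffix_def intro!: sum.neutral)

lemma level_sum_0: "factorial_language V \<Longrightarrow> level_sum p V 0 = 1"
proof -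
  assume "factorial_language V"
  then have "[] \<in> V" by (simp add: factorial_language_def)
  then have "level V 0 = {[]}" by (auto simp: level_def)
  then show ?thesis by (simp add: level_sum_def)
qed

text \<open>With F and G the generating functions of level sums and hit sums, and P the sum of the
  letter weights, the two relations read G = 1 - (1 - zP) F and p(w) z^q F = c(z) G; eliminating G
  gives the claim. It is kept free of division because the second factor is only later seen to be
  nonzero.\<close>

lemma avoiding_generating_function:
  fixes p :: "'k::finite \<Rightarrow> real"
  assumes w: "w \<noteq> []" and pos: "\<And>i. 0 < p i"
    and sF: "summable (\<lambda>n. level_sum p (avoiding w) n * z ^ n)"
  shows "(\<Sum>n. level_sum p (avoiding w) n * z ^ n) *
      ((1 - z * sum p UNIV) * correlation p w z + wt p w * z ^ length w) = correlation p w z"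
proof -
  let ?q = "length w"
  define F where "F = (\<lambda>n. level_sum p (avoiding w) n * z ^ n)"
  define G where "G = (\<lambda>n. hit_sum p w n * z ^ n)"
  have F0: "F 0 = 1" by (simp add: F_def level_sum_0 factorial_language_avoiding w)
  have G0: "G i = 0" if "i < ?q" for i using that by (simp add: G_def hit_sum_eq_0)
  have sF': "summable F" using sF by (simp add: F_def)
  have GS: "G (Suc n) = z * sum p UNIV * F n - F (Suc n)" for n
    using level_sum_step[OF w, of p n] by (simp add: G_def F_def algebra_simps)
  have "(\<lambda>n. F (Suc n)) sums (suminf F - F 0)"
    using sF' by (simp add: sums_Suc_iff summable_sums)
  then have "(\<lambda>n. G (Suc n)) sums (z * sum p UNIV * suminf F - (suminf F - F 0))"
    unfolding GS by (intro sums_diff sums_mult summable_sums[OF sF'])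
  then have sG: "G sums (z * sum p UNIV * suminf F - (suminf F - 1))"
    using G0[of 0] w by (simp add: sums_Suc_iff F0)
  define g where "g = suminf G"
  have g: "g = z * sum p UNIV * suminf F - (suminf F - 1)"
    using sG by (simp add: g_def sums_iff)
  \<comment> \<open>No stopped word is shorter than \<open>w\<close>, so dropping the first
    \<open>?q - j\<close> coefficients of \<open>G\<close> does not change its sum.\<close>
  have shift: "(\<lambda>n. G (n + (?q - j))) sums g" if "j \<in> overlaps w" for j
  proof -
    have "(\<Sum>i<?q - j. G i) = 0" by (intro sum.neutral) (auto intro: G0)
    then show ?thesis using sG g by (simp add: sums_iff_shift)
  qed
  have "(\<lambda>n. \<Sum>j\<in>overlaps w. wt p (take j w) * z ^ j * G (n + (?q - j))) sums
      (\<Sum>j\<in>overlaps w. wt p (take j w) * z ^ j * g)"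
    by (intro sums_sum sums_mult shift)
  moreover have "(\<Sum>j\<in>overlaps w. wt p (take j w) * z ^ j * G (n + (?q - j))) = wt p w * z ^ ?q * F n" for n
  proof -
    have "wt p w * z ^ ?q * F n = z ^ (n + ?q) * (\<Sum>j\<in>overlaps w. hit_sum p w (n + ?q - j) * wt p (take j w))"
      using hit_sum_overlaps[OF w, of p n, OF pos] by (simp add: F_def power_add)
    also have "\<dots> = (\<Sum>j\<in>overlaps w. wt p (take j w) * z ^ j * G (n + (?q - j)))"
      unfolding sum_distrib_left
    proof (rule sum.cong[OF refl])
      fix j assume "j \<in> overlaps w"
      then have j: "n + ?q = j + (n + (?q - j))" "n + ?q - j = n + (?q - j)" by (auto simp: overlaps_def)
      show "z ^ (n + ?q) * (hit_sum p w (n + ?q - j) * wt p (take j w)) =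
          wt p (take j w) * z ^ j * G (n + (?q - j))"
        unfolding G_def j(2) by (subst j(1)) (simp add: power_add)
    qed
    finally show ?thesis ..
  qed
  ultimately have "(\<lambda>n. wt p w * z ^ ?q * F n) sums (correlation p w z * g)"
    by (simp add: correlation_def sum_distrib_right)
  moreover have "(\<lambda>n. wt p w * z ^ ?q * F n) sums (wt p w * z ^ ?q * suminf F)"
    by (intro sums_mult summable_sums sF')
  ultimately have "wt p w * z ^ ?q * suminf F = correlation p w z * g"
    by (rule sums_unique2[symmetric])
  then show ?thesis
    unfolding g F_def[symmetric] by (simp only: algebra_simps)
qed

lemma correlation_ge_1:
  assumes "w \<noteq> []" "\<And>i. 0 < p i" "0 \<le> z"
  shows "1 \<le> correlation p w z"
proof -
  have "(\<Sum>j\<in>{0}. wt p (take j w) * z ^ j) \<le> correlation p w z"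
    unfolding correlation_def using assms
    by (intro sum_mono2) (auto simp: overlaps_def less_imp_le wt_pos)
  then show ?thesis by simp
qed

text \<open>The identity says F d = c with c >= 1. Coefficients of at least 1 give F >= 1/(1-z),
  which makes the denominator d positive and at most (1-z) c.\<close>

lemma avoiding_denominator_bounds:
  fixes p :: "'k::finite \<Rightarrow> real"
  assumes w: "w \<noteq> []" and pos: "\<And>i. 0 < p i"
    and ge1: "\<And>n. 1 \<le> level_sum p (avoiding w) n"
    and sF: "summable (\<lambda>n. level_sum p (avoiding w) n * z ^ n)" and z: "0 < z" "z < 1"
  shows "0 < (1 - z * sum p UNIV) * correlation p w z + wt p w * z ^ length w"
    and "(1 - z * sum p UNIV) * correlation p w z + wt p w * z ^ length w \<le> (1 - z) * correlation p w z"
proof -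
  define F where "F = (\<Sum>n. level_sum p (avoiding w) n * z ^ n)"
  define d where "d = (1 - z * sum p UNIV) * correlation p w z + wt p w * z ^ length w"
  have c: "1 \<le> correlation p w z" using correlation_ge_1 w pos z by (metis less_imp_le)
  have "(\<Sum>n. z ^ n) \<le> F"
    unfolding F_def using z ge1 by (intro suminf_le sF summable_geometric) auto
  then have F: "1 / (1 - z) \<le> F" using z by (simp add: suminf_geometric)
  have Fd: "F * d = correlation p w z"
    unfolding F_def d_def by (rule avoiding_generating_function[OF w pos sF])
  have Fp: "0 < F" using F z by (smt (verit) divide_pos_pos)
  have "0 < F * d" using Fd c by simp
  then show d: "0 < (1 - z * sum p UNIV) * correlation p w z + wt p w * z ^ length w"
    using Fp unfolding d_def[symmetric] by (simp add: zero_less_mult_iff)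
  have "1 / (1 - z) * d \<le> F * d" using F d by (intro mult_right_mono) (auto simp: d_def)
  then show "d \<le> (1 - z) * correlation p w z" unfolding Fd using z by (simp add: field_simps)
qed

text \<open>Abel summation: the generating function has a pole at \<open>z = 1\<close>, so its denominator vanishes there.\<close>

lemma avoiding_critical_equation:
  fixes p :: "'k::finite \<Rightarrow> real"
  assumes w: "w \<noteq> []" and pos: "\<And>i. 0 < p i"
    and ge1: "\<And>n. 1 \<le> level_sum p (avoiding w) n"
    and sF: "\<And>z. 0 < z \<Longrightarrow> z < 1 \<Longrightarrow> summable (\<lambda>n. level_sum p (avoiding w) n * z ^ n)"
  shows "(sum p UNIV - 1) * correlation p w 1 = wt p w"
proof -
  let ?d = "\<lambda>z. (1 - z * sum p UNIV) * correlation p w z + wt p w * z ^ length w"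
  have "(?d \<longlongrightarrow> (1 - 1 * sum p UNIV) * correlation p w 1 + wt p w * 1 ^ length w) (at_left 1)"
    unfolding correlation_def by (intro tendsto_intros)
  moreover have "(?d \<longlongrightarrow> 0) (at_left 1)"
  proof (rule tendsto_sandwich[where f = "\<lambda>_. 0"])
    have ev: "\<forall>\<^sub>F z in at_left 1. z \<in> {0<..<1::real}"
      by (rule eventually_at_left_real) simp
    show "\<forall>\<^sub>F z in at_left 1. 0 \<le> ?d z"
      using ev by eventually_elim (use avoiding_denominator_bounds(1)[OF w pos ge1 sF] in force)
    show "\<forall>\<^sub>F z in at_left 1. ?d z \<le> (1 - z) * correlation p w z"
      using ev by eventually_elim (use avoiding_denominator_bounds(2)[OF w pos ge1 sF] in force)
    have "((\<lambda>z. (1 - z) * correlation p w z) \<longlongrightarrow> (1 - 1) * correlation p w 1) (at_left 1)"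
      unfolding correlation_def by (intro tendsto_intros)
    then show "((\<lambda>z. (1 - z) * correlation p w z) \<longlongrightarrow> 0) (at_left 1)" by simp
  qed auto
  ultimately have "(1 - 1 * sum p UNIV) * correlation p w 1 + wt p w * 1 ^ length w = 0"
    by (intro tendsto_unique) auto
  then show ?thesis by (simp add: algebra_simps)
qed

text \<open>Positivity of the denominator, with the correlation estimated below by 1 only. The
  result depends on \<open>w\<close> through its length alone, so for long holes it forces the sum
  of the letter weights down to about 1/z, for each z < 1.\<close>

lemma avoiding_critical_bound:
  fixes p :: "'k::finite \<Rightarrow> real"
  assumes w: "w \<noteq> []" and pos: "\<And>i. 0 < p i"
    and ge1: "\<And>n. 1 \<le> level_sum p (avoiding w) n"
    and sF: "summable (\<lambda>n. level_sum p (avoiding w) n * z ^ n)" and z: "0 < z" "z < 1"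
    and wt1: "wt p w \<le> 1"
  shows "z * sum p UNIV < 1 + z ^ length w"
proof (rule ccontr)
  assume "\<not> ?thesis"
  then have a: "z ^ length w \<le> z * sum p UNIV - 1" by simp
  have c: "1 \<le> correlation p w z" using correlation_ge_1 w pos z by (metis less_imp_le)
  have zq: "0 \<le> z ^ length w" using z by simp
  have "wt p w * z ^ length w \<le> z ^ length w" using wt1 zq by (simp add: mult_left_le_one_le wt_nonneg less_imp_le pos)
  also have "\<dots> \<le> (z * sum p UNIV - 1) * 1" using a by simp
  also have "\<dots> \<le> (z * sum p UNIV - 1) * correlation p w z" using a zq c by (intro mult_left_mono) auto
  finally show False
    using avoiding_denominator_bounds(1)[OF w pos ge1 sF z] by (simp add: algebra_simps)
qed

text \<open>Subadditivity of the logarithms makes the limit also the infimum. The resulting bound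
  \<open>exp (real n * L) \<le> f n\<close> holds for every \<open>n\<close>, without subexponential
  error; this is how zero pressure gives level sums of at least 1. The bound \<open>e ^ n\<close>
  keeps the infimum finite.\<close>

lemma fekete:
  fixes f :: "nat \<Rightarrow> real"
  assumes sub: "\<And>m n. f (m + n) \<le> f m * f n" and e: "0 < e" and low: "\<And>n. e ^ n \<le> f n"
  shows "\<exists>L. (\<lambda>n. 1 / real n * ln (f n)) \<longlonglongrightarrow> L \<and> (\<forall>n. exp (real n * L) \<le> f n)"
proof -
  have pos: "0 < f n" for n using low[of n] e by (meson less_le_trans zero_less_power)
  define b where "b n = ln (f n) / real n" for n
  define L where "L = Inf (b ` {1..})"
  have bdd: "bdd_below (b ` {1..})"
  proof (rule bdd_belowI)
    fix x assume "x \<in> b ` {1..}"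
    then obtain n where "1 \<le> n" "x = b n" by auto
    moreover have "real n * ln e \<le> ln (f n)"
      using low[of n] e pos[of n] by (metis ln_mono ln_realpow zero_less_power)
    ultimately show "ln e \<le> x" by (simp add: b_def pos_le_divide_eq mult.commute)
  qed
  have Lb: "L \<le> b n" if "1 \<le> n" for n
    unfolding L_def by (rule cInf_lower[OF imageI bdd]) (use that in simp)
  have iter: "ln (f (m * k + r)) \<le> real k * ln (f m) + ln (f r)" for m k r
  proof (induction k)
    case (Suc k)
    have "f (m * Suc k + r) \<le> f m * f (m * k + r)" using sub[of m "m * k + r"] by (simp add: algebra_simps)
    then have "ln (f (m * Suc k + r)) \<le> ln (f m) + ln (f (m * k + r))"
      using pos by (metis ln_mono ln_mult_pos)
    then show ?case using Suc by (simp add: algebra_simps)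
  qed simp
  have lim: "b \<longlonglongrightarrow> L"
  proof (rule LIMSEQ_I)
    fix r :: real assume r: "0 < r"
    have "\<exists>x\<in>b ` {1..}. x < L + r / 2"
      using cInf_lessD[of "b ` {1..}" "L + r / 2"] r by (auto simp: L_def)
    then obtain m where m: "1 \<le> m" "b m < L + r / 2" by auto
    define M where "M = (\<Sum>i<m. \<bar>ln (f i)\<bar>)"
    define K where "K = real m * \<bar>b m\<bar> + M"
    have up: "b n \<le> b m + K / real n" if n: "1 \<le> n" for n
    proof -
      have "ln (f n) \<le> real (n div m) * ln (f m) + ln (f (n mod m))"
        using iter[of m "n div m" "n mod m"] by simp
      also have "ln (f (n mod m)) \<le> M"
      proof -
        have "\<bar>ln (f (n mod m))\<bar> \<le> M" unfolding M_def using m by (intro member_le_sum) auto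
        then show ?thesis by simp
      qed
      also have "real (n div m) * ln (f m) = (real n - real (n mod m)) * b m"
      proof -
        have "real n = real (n div m) * real m + real (n mod m)"
          by (metis div_mult_mod_eq of_nat_add of_nat_mult)
        then show ?thesis using m by (simp add: b_def)
      qed
      also have "(real n - real (n mod m)) * b m \<le> real n * b m + real m * \<bar>b m\<bar>"
      proof -
        have "- (real (n mod m) * b m) \<le> real (n mod m) * \<bar>b m\<bar>"
          by (metis abs_ge_minus_self mult_left_mono mult_minus_right of_nat_0_le_iff)
        also have "\<dots> \<le> real m * \<bar>b m\<bar>" using m by (intro mult_right_mono) (auto intro: less_imp_le)
        finally show ?thesis by (simp add: algebra_simps)
      qed
      finally have "ln (f n) \<le> real n * b m + K" by (simp add: K_def)
      then show ?thesis using n by (simp add: b_def field_simps)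
    qed
    have "(\<lambda>n. K / real n) \<longlonglongrightarrow> 0" by (rule lim_const_over_n)
    then have "\<forall>\<^sub>F n in sequentially. K / real n < r / 2"
      by (rule order_tendstoD) (use r in simp)
    then obtain N where N: "\<And>n. n \<ge> N \<Longrightarrow> K / real n < r / 2" by (auto simp: eventually_sequentially)
    show "\<exists>no. \<forall>n\<ge>no. norm (b n - L) < r"
    proof (intro exI[of _ "max 1 N"] allI impI)
      fix n assume "n \<ge> max 1 N"
      then have "K / real n < r / 2" "b n \<le> b m + K / real n" "L \<le> b n"
        using N up Lb by auto
      then have "0 \<le> b n - L" "b n - L < r" using m by linarith+
      then show "norm (b n - L) < r" by simp
    qed
  qed
  moreover have "exp (real n * L) \<le> f n" for n
  proof (cases "n = 0")
    case True
    have "f 0 * 1 \<le> f 0 * f 0" using sub[of 0 0] by simp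
    then have "1 \<le> f 0" using pos[of 0] mult_le_cancel_left_pos by blast
    then show ?thesis using True by simp
  next
    case False
    then have "real n * L \<le> ln (f n)" using Lb[of n] by (simp add: b_def field_simps)
    then show ?thesis using pos[of n] by (simp add: ln_ge_iff)
  qed
  ultimately show ?thesis unfolding b_def by auto
qed

section \<open>Conformal measures of factorial languages\<close>

lemma factorial_languageD:
  assumes "factorial_language V" "u @ v \<in> V"
  shows "u \<in> V" "v \<in> V"
  using assms unfolding factorial_language_def by blast+

text \<open>Tychonoff: a cube with countably many factors is compact and first countable, hence
  sequentially compact. It is applied with finite words as indices.\<close>

lemma pointwise_convergent_subsequence:
  fixes h :: "nat \<Rightarrow> 'a::countable \<Rightarrow> real"
  assumes "\<And>k u. h k u \<in> {0..1}"
  shows "\<exists>r H. strict_mono r \<and> (\<forall>u. (\<lambda>k. h (r k) u) \<longlonglongrightarrow> H u)"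
proof -
  have "compactin (product_topology (\<lambda>_::'a. euclidean :: real topology) UNIV) (PiE UNIV (\<lambda>_. {0..1}))"
    by (simp add: compactin_PiE)
  then have "compact (PiE UNIV (\<lambda>_::'a. {0..1::real}))"
    by (simp add: euclidean_product_topology)
  then have "seq_compact (PiE UNIV (\<lambda>_::'a. {0..1::real}))"
    by (rule compact_imp_seq_compact)
  then obtain H r where r: "strict_mono r" and lim: "(h \<circ> r) \<longlonglongrightarrow> H"
    using assms unfolding seq_compact_def PiE_UNIV_domain Pi_iff by (metis UNIV_I)
  have "(\<lambda>k. h (r k) u) \<longlonglongrightarrow> H u" for u
    using continuous_on_tendsto_compose[OF continuous_on_product_coordinates[of u] lim] by simp
  then show ?thesis using r by blast
qed

lemma level_Suc_Cons: "level V (Suc n) = (\<Union>i. (#) i ` level {v. i # v \<in> V} n)"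
  by (auto simp: level_def length_Suc_conv)

lemma level_sum_Suc:
  fixes p :: "'k::finite \<Rightarrow> real"
  shows "level_sum p V (Suc n) = (\<Sum>i\<in>UNIV. p i * level_sum p {v. i # v \<in> V} n)"
proof -
  have "level_sum p V (Suc n) = (\<Sum>i\<in>UNIV. \<Sum>u\<in>(#) i ` level {v. i # v \<in> V} n. wt p u)"
    unfolding level_sum_def level_Suc_Cons by (rule sum.UNION_disjoint) auto
  also have "\<dots> = (\<Sum>i\<in>UNIV. p i * level_sum p {v. i # v \<in> V} n)"
    by (simp add: sum.reindex level_sum_def sum_distrib_left)
  finally show ?thesis .
qed

text \<open>The masses are \<open>wt p u * H u\<close>, where \<open>H u\<close> is a subsequential limit, as \<open>z\<close> increases to 1, of the
  ratio of the generating function of the continuations of \<open>u\<close> in \<open>V\<close> to that of \<open>V\<close> itself.\<close>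

lemma conformal_masses:
  fixes p :: "'k::finite \<Rightarrow> real"
  assumes V: "factorial_language V" and pos: "\<And>i. 0 < p i"
    and ge1: "\<And>n. 1 \<le> level_sum p V n"
    and sF: "\<And>z. 0 < z \<Longrightarrow> z < 1 \<Longrightarrow> summable (\<lambda>n. level_sum p V n * z ^ n)"
  obtains m :: "'k list \<Rightarrow> real" where "m [] = 1" "\<And>u. 0 \<le> m u" "\<And>u. m u \<le> wt p u"
    "\<And>u. (\<Sum>i\<in>UNIV. m (u @ [i])) = m u" "\<And>u. u \<notin> V \<Longrightarrow> m u = 0"
proof -
  define E where "E u n = level_sum p {v. u @ v \<in> V} n" for u n
  define F where "F u z = (\<Sum>n. E u n * z ^ n)" for u and z :: real
  have p0: "0 \<le> p i" for i using pos[of i] by simp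
  have E0: "0 \<le> E u n" for u n unfolding E_def by (rule level_sum_nonneg) (rule p0)
  have EV: "E u n \<le> level_sum p V n" for u n
  proof -
    have "level {v. u @ v \<in> V} n \<subseteq> level V n"
      using factorial_languageD(2)[OF V] by (auto simp: level_def)
    then show ?thesis
      unfolding E_def level_sum_def by (intro sum_mono2) (auto intro: wt_nonneg p0)
  qed
  have Enil: "E [] n = level_sum p V n" for n by (simp add: E_def)
  have Estep: "E u (Suc n) = (\<Sum>i\<in>UNIV. p i * E (u @ [i]) n)" for u n
    by (simp add: E_def level_sum_Suc)
  have Eout: "E u n = 0" if "u \<notin> V" for u n
  proof -
    have "{v. u @ v \<in> V} = {}" using that factorial_languageD(1)[OF V] by auto
    then show ?thesis by (simp add: E_def level_sum_def level_def)
  qed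
  have sE: "summable (\<lambda>n. E u n * z ^ n)" if "0 < z" "z < 1" for u z
    using that E0 EV by (intro summable_comparison_test'[OF sF[OF that], of 0]) (auto intro!: mult_right_mono)
  have F0: "0 \<le> F u z" if "0 < z" "z < 1" for u z
    unfolding F_def using that E0 by (intro suminf_nonneg sE) auto
  have Fle: "F u z \<le> F [] z" if "0 < z" "z < 1" for u z
    unfolding F_def using that EV[of u] by (intro suminf_le sE) (auto simp: Enil intro!: mult_right_mono)
  have Fgeo: "1 / (1 - z) \<le> F [] z" if z: "0 < z" "z < 1" for z
  proof -
    have "(\<Sum>n. z ^ n) \<le> F [] z"
      unfolding F_def using z ge1 by (intro suminf_le sE summable_geometric) (auto simp: Enil)
    then show ?thesis using z by (simp add: suminf_geometric)
  qed
  have Frec: "F u z = E u 0 + z * (\<Sum>i\<in>UNIV. p i * F (u @ [i]) z)" if z: "0 < z" "z < 1" for u z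
  proof -
    have "(\<lambda>n. z * (\<Sum>i\<in>UNIV. p i * (E (u @ [i]) n * z ^ n))) sums
        (z * (\<Sum>i\<in>UNIV. p i * F (u @ [i]) z))"
      unfolding F_def by (intro sums_mult sums_sum summable_sums sE z)
    then have "(\<lambda>n. E u (Suc n) * z ^ Suc n) sums (z * (\<Sum>i\<in>UNIV. p i * F (u @ [i]) z))"
      by (simp add: Estep sum_distrib_left sum_distrib_right algebra_simps)
    then have "(\<lambda>n. E u n * z ^ n) sums (z * (\<Sum>i\<in>UNIV. p i * F (u @ [i]) z) + E u 0)"
      using sums_Suc[of "\<lambda>n. E u n * z ^ n"] by simp
    then show ?thesis by (simp add: F_def sums_iff)
  qed
  \<comment> \<open>Chosen so that the geometric lower bound for the generating function at
    \<open>z k\<close> is exactly \<open>k + 2\<close>.\<close>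
  define z where "z k = 1 - 1 / (real k + 2)" for k
  have z: "0 < z k" "z k < 1" for k by (auto simp: z_def field_simps)
  have zlim: "z \<longlonglongrightarrow> 1" unfolding z_def by real_asymp
  define h where "h k u = F u (z k) / F [] (z k)" for k u
  have Fk: "real k + 2 \<le> F [] (z k)" for k
    using Fgeo[OF z[of k]] by (simp add: z_def)
  have h01: "h k u \<in> {0..1}" for k u
    using F0[OF z[of k], of u] Fle[OF z[of k], of u] Fk[of k] by (auto simp: h_def divide_le_eq_1)
  from pointwise_convergent_subsequence[of h, OF this]
  obtain r H where r: "strict_mono r" and H: "\<And>u. (\<lambda>k. h (r k) u) \<longlonglongrightarrow> H u"
    by blast
  have H0: "0 \<le> H u" for u by (rule LIMSEQ_le_const[OF H]) (use h01 in auto)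
  have H1: "H u \<le> 1" for u by (rule LIMSEQ_le_const2[OF H]) (use h01 in auto)
  have Hnil: "H [] = 1"
  proof -
    have "h k [] = 1" for k using Fk[of k] by (simp add: h_def)
    then show ?thesis using H[of "[]"] by (simp add: LIMSEQ_const_iff)
  qed
  have Hrec: "H u = (\<Sum>i\<in>UNIV. p i * H (u @ [i]))" for u
  proof -
    have e: "h k u = E u 0 / F [] (z k) + z k * (\<Sum>i\<in>UNIV. p i * h k (u @ [i]))" for k
      unfolding h_def by (subst Frec[OF z]) (simp add: add_divide_distrib sum_divide_distrib[symmetric])
    \<comment> \<open>The term of \<open>u\<close> itself is a fixed number while the normalising
      generating function blows up. It disappears in the limit, and exact additivity over the
      children of \<open>u\<close> remains.\<close>
    have "(\<lambda>k. E u 0 / F [] (z k)) \<longlonglongrightarrow> 0"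
    proof (rule tendsto_sandwich[where f = "\<lambda>_. 0" and h = "\<lambda>k. E u 0 / (real k + 2)"])
      show "\<forall>\<^sub>F k in sequentially. E u 0 / F [] (z k) \<le> E u 0 / (real k + 2)"
      proof (intro always_eventually allI divide_left_mono)
        show "0 < F [] (z k) * (real k + 2)" for k
          using Fk[of k] by (intro mult_pos_pos) linarith+
      qed (use Fk E0 in auto)
      show "\<forall>\<^sub>F k in sequentially. 0 \<le> E u 0 / F [] (z k)"
        using E0[of u 0] F0[OF z] by (intro always_eventually allI divide_nonneg_nonneg) auto
      show "(\<lambda>k. E u 0 / (real k + 2)) \<longlonglongrightarrow> 0" by real_asymp
    qed simp
    then have "(\<lambda>k. E u 0 / F [] (z (r k))) \<longlonglongrightarrow> 0"
      using LIMSEQ_subseq_LIMSEQ[OF _ r] by (auto simp: o_def)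
    moreover have "(\<lambda>k. z (r k)) \<longlonglongrightarrow> 1" using LIMSEQ_subseq_LIMSEQ[OF zlim r] by (simp add: o_def)
    ultimately have "(\<lambda>k. h (r k) u) \<longlonglongrightarrow> 0 + 1 * (\<Sum>i\<in>UNIV. p i * H (u @ [i]))"
      unfolding e by (intro tendsto_intros H)
    then show ?thesis using LIMSEQ_unique[OF H[of u]] by simp
  qed
  have Hout: "H u = 0" if "u \<notin> V" for u
  proof -
    have "h k u = 0" for k using Eout[OF that] by (simp add: h_def F_def)
    then show ?thesis using H[of u] by (simp add: LIMSEQ_const_iff)
  qed
  show ?thesis
  proof (rule that[of "\<lambda>u. wt p u * H u"])
    fix u
    show "(\<Sum>i\<in>UNIV. wt p (u @ [i]) * H (u @ [i])) = wt p u * H u"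
      by (subst (2) Hrec) (simp add: sum_distrib_left mult.assoc)
    show "wt p u * H u \<le> wt p u" using H1[of u] wt_nonneg[of p u] p0 by (simp add: mult_left_le)
    show "0 \<le> wt p u * H u" using H0 wt_nonneg[of p u] p0 by simp
  qed (use Hnil Hout in auto)
qed

section \<open>Streams as paths in the tree of words\<close>

primrec tree_prefix :: "('k list \<Rightarrow> 'k) \<Rightarrow> nat \<Rightarrow> 'k list" where
  "tree_prefix \<omega> 0 = []"
| "tree_prefix \<omega> (Suc n) = tree_prefix \<omega> n @ [\<omega> (tree_prefix \<omega> n)]"

text \<open>A decision function on finite words determines a stream. With independent random
  decisions it yields measures with given cylinder masses; with deterministic ones it later prolongs
  an avoiding word to a survivor.\<close>

definition tree_path :: "('k list \<Rightarrow> 'k) \<Rightarrow> 'k stream" where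
  "tree_path \<omega> = to_stream (\<lambda>n. \<omega> (tree_prefix \<omega> n))"

lemma stake_tree_path: "stake n (tree_path \<omega>) = tree_prefix \<omega> n"
  by (induction n) (simp_all add: stake_Suc tree_path_def to_stream_def del: stake.simps(2))

text \<open>The proper prefixes of \<open>w\<close> are distinct, and each of them fixes one value
  of \<open>\<omega>\<close>. The event is therefore a cylinder of the product space, and its
  probability is a product.\<close>

lemma tree_path_in_cylinder:
  "tree_path \<omega> \<in> cylinder w \<longleftrightarrow> (\<forall>u\<in>(\<lambda>j. take j w) ` {..<length w}. \<omega> u = w ! length u)"
proof (induction w rule: rev_induct)
  case (snoc i w)
  have "tree_path \<omega> \<in> cylinder (w @ [i]) \<longleftrightarrow> tree_path \<omega> \<in> cylinder w \<and> \<omega> w = i"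
    by (auto simp: cylinder_def stake_tree_path simp del: stake.simps)
  also have "\<dots> \<longleftrightarrow> (\<forall>u\<in>(\<lambda>j. take j w) ` {..<length w}. \<omega> u = w ! length u) \<and> \<omega> w = i"
    using snoc by simp
  also have "\<dots> \<longleftrightarrow> (\<forall>u\<in>(\<lambda>j. take j (w @ [i])) ` {..<length (w @ [i])}. \<omega> u = (w @ [i]) ! length u)"
    by (auto simp: lessThan_Suc nth_append)
  finally show ?case .
qed (simp add: cylinder_def)

lemma cylinder_sets [measurable]: "cylinder w \<in> sets (stream_space (count_space (UNIV :: 'k::finite set)))"
proof -
  have "cylinder w = sstart UNIV w"
    by (auto simp: sstart_eq cylinder_def list_eq_iff_nth_eq)
  then show ?thesis by (simp add: sstart_sets)
qed

text \<open>Choose a letter independently at every finite word \<open>u\<close>, with law \<open>i \<mapsto> m (u @ [i]) / m u\<close>, and follow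
  the resulting path.\<close>

lemma measure_from_masses:
  fixes m :: "'k::finite list \<Rightarrow> real"
  assumes m1: "m [] = 1" and m0: "\<And>u. 0 \<le> m u" and ms: "\<And>u. (\<Sum>i\<in>UNIV. m (u @ [i])) = m u"
  obtains M where "prob_space M" "sets M = sets (stream_space (count_space UNIV))"
    "\<And>u. emeasure M (cylinder u) = ennreal (m u)"
proof -
  \<comment> \<open>Below a word of mass 0 the conditional law is undefined; the default is harmless
    because the path reaches such a word with probability 0.\<close>
  define K where "K u = (if m u = 0 then return_pmf undefined else embed_pmf (\<lambda>i. m (u @ [i]) / m u))" for u
  have pmfK: "pmf (K u) i = m (u @ [i]) / m u" if "m u \<noteq> 0" for u i
  proof -
    have "pmf (embed_pmf (\<lambda>i. m (u @ [i]) / m u)) i = m (u @ [i]) / m u"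
    proof (rule pmf_embed_pmf)
      have "(\<integral>\<^sup>+ i. ennreal (m (u @ [i]) / m u) \<partial>count_space UNIV) = ennreal (\<Sum>i\<in>UNIV. m (u @ [i]) / m u)"
        using m0 by (simp add: nn_integral_count_space_finite)
      also have "(\<Sum>i\<in>UNIV. m (u @ [i]) / m u) = 1"
        using that ms[of u] by (simp add: sum_divide_distrib[symmetric])
      finally show "(\<integral>\<^sup>+ i. ennreal (m (u @ [i]) / m u) \<partial>count_space UNIV) = 1" by simp
    qed (use m0 in simp)
    then show ?thesis using that by (simp add: K_def)
  qed
  interpret product_prob_space "\<lambda>u. measure_pmf (K u)" UNIV
    by unfold_locales
  let ?P = "PiM UNIV (\<lambda>u. measure_pmf (K u))"
  let ?S = "stream_space (count_space (UNIV :: 'k set))"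
  have comp: "(\<lambda>\<omega>. \<omega> u) \<in> measurable ?P (count_space UNIV)" for u
    using measurable_component_singleton[of u UNIV "\<lambda>u. measure_pmf (K u)"] by simp
  have pre: "(\<lambda>\<omega>. tree_prefix \<omega> n) \<in> measurable ?P (count_space UNIV)" for n
  proof (induction n)
    case (Suc n)
    have "(\<lambda>\<omega>. u @ [\<omega> u]) \<in> measurable ?P (count_space UNIV)" for u
      by (rule measurable_compose[OF comp]) simp
    from measurable_compose_countable[where f = "\<lambda>u \<omega>. u @ [\<omega> u]", OF this Suc]
    show ?case by (simp only: tree_prefix.simps)
  qed simp
  have meas: "tree_path \<in> measurable ?P ?S"
  proof (rule measurable_stream_space2)
    fix n
    have "(\<lambda>\<omega> :: 'k list \<Rightarrow> 'k. tree_path \<omega> !! n) = (\<lambda>\<omega>. \<omega> (tree_prefix \<omega> n))"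
      by (simp add: tree_path_def to_stream_def)
    then show "(\<lambda>\<omega>. tree_path \<omega> !! n) \<in> measurable ?P (count_space UNIV)"
      using measurable_compose_countable[where f = "\<lambda>u \<omega>. \<omega> u", OF comp pre[of n]] by (simp only:)
  qed
  have space: "space ?P = UNIV" by (simp add: space_PiM)
  show ?thesis
  proof (rule that[of "distr ?P ?S tree_path"])
    show "prob_space (distr ?P ?S tree_path)" by (rule prob_space_distr[OF meas])
    show "emeasure (distr ?P ?S tree_path) (cylinder w) = ennreal (m w)" for w
    proof -
      let ?J = "(\<lambda>j. take j w) ` {..<length w}"
      have inj: "inj_on (\<lambda>j. take j w) {..<length w}"
        by (rule inj_onI) (metis length_take lessThan_iff min.absorb2 less_imp_le)
      have "emeasure (distr ?P ?S tree_path) (cylinder w) = emeasure ?P (tree_path -` cylinder w \<inter> space ?P)"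
        by (rule emeasure_distr[OF meas cylinder_sets])
      also have "tree_path -` cylinder w \<inter> space ?P = {\<omega>\<in>space ?P. \<forall>u\<in>?J. \<omega> u \<in> {w ! length u}}"
        by (auto simp: tree_path_in_cylinder)
      also have "emeasure ?P \<dots> = (\<Prod>u\<in>?J. emeasure (measure_pmf (K u)) {w ! length u})"
        by (rule emeasure_PiM_Collect) auto
      also have "\<dots> = (\<Prod>j<length w. emeasure (measure_pmf (K (take j w))) {w ! j})"
        by (subst prod.reindex[OF inj]) (auto intro!: prod.cong)
      also have "\<dots> = ennreal (\<Prod>j<length w. pmf (K (take j w)) (w ! j))"
        by (simp add: emeasure_pmf_single prod_ennreal)
      also have "(\<Prod>j<length w. pmf (K (take j w)) (w ! j)) = m w"
      proof (induction w rule: rev_induct)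
        case (snoc i w)
        have "(\<Prod>j<length (w @ [i]). pmf (K (take j (w @ [i]))) ((w @ [i]) ! j)) =
           (\<Prod>j<length w. pmf (K (take j w)) (w ! j)) * pmf (K w) i"
          by (simp add: lessThan_Suc mult.commute nth_append)
        also have "\<dots> = m w * pmf (K w) i" using snoc by simp
        also have "\<dots> = m (w @ [i])"
        proof (cases "m w = 0")
          \<comment> \<open>By additivity and nonnegativity all children of a null word are null, so
            the telescoping product survives the default law.\<close>
          case True
          then have "(\<Sum>i\<in>UNIV. m (w @ [i])) = 0" using ms by simp
          then have "m (w @ [i]) = 0" using m0 by (simp add: sum_nonneg_eq_0_iff)
          then show ?thesis using True by simp
        qed (simp add: pmfK)
        finally show ?case .
      qed (simp add: m1)
      finally show ?thesis .
    qed
  qed simp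
qed

text \<open>Passes from masses to a measure. Countably many words lie outside \<open>V\<close> and
  each has a null cylinder, so almost every stream has all its prefixes in \<open>V\<close>.\<close>

lemma conformal_measure:
  fixes p :: "'k::finite \<Rightarrow> real"
  assumes V: "factorial_language V" and pos: "\<And>i. 0 < p i"
    and ge1: "\<And>n. 1 \<le> level_sum p V n"
    and sF: "\<And>z. 0 < z \<Longrightarrow> z < 1 \<Longrightarrow> summable (\<lambda>n. level_sum p V n * z ^ n)"
  obtains M where "prob_space M" "sets M = sets (stream_space (count_space UNIV))"
    "\<And>u. emeasure M (cylinder u) \<le> ennreal (wt p u)" "AE x in M. \<forall>n. stake n x \<in> V"
proof -
  obtain m where m: "m [] = 1" "\<And>u. 0 \<le> m u" "\<And>u. m u \<le> wt p u"
    "\<And>u. (\<Sum>i\<in>UNIV. m (u @ [i])) = m u" "\<And>u. u \<notin> V \<Longrightarrow> m u = 0"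
    using conformal_masses[OF V pos ge1 sF] by blast
  obtain M where M: "prob_space M" "sets M = sets (stream_space (count_space UNIV))"
    "\<And>u. emeasure M (cylinder u) = ennreal (m u)"
    using measure_from_masses[OF m(1,2,4)] by blast
  have "AE x in M. u \<notin> V \<longrightarrow> x \<notin> cylinder u" for u
  proof (cases "u \<in> V")
    case False
    then have "cylinder u \<in> null_sets M" using M m(5) by (auto simp: null_sets_def cylinder_sets)
    then show ?thesis by (auto dest: AE_not_in)
  qed simp
  then have "AE x in M. \<forall>u. u \<notin> V \<longrightarrow> x \<notin> cylinder u" by (simp add: AE_all_countable)
  then have "AE x in M. \<forall>n. stake n x \<in> V"
    by eventually_elim (auto simp: cylinder_def)
  then show ?thesis using that M m(3) by (simp add: ennreal_leI)
qed

section \<open>Hausdorff dimension\<close>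

text \<open>The premeasure is defined by sequences of sets. A finite cover is padded with empty
  sets, which cost nothing even at \<open>s = 0\<close> by the convention in
  \<open>diam_pow\<close>.\<close>

lemma hausdorff_premeasure_finite_cover:
  fixes E :: "'a::euclidean_space set" and U :: "'i \<Rightarrow> 'a set"
  assumes I: "finite I" and cover: "E \<subseteq> (\<Union>i\<in>I. U i)"
    and U: "\<And>i. i \<in> I \<Longrightarrow> bounded (U i) \<and> diameter (U i) \<le> \<delta>" and \<delta>: "0 \<le> \<delta>"
  shows "hausdorff_premeasure \<delta> s E \<le> (\<Sum>i\<in>I. ennreal (diam_pow s (U i)))"
proof -
  obtain g where g: "bij_betw g {..<card I} I"
    using ex_bij_betw_nat_finite[OF I] by (auto simp: atLeast0LessThan)
  define W where "W n = (if n < card I then U (g n) else {})" for n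
  have gI: "g n \<in> I" if "n < card I" for n using g that by (auto simp: bij_betw_def)
  have "E \<subseteq> (\<Union>n. W n)"
  proof
    fix x assume "x \<in> E"
    then obtain i where "i \<in> I" "x \<in> U i" using cover by auto
    moreover from \<open>i \<in> I\<close> obtain n where "n < card I" "g n = i"
      using g by (metis bij_betw_imp_surj_on imageE lessThan_iff)
    ultimately show "x \<in> (\<Union>n. W n)" by (auto simp: W_def)
  qed
  moreover have "bounded (W n) \<and> diameter (W n) \<le> \<delta>" for n
    using U[OF gI] \<delta> by (simp add: W_def)
  ultimately have "hausdorff_premeasure \<delta> s E \<le> (\<Sum>n. ennreal (diam_pow s (W n)))"
    unfolding hausdorff_premeasure_def by (intro INF_lower) auto
  also have "\<dots> = (\<Sum>n<card I. ennreal (diam_pow s (W n)))"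
    by (rule suminf_finite) (auto simp: W_def diam_pow_def)
  also have "\<dots> = (\<Sum>n<card I. ennreal (diam_pow s (U (g n))))"
    by (intro sum.cong) (auto simp: W_def)
  also have "\<dots> = (\<Sum>i\<in>I. ennreal (diam_pow s (U i)))"
    by (rule sum.reindex_bij_betw[OF g])
  finally show ?thesis .
qed

lemma hausdorff_dim_le:
  assumes "0 \<le> t" "\<And>e. 0 < e \<Longrightarrow> hausdorff_measure (t + e) E = 0"
  shows "hausdorff_dim E \<le> t"
proof (rule field_le_epsilon)
  fix e :: real assume "0 < e"
  then show "hausdorff_dim E \<le> t + e"
    unfolding hausdorff_dim_def using assms by (intro cInf_lower bdd_belowI[of _ 0]) auto
qed

text \<open>The exponent \<open>r\<close> witnesses that the set under \<open>Inf\<close> is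
  nonempty; a real infimum over the empty set would carry no information.\<close>

lemma hausdorff_dim_ge:
  assumes "0 \<le> r" "hausdorff_measure r E = 0"
    and "\<And>s. 0 \<le> s \<Longrightarrow> s < t \<Longrightarrow> hausdorff_measure s E \<noteq> 0"
  shows "t \<le> hausdorff_dim E"
  unfolding hausdorff_dim_def using assms by (intro cInf_greatest) (auto simp: not_less[symmetric])

lemma dyadic_bracket:
  fixes r :: real
  assumes "0 < r" "r \<le> 1"
  obtains n :: nat where "(1/2) ^ Suc n < r" "r \<le> (1/2) ^ n"
proof -
  obtain m where m: "(1/2) ^ m < r" using real_arch_pow_inv[of r "1/2"] assms by auto
  define k where "k = (LEAST m. (1/2) ^ m < r)"
  have k: "(1/2) ^ k < r" unfolding k_def by (rule LeastI[of _ m]) (rule m)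
  then have "k \<noteq> 0" using assms by (cases k) auto
  then obtain n where n: "k = Suc n" by (cases k) auto
  have "\<not> (1/2) ^ n < r" using not_less_Least[of n "\<lambda>m. (1/2) ^ m < r"] n by (simp add: k_def)
  then show ?thesis using that[of n] k n by simp
qed

text \<open>A diameter is rounded up to a power of 1/2, at the price of the factor
  \<open>2 powr s'\<close>. Diameter 0 has no such rounding: for \<open>s = 0\<close> the unit scale
  suffices, and for \<open>s > 0\<close> all scales together show that the mass is 0.\<close>

lemma ball_mass_le_diam_pow:
  fixes K :: real and b :: "real \<Rightarrow> ennreal" and U :: "'a::euclidean_space set"
  assumes mono: "\<And>r r'. r \<le> r' \<Longrightarrow> b r \<le> b r'"
    and b: "\<And>n. b ((1/2) ^ n) \<le> ennreal (K * (1/2) powr (real n * s'))"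
    and K: "0 \<le> K" and s: "0 \<le> s" "s \<le> s'" and U: "U \<noteq> {}" "diameter U \<le> 1" "bounded U"
  shows "b (diameter U) \<le> ennreal (K * 2 powr s' * diam_pow s U)"
proof (cases "diameter U = 0")
  case True
  show ?thesis
  proof (cases "s = 0")
    case s0: True
    have "b (diameter U) \<le> b ((1/2) ^ 0)" using True by (intro mono) simp
    also have "\<dots> \<le> ennreal K" using b[of 0] by simp
    also have "\<dots> \<le> ennreal (K * 2 powr s' * diam_pow s U)"
      using K s s0 U ge_one_powr_ge_zero[of 2 s'] by (intro ennreal_leI) (simp add: diam_pow_def mult_le_cancel_left1)
    finally show ?thesis .
  next
    case False
    then have "0 < s'" using s by simp
    have "(\<lambda>n. K * (1/2) powr (real n * s')) \<longlonglongrightarrow> 0"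
    proof -
      have "(1/2) powr s' < (1/2 :: real) powr 0" using \<open>0 < s'\<close> by (intro powr_less_mono') auto
      then have "(\<lambda>n. K * ((1/2) powr s') ^ n) \<longlonglongrightarrow> K * 0"
        by (intro tendsto_intros LIMSEQ_realpow_zero) auto
      moreover have "(1/2) powr (real n * s') = ((1/2 :: real) powr s') ^ n" for n
        by (simp add: powr_powr mult.commute flip: powr_realpow)
      ultimately show ?thesis by simp
    qed
    then have lim: "(\<lambda>n. ennreal (K * (1/2) powr (real n * s'))) \<longlonglongrightarrow> ennreal 0"
      by (rule tendsto_ennrealI)
    have "b (diameter U) \<le> ennreal 0"
    proof (rule LIMSEQ_le_const[OF lim], intro exI allI impI)
      fix n :: nat
      have "b (diameter U) \<le> b ((1/2) ^ n)" using True by (intro mono) simp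
      then show "b (diameter U) \<le> ennreal (K * (1/2) powr (real n * s'))" using b[of n] by simp
    qed
    then show ?thesis by simp
  qed
next
  case False
  then have r: "0 < diameter U" using diameter_ge_0[OF U(3)] by simp
  obtain n where n: "(1/2) ^ Suc n < diameter U" "diameter U \<le> (1/2) ^ n"
    using dyadic_bracket[OF r U(2)] by blast
  have "b (diameter U) \<le> ennreal (K * (1/2) powr (real n * s'))"
    using mono[OF n(2)] b[of n] by simp
  also have "(1/2) powr (real n * s') = ((1/2) ^ n) powr s'"
    by (simp add: powr_powr[symmetric] powr_realpow)
  also have "\<dots> \<le> (2 * diameter U) powr s'"
    using n s by (intro powr_mono2) auto
  also have "\<dots> = 2 powr s' * diameter U powr s'" using r by (simp add: powr_mult)
  also have "diameter U powr s' \<le> diameter U powr s"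
    using r U s by (intro powr_mono') auto
  also have "diameter U powr s = diam_pow s U"
    using r U by (auto simp: diam_pow_def)
  finally show ?thesis
    using K by (simp add: ennreal_leI mult.assoc mult_left_mono)
qed

text \<open>Mass distribution principle with a constant \<open>\<Phi> x\<close> that depends on the
  point: being finite almost everywhere, it is bounded on a set \<open>G K\<close> of positive mass,
  and covering that set is already expensive. All masses are taken upstairs, so the image itself is
  never measured.\<close>

lemma mass_distribution:
  fixes f :: "'b \<Rightarrow> 'a::euclidean_space" and \<Phi> :: "'b \<Rightarrow> ennreal"
  assumes "prob_space M" and f: "f \<in> borel_measurable M" and \<Phi>: "\<Phi> \<in> borel_measurable M"
    and fin: "AE x in M. \<Phi> x < \<infinity>"
    and ball: "\<And>x n. x \<in> space M \<Longrightarrow> emeasure M {y \<in> space M. dist (f x) (f y) \<le> (1/2) ^ n} \<le> ennreal ((1/2) powr (real n * s')) * \<Phi> x"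
    and X: "AE x in M. x \<in> X" and s: "0 \<le> s" "s \<le> s'"
  shows "hausdorff_measure s (f ` X) \<noteq> 0"
proof
  assume H0: "hausdorff_measure s (f ` X) = 0"
  interpret prob_space M by fact
  define G where "G K = {x \<in> space M. \<Phi> x \<le> ennreal (real K)}" for K :: nat
  have Gm: "G K \<in> sets M" for K unfolding G_def using \<Phi> by measurable
  have "\<exists>K. emeasure M (G K) \<noteq> 0"
  proof (rule ccontr)
    assume "\<not> ?thesis"
    then have "(\<Union>K. G K) \<in> null_sets M" using Gm by (intro null_sets_UN) auto
    then have "AE x in M. x \<notin> (\<Union>K. G K)" by (rule AE_not_in)
    with fin AE_space have "AE x in M. False"
    proof eventually_elim
      case (elim x)
      then obtain r where "\<Phi> x = ennreal r" "0 \<le> r" by (cases "\<Phi> x") auto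
      moreover obtain K :: nat where "r \<le> real K" using real_arch_simple by blast
      ultimately show ?case using elim by (auto simp: G_def ennreal_leI)
    qed
    then show False by simp
  qed
  then obtain K where K: "emeasure M (G K) \<noteq> 0" by blast
  \<comment> \<open>The summand 1 keeps the constant positive, also when \<open>K\<close> is 0,
    since it is divided by below.\<close>
  define C where "C = real K * 2 powr s' + 1"
  have C: "0 < C" unfolding C_def by (simp add: add_nonneg_pos)
  obtain N where N: "{x \<in> space M. x \<notin> X} \<subseteq> N" "N \<in> null_sets M"
    using X by (auto elim!: AE_E simp: null_sets_def)
  have main: "emeasure M (G K) \<le> ennreal C * (\<Sum>i. ennreal (diam_pow s (U i)))"
    if cov: "f ` X \<subseteq> (\<Union>i. U i)" and U: "\<And>i. bounded (U i) \<and> diameter (U i) \<le> 1" for U :: "nat \<Rightarrow> 'a set"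
  proof -
    \<comment> \<open>A covering set that meets the image of \<open>G K\<close> is replaced by a
      ball centred at such a point, where the bound with \<open>K\<close> is available; sets that
      miss it are discarded.\<close>
    define x where "x i = (SOME x. x \<in> G K \<and> f x \<in> U i)" for i
    define B where "B i = (if \<exists>x. x \<in> G K \<and> f x \<in> U i then {y \<in> space M. dist (f (x i)) (f y) \<le> diameter (U i)} else {})" for i
    have x: "x i \<in> G K \<and> f (x i) \<in> U i" if "\<exists>x. x \<in> G K \<and> f x \<in> U i" for i
      unfolding x_def using that by (rule someI_ex)
    have "{y \<in> space M. dist c (f y) \<le> r} \<in> sets M" for c r using f by measurable
    then have Bm: "B i \<in> sets M" for i by (simp add: B_def)
    have Bi: "emeasure M (B i) \<le> ennreal C * ennreal (diam_pow s (U i))" for i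
    proof (cases "\<exists>x. x \<in> G K \<and> f x \<in> U i")
      case True
      note xi = x[OF True]
      let ?b = "\<lambda>r. emeasure M {y \<in> space M. dist (f (x i)) (f y) \<le> r}"
      have "?b (diameter (U i)) \<le> ennreal (real K * 2 powr s' * diam_pow s (U i))"
      proof (rule ball_mass_le_diam_pow)
        show "?b r \<le> ?b r'" if "r \<le> r'" for r r'
          using that f by (intro emeasure_mono) auto
        show "?b ((1/2) ^ n) \<le> ennreal (real K * (1/2) powr (real n * s'))" for n
        proof -
          have "?b ((1/2) ^ n) \<le> ennreal ((1/2) powr (real n * s')) * \<Phi> (x i)"
            using xi by (intro ball) (auto simp: G_def)
          also have "\<dots> \<le> ennreal ((1/2) powr (real n * s')) * ennreal (real K)"
            using xi by (intro mult_left_mono) (auto simp: G_def)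
          finally show ?thesis by (simp add: ennreal_mult[symmetric] mult.commute)
        qed
      qed (use xi U s in auto)
      also have "\<dots> \<le> ennreal (C * diam_pow s (U i))"
        by (intro ennreal_leI mult_right_mono) (auto simp: C_def diam_pow_def)
      also have "\<dots> = ennreal C * ennreal (diam_pow s (U i))"
        using C by (intro ennreal_mult) (auto simp: diam_pow_def)
      finally show ?thesis using True by (simp add: B_def)
    next
      case False
      then have "B i = {}" unfolding B_def by (rule if_not_P)
      then show ?thesis by simp
    qed
    have sub: "G K - N \<subseteq> (\<Union>i. B i)"
    proof
      fix y assume y: "y \<in> G K - N"
      then have "y \<in> space M" "y \<in> X" using N by (auto simp: G_def)
      then obtain i where i: "f y \<in> U i" using cov by auto
      then have ex: "\<exists>x. x \<in> G K \<and> f x \<in> U i" using y by auto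
      have "dist (f (x i)) (f y) \<le> diameter (U i)"
        using U[of i] x[OF ex] i by (intro diameter_bounded_bound) auto
      then have "y \<in> B i" using ex \<open>y \<in> space M\<close> by (auto simp: B_def)
      then show "y \<in> (\<Union>i. B i)" by blast
    qed
    have "emeasure M (G K) = emeasure M (G K - N)"
      using emeasure_Diff_null_set[OF N(2) Gm] by simp
    also have "\<dots> \<le> emeasure M (\<Union>i. B i)" using sub Bm by (intro emeasure_mono) auto
    also have "\<dots> \<le> (\<Sum>i. emeasure M (B i))" using Bm by (intro emeasure_subadditive_countably) auto
    also have "\<dots> \<le> (\<Sum>i. ennreal C * ennreal (diam_pow s (U i)))" by (intro suminf_le Bi) auto
    finally show ?thesis by simp
  qed
  have "hausdorff_premeasure 1 s (f ` X) \<le> hausdorff_measure s (f ` X)"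
    unfolding hausdorff_measure_def by (intro SUP_upper) auto
  then have "hausdorff_premeasure 1 s (f ` X) = 0" using H0 by simp
  then have "hausdorff_premeasure 1 s (f ` X) < emeasure M (G K) / ennreal C"
    using K C by (simp add: ennreal_divide_eq_0_iff zero_less_iff_neq_zero)
  then obtain U where U: "f ` X \<subseteq> (\<Union>i. U i)" "\<And>i. bounded (U i) \<and> diameter (U i) \<le> 1"
    and less: "(\<Sum>i. ennreal (diam_pow s (U i))) < emeasure M (G K) / ennreal C"
    unfolding hausdorff_premeasure_def by (auto simp: INF_less_iff)
  have "ennreal C * (\<Sum>i. ennreal (diam_pow s (U i))) < ennreal C * (emeasure M (G K) / ennreal C)"
    using less C by (intro ennreal_mult_strict_left_mono) auto
  also have "\<dots> = emeasure M (G K)" using C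
    by (metis ennreal_eq_0_iff ennreal_mult_divide_eq ennreal_neq_top ennreal_times_divide mult.commute not_le)
  finally show False using main[OF U] by simp
qed

section \<open>Transversality for diagonal systems\<close>

lemma vec_nth_nth_measurable [measurable]: "(\<lambda>v :: real^'d::finite^'k::finite. v $ i $ c) \<in> borel_measurable borel"
  by (intro borel_measurable_continuous_onI continuous_intros)

lemma vec_nth_measurable [measurable]: "(\<lambda>v :: real^'d::finite. v $ c) \<in> borel_measurable borel"
  by (intro borel_measurable_continuous_onI continuous_intros)

lemma borel_measurable_vec_lambda:
  fixes f :: "'a \<Rightarrow> 'd::finite \<Rightarrow> real"
  assumes "\<And>c. (\<lambda>x. f x c) \<in> borel_measurable M"
  shows "(\<lambda>x. (\<chi> c. f x c)) \<in> borel_measurable M"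
proof (rule borel_measurable_euclidean_space[THEN iffD2], rule ballI)
  fix b :: "real^'d" assume "b \<in> Basis"
  then obtain c where "b = axis c 1" by (auto simp: Basis_vec_def)
  then show "(\<lambda>x. (\<chi> c. f x c) \<bullet> b) \<in> borel_measurable M" using assms by (simp add: inner_axis)
qed

text \<open>Average the indicator of the slab over the translates \<open>v + u \<tau>\<close> with \<open>\<tau>\<close> in the cube \<open>[-1,1]\<^sup>d\<close>: for fixed
  \<open>v\<close> the constraints on \<open>\<tau>\<close> decouple over the coordinates.\<close>

lemma slab_volume:
  fixes l :: "'v::euclidean_space \<Rightarrow> real^'d::finite" and u :: "real^'d \<Rightarrow> 'v"
  assumes l: "l \<in> borel_measurable borel" and u: "u \<in> borel_measurable borel"
    and shift: "\<And>v \<tau> c. l (v + u \<tau>) $ c = l v $ c + \<kappa> c * \<tau> $ c"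
    and \<kappa>: "\<And>c. \<delta> \<le> \<kappa> c" and \<delta>: "0 < \<delta>"
    and B: "\<And>\<tau>. (\<And>c. \<bar>\<tau> $ c\<bar> \<le> 1) \<Longrightarrow> norm (u \<tau>) \<le> B"
    and r: "\<And>c. 0 \<le> r c"
  shows "emeasure lborel {v. norm v \<le> R \<and> (\<forall>c. \<bar>l v $ c\<bar> \<le> r c)}
    \<le> emeasure lborel (cball (0::'v) (R + B)) * ennreal (\<Prod>c\<in>UNIV. max 2 (2 / \<delta>) * min 1 (r c))"
proof -
  define S where "S = {v. norm v \<le> R \<and> (\<forall>c. \<bar>l v $ c\<bar> \<le> r c)}"
  define T where "T = cbox (\<chi> c. - 1) ((\<chi> c. 1) :: real^'d)"
  let ?P = "\<Prod>c\<in>UNIV. max 2 (2 / \<delta>) * min 1 (r c)"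
  have T: "\<tau> \<in> T \<longleftrightarrow> (\<forall>c. \<bar>\<tau> $ c\<bar> \<le> 1)" for \<tau>
    by (auto simp: T_def mem_box_cart abs_le_iff minus_le_iff)
  note [measurable] = l u
  have S [measurable]: "S \<in> sets borel" unfolding S_def by measurable
  have Tm [measurable]: "T \<in> sets borel" by (simp add: T_def)
  \<comment> \<open>The cube has volume at least 1, so integrating over its translates can only
    increase the measure to be bounded.\<close>
  have "(1::ennreal) \<le> emeasure lborel T"
  proof -
    have "T \<noteq> {}" by (simp add: T_def interval_ne_empty_cart)
    then have "measure lborel T = (\<Prod>c\<in>(UNIV::'d set). 2)"
      unfolding T_def by (subst content_cbox_cart) auto
    then show ?thesis
      by (simp add: emeasure_eq_measure2 T_def emeasure_lborel_cbox_finite one_le_power flip: ennreal_1)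
  qed
  then have "emeasure lborel S \<le> emeasure lborel T * emeasure lborel S"
    using mult_right_mono[of 1 "emeasure lborel T" "emeasure lborel S"] by simp
  also have "\<dots> = (\<integral>\<^sup>+ \<tau>. indicator T \<tau> * emeasure lborel S \<partial>lborel)"
    by (simp add: nn_integral_multc)
  also have "\<dots> = (\<integral>\<^sup>+ \<tau>. (\<integral>\<^sup>+ v. indicator T \<tau> * indicator S (v + u \<tau>) \<partial>lborel) \<partial>lborel)"
  proof (rule nn_integral_cong)
    fix \<tau> :: "real^'d"
    have "emeasure lborel S = (\<integral>\<^sup>+ v. indicator S v \<partial>distr lborel borel ((+) (u \<tau>)))"
      by (simp add: lborel_distr_plus)
    also have "\<dots> = (\<integral>\<^sup>+ v. indicator S (v + u \<tau>) \<partial>lborel)"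
      by (subst nn_integral_distr) (auto simp: add.commute)
    finally show "indicator T \<tau> * emeasure lborel S = (\<integral>\<^sup>+ v. indicator T \<tau> * indicator S (v + u \<tau>) \<partial>lborel)"
      by (simp add: nn_integral_cmult)
  qed
  also have "\<dots> = (\<integral>\<^sup>+ v. (\<integral>\<^sup>+ \<tau>. indicator T \<tau> * indicator S (v + u \<tau>) \<partial>lborel) \<partial>lborel)"
    by (rule lborel_pair.Fubini'[symmetric]) measurable
  also have "\<dots> \<le> (\<integral>\<^sup>+ v. ennreal ?P * indicator (cball (0::'v) (R + B)) v \<partial>lborel)"
  proof (rule nn_integral_mono)
    fix v :: 'v
    show "(\<integral>\<^sup>+ \<tau>. indicator T \<tau> * indicator S (v + u \<tau>) \<partial>lborel) \<le> ennreal ?P * indicator (cball (0::'v) (R + B)) v"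
    proof (cases "norm v \<le> R + B")
      case False
      have "indicator T \<tau> * indicator S (v + u \<tau>) = (0::ennreal)" for \<tau>
      proof (rule ccontr)
        assume "indicator T \<tau> * indicator S (v + u \<tau>) \<noteq> (0::ennreal)"
        then have "\<tau> \<in> T" "v + u \<tau> \<in> S" by (auto simp: indicator_def split: if_splits)
        then have "norm (u \<tau>) \<le> B" "norm (v + u \<tau>) \<le> R" using B T by (auto simp: S_def)
        moreover have "norm v \<le> norm (v + u \<tau>) + norm (u \<tau>)"
          using norm_triangle_ineq4[of "v + u \<tau>" "u \<tau>"] by simp
        ultimately show False using False by simp
      qed
      then have "(\<integral>\<^sup>+ \<tau>. indicator T \<tau> * indicator S (v + u \<tau>) \<partial>lborel) = 0"
        by (simp only: nn_integral_const mult_zero_left)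
      then show ?thesis by simp
    next
      case True
      \<comment> \<open>In coordinate \<open>c\<close> the admissible parameters form an interval of
        length at most 2, and at most \<open>2 * r c / \<kappa> c\<close>; the product of these
        lengths is the claimed bound.\<close>
      define lo where "lo = (\<chi> c. max (-1) ((- r c - l v $ c) / \<kappa> c))"
      define hi where "hi = (\<chi> c. min 1 ((r c - l v $ c) / \<kappa> c))"
      have \<kappa>0: "0 < \<kappa> c" for c using \<kappa>[of c] \<delta> by simp
      have "(\<integral>\<^sup>+ \<tau>. indicator T \<tau> * indicator S (v + u \<tau>) \<partial>lborel) \<le> (\<integral>\<^sup>+ \<tau>. indicator (cbox lo hi) \<tau> \<partial>lborel)"
      proof (rule nn_integral_mono)
        fix \<tau> :: "real^'d"
        show "indicator T \<tau> * indicator S (v + u \<tau>) \<le> (indicator (cbox lo hi) \<tau> :: ennreal)"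
        proof (cases "\<tau> \<in> T \<and> v + u \<tau> \<in> S")
          case True
          have "lo $ c \<le> \<tau> $ c \<and> \<tau> $ c \<le> hi $ c" for c
          proof -
            have "\<bar>\<tau> $ c\<bar> \<le> 1" "\<bar>l v $ c + \<kappa> c * \<tau> $ c\<bar> \<le> r c"
              using True T by (auto simp: S_def shift)
            then show ?thesis using \<kappa>0[of c]
              by (simp add: lo_def hi_def pos_divide_le_eq pos_le_divide_eq abs_le_iff algebra_simps)
          qed
          then have "\<tau> \<in> cbox lo hi" by (simp add: mem_box_cart)
          then show ?thesis using True by simp
        qed (auto simp: indicator_def)
      qed
      also have "\<dots> = emeasure lborel (cbox lo hi)" by simp
      also have "\<dots> \<le> ennreal ?P"
      proof (cases "cbox lo hi = {}")
        case False
        have "measure lborel (cbox lo hi) = (\<Prod>c\<in>UNIV. hi $ c - lo $ c)"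
          by (rule content_cbox_cart[OF False])
        also have "\<dots> \<le> ?P"
        proof (rule prod_mono)
          fix c :: 'd
          have "lo $ c \<le> hi $ c" using False by (auto simp: interval_ne_empty_cart)
          moreover have "hi $ c - lo $ c \<le> 2" by (simp add: hi_def lo_def)
          moreover have "hi $ c - lo $ c \<le> (2 / \<delta>) * r c"
          proof -
            have "hi $ c - lo $ c \<le> (r c - l v $ c) / \<kappa> c - (- r c - l v $ c) / \<kappa> c"
              by (simp add: hi_def lo_def)
            also have "\<dots> = 2 * r c / \<kappa> c" by (simp add: diff_divide_distrib[symmetric])
            also have "\<dots> \<le> 2 * r c / \<delta>" using \<kappa>[of c] \<delta> r[of c] by (intro divide_left_mono) auto
            finally show ?thesis by simp
          qed
          moreover have "(2 / \<delta>) * r c \<le> max 2 (2 / \<delta>) * r c" using r[of c] by (intro mult_right_mono) auto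
          ultimately show "0 \<le> hi $ c - lo $ c \<and> hi $ c - lo $ c \<le> max 2 (2 / \<delta>) * min 1 (r c)"
            by (auto simp: min_def)
        qed
        finally show ?thesis
          by (simp add: emeasure_eq_measure2 emeasure_lborel_cbox_finite ennreal_leI)
      qed simp
      finally show ?thesis using True by simp
    qed
  qed
  also have "\<dots> = emeasure lborel (cball (0::'v) (R + B)) * ennreal ?P"
    by (subst nn_integral_cmult_indicator) (simp_all add: mult.commute)
  finally show ?thesis unfolding S_def .
qed

text \<open>The system is reduced to its diagonal entries, of either sign, with one common bound
  \<alpha>. The condition \<alpha> < 1/2 acts through \<open>separation_pos\<close>.\<close>

locale diagonal_ifs =
  fixes a :: "'k::finite \<Rightarrow> 'd::finite \<Rightarrow> real" and \<alpha> :: real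
  assumes nz: "\<And>i c. a i c \<noteq> 0" and bound: "\<And>i c. \<bar>a i c\<bar> \<le> \<alpha>" and \<alpha>_less: "\<alpha> < 1 / 2"
begin

abbreviation "cf c w \<equiv> wt (\<lambda>i. a i c) w"

text \<open>The translations enter as an arbitrary function \<open>e\<close> of the letter. This
  makes linearity in \<open>e\<close> available both for the coordinates of \<open>v\<close> and for
  the test direction with values 1, -1 and 0.\<close>

definition coord :: "'d \<Rightarrow> ('k \<Rightarrow> real) \<Rightarrow> 'k stream \<Rightarrow> real" where
  "coord c e x = (\<Sum>m. cf c (stake m x) * e (x !! m))"

definition proj :: "real^'d^'k \<Rightarrow> 'k stream \<Rightarrow> real^'d" where
  "proj v x = (\<chi> c. coord c (\<lambda>i. v $ i $ c) x)"

lemma \<alpha>_pos: "0 < \<alpha>"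
  using nz bound by (metis abs_ge_zero abs_le_zero_iff order.trans not_le)

lemma cf_nz: "cf c w \<noteq> 0"
  by (induction w) (auto simp: nz)

lemma cf_bound: "\<bar>cf c w\<bar> \<le> \<alpha> ^ length w"
proof (induction w)
  case (Cons i w)
  then show ?case using mult_mono[OF bound[of i c] Cons] \<alpha>_pos by (simp add: abs_mult)
qed simp

lemma coord_term_bound:
  assumes "\<And>i. \<bar>e i\<bar> \<le> B"
  shows "\<bar>cf c (stake m x) * e (x !! m)\<bar> \<le> B * \<alpha> ^ m"
  using mult_mono[OF cf_bound[of c "stake m x"] assms[of "x !! m"]] \<alpha>_pos
  by (simp add: abs_mult mult.commute)

lemma geometric_sums: "(\<lambda>m. B * \<alpha> ^ m) sums (B / (1 - \<alpha>))"
  using sums_mult[OF geometric_sums[of \<alpha>], of B] \<alpha>_pos \<alpha>_less by simp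

lemma coord_summable: "summable (\<lambda>m. cf c (stake m x) * e (x !! m))"
proof (rule summable_comparison_test'[of "\<lambda>m. (\<Sum>i\<in>UNIV. \<bar>e i\<bar>) * \<alpha> ^ m" 0])
  show "summable (\<lambda>m. (\<Sum>i\<in>UNIV. \<bar>e i\<bar>) * \<alpha> ^ m)"
    using geometric_sums by (rule sums_summable)
  have "\<bar>e i\<bar> \<le> (\<Sum>i\<in>UNIV. \<bar>e i\<bar>)" for i by (rule member_le_sum) auto
  then show "norm (cf c (stake m x) * e (x !! m)) \<le> (\<Sum>i\<in>UNIV. \<bar>e i\<bar>) * \<alpha> ^ m" for m
    using coord_term_bound[of e] by simp
qed

lemma coord_bound:
  assumes "\<And>i. \<bar>e i\<bar> \<le> B"
  shows "\<bar>coord c e x\<bar> \<le> B / (1 - \<alpha>)"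
proof -
  have "norm (coord c e x) \<le> (\<Sum>m. B * \<alpha> ^ m)"
    unfolding coord_def
  proof (rule norm_suminf_le)
    show "summable (\<lambda>m. B * \<alpha> ^ m)" using geometric_sums by (rule sums_summable)
    show "norm (cf c (stake m x) * e (x !! m)) \<le> B * \<alpha> ^ m" for m
      using coord_term_bound[OF assms] by simp
  qed
  then show ?thesis using geometric_sums[of B] by (simp add: sums_iff)
qed

lemma coord_sums: "(\<lambda>m. cf c (stake m x) * e (x !! m)) sums coord c e x"
  unfolding coord_def by (rule summable_sums[OF coord_summable])

lemma coord_step: "coord c e x = e (shd x) + a (shd x) c * coord c e (stl x)"
proof -
  have "(\<lambda>m. cf c (stake (Suc m) x) * e (x !! Suc m)) sums (a (shd x) c * coord c e (stl x))"
    using sums_mult[OF coord_sums[of c "stl x" e], of "a (shd x) c"] by (simp add: mult.assoc)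
  from sums_Suc[OF this] show ?thesis using sums_unique2[OF coord_sums[of c x e]] by simp
qed

lemma coord_affine: "coord c (\<lambda>i. e i + t * e' i) x = coord c e x + t * coord c e' x"
proof -
  have "(\<lambda>m. cf c (stake m x) * e (x !! m) + t * (cf c (stake m x) * e' (x !! m))) sums
      (coord c e x + t * coord c e' x)"
    by (intro sums_add sums_mult coord_sums)
  then have "(\<lambda>m. cf c (stake m x) * (e (x !! m) + t * e' (x !! m))) sums (coord c e x + t * coord c e' x)"
    by (simp add: algebra_simps)
  with coord_sums show ?thesis by (rule sums_unique2)
qed

lemma coord_diff_common_prefix:
  assumes "stake n x = stake n y"
  shows "coord c e x - coord c e y = cf c (stake n x) * (coord c e (sdrop n x) - coord c e (sdrop n y))"
  using assms
proof (induction n arbitrary: x y)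
  case (Suc n)
  then have "shd x = shd y" "stake n (stl x) = stake n (stl y)" by auto
  then have "coord c e x - coord c e y = a (shd x) c * (coord c e (stl x) - coord c e (stl y))"
    by (simp add: coord_step[of c e x] coord_step[of c e y] algebra_simps)
  then show ?case using Suc.IH[of "stl x" "stl y"] \<open>stake n (stl x) = stake n (stl y)\<close>
    by (simp add: mult.assoc)
qed simp

lemma coord_measurable [measurable]:
  "(\<lambda>(v, x). coord c (\<lambda>i. v $ i $ c) x) \<in> borel_measurable (borel \<Otimes>\<^sub>M stream_space (count_space UNIV))"
proof -
  have st: "stake m \<in> measurable (stream_space (count_space UNIV)) (count_space (UNIV :: 'k list set))" for m
    by measurable
  have "(\<lambda>z :: (real^'d^'k) \<times> 'k stream. cf c (stake m (snd z)) * fst z $ (snd z !! m) $ c)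
      \<in> borel_measurable (borel \<Otimes>\<^sub>M stream_space (count_space UNIV))" for m
  proof (rule borel_measurable_times)
    show "(\<lambda>z. cf c (stake m (snd z))) \<in> borel_measurable ((borel :: (real^'d^'k) measure) \<Otimes>\<^sub>M stream_space (count_space UNIV))"
      by (rule measurable_compose[OF measurable_snd measurable_compose[OF st]]) simp
    have "(\<lambda>z. snd z !! m) \<in> measurable ((borel :: (real^'d^'k) measure) \<Otimes>\<^sub>M stream_space (count_space UNIV)) (count_space (UNIV :: 'k set))"
      by measurable
    moreover have "(\<lambda>z :: (real^'d^'k) \<times> 'k stream. fst z $ i $ c) \<in> borel_measurable (borel \<Otimes>\<^sub>M stream_space (count_space UNIV))" for i
      by measurable
    ultimately show "(\<lambda>z :: (real^'d^'k) \<times> 'k stream. fst z $ (snd z !! m) $ c) \<in> borel_measurable (borel \<Otimes>\<^sub>M stream_space (count_space UNIV))"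
      by (rule measurable_compose_countable[rotated])
  qed
  then show ?thesis unfolding coord_def case_prod_beta by (rule borel_measurable_suminf)
qed

lemma proj_measurable [measurable]:
  "(\<lambda>(v, x). proj v x) \<in> borel_measurable (borel \<Otimes>\<^sub>M stream_space (count_space UNIV))"
  unfolding proj_def case_prod_beta
  by (rule borel_measurable_vec_lambda) (use coord_measurable in \<open>simp add: case_prod_beta\<close>)

text \<open>Lower bound for the linear form of a coordinate difference at the test direction: the
  first letters contribute 1 - (-1) = 2, and each of the two tails takes away at most
  \<alpha>/(1-\<alpha>). It is positive because \<alpha> < 1/2.\<close>

definition separation :: real where "separation = 2 - 2 * \<alpha> / (1 - \<alpha>)"

lemma separation_pos: "0 < separation"
  using \<alpha>_less by (simp add: separation_def field_simps)

text \<open>Moving the translation of letter \<open>shd x\<close> by \<tau> and that of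
  \<open>shd y\<close> by -\<tau> moves every coordinate of the difference at rate at least
  \<open>separation\<close>. The radii may differ between coordinates, as the slabs coming from a
  common prefix are anisotropic. The ball grows by CARD('k) * CARD('d), a crude l1 bound for the
  displacement.\<close>

lemma transversality:
  fixes x y :: "'k stream"
  assumes ne: "shd x \<noteq> shd y" and r: "\<And>c. 0 \<le> r c"
  shows "emeasure lborel {v. norm v \<le> R \<and> (\<forall>c. \<bar>proj v x $ c - proj v y $ c\<bar> \<le> r c)}
    \<le> emeasure lborel (cball (0 :: real^'d^'k) (R + real CARD('k) * real CARD('d)))
      * ennreal (\<Prod>c\<in>UNIV. max 2 (2 / separation) * min 1 (r c))"
proof -
  define e where "e i = (if i = shd x then 1 else if i = shd y then -1 else 0 :: real)" for i
  have e1: "\<bar>e i\<bar> \<le> 1" for i by (simp add: e_def)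
  define u :: "real^'d \<Rightarrow> real^'d^'k" where "u \<tau> = (\<chi> i. e i *\<^sub>R \<tau>)" for \<tau>
  define l where "l v = proj v x - proj v y" for v
  have pm: "(\<lambda>v. proj v z) \<in> borel_measurable borel" for z
  proof -
    have "(\<lambda>v. (v, z)) \<in> measurable borel ((borel :: (real^'d^'k) measure) \<Otimes>\<^sub>M stream_space (count_space UNIV))"
      by (rule measurable_Pair) (auto simp: space_stream_space)
    from measurable_compose[OF this proj_measurable] show ?thesis by simp
  qed
  have l: "l \<in> borel_measurable borel"
    unfolding l_def by (intro borel_measurable_diff pm)
  have u: "u \<in> borel_measurable borel"
    unfolding u_def by (intro borel_measurable_continuous_onI continuous_on_vec_lambda continuous_intros)
  have "norm (u \<tau>) \<le> real CARD('k) * real CARD('d)" if \<tau>: "\<And>c. \<bar>\<tau> $ c\<bar> \<le> 1" for \<tau>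
  proof -
    have "norm \<tau> \<le> (\<Sum>c\<in>UNIV. \<bar>\<tau> $ c\<bar>)" by (rule norm_le_l1_cart)
    also have "\<dots> \<le> (\<Sum>c\<in>(UNIV::'d set). 1)" by (intro sum_mono \<tau>)
    finally have n: "norm \<tau> \<le> real CARD('d)" by simp
    have "norm (u \<tau>) \<le> (\<Sum>i\<in>UNIV. norm (u \<tau> $ i))"
      unfolding norm_vec_def by (rule L2_set_le_sum) simp
    also have "\<dots> \<le> (\<Sum>i\<in>(UNIV::'k set). real CARD('d))"
    proof (rule sum_mono)
      fix i
      have "\<bar>e i\<bar> * norm \<tau> \<le> 1 * real CARD('d)" using e1 n by (intro mult_mono) auto
      then show "norm (u \<tau> $ i) \<le> real CARD('d)" by (simp add: u_def)
    qed
    finally show ?thesis by simp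
  qed
  note B = this
  have shift: "l (v + u \<tau>) $ c = l v $ c + (coord c e x - coord c e y) * \<tau> $ c" for v \<tau> c
    using coord_affine[of c "\<lambda>i. v $ i $ c" "\<tau> $ c" e]
    by (simp add: l_def proj_def u_def algebra_simps)
  have "separation \<le> coord c e x - coord c e y" for c
  proof -
    have s: "\<bar>a i c * coord c e z\<bar> \<le> \<alpha> / (1 - \<alpha>)" for i z
      using mult_mono[OF bound[of i c] coord_bound[of e 1 c z]] e1 \<alpha>_pos by (simp add: abs_mult)
    have "coord c e x = 1 + a (shd x) c * coord c e (stl x)" using coord_step[of c e x] by (simp add: e_def)
    moreover have "coord c e y = - 1 + a (shd y) c * coord c e (stl y)"
      using coord_step[of c e y] ne by (simp add: e_def)
    ultimately show ?thesis
      using s[of "shd x" "stl x"] s[of "shd y" "stl y"] by (simp add: separation_def)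
  qed
  from slab_volume[of l u, OF l u shift this separation_pos B r, of R]
  show ?thesis by (simp add: l_def)
qed

end

text \<open>\<open>phi D s b\<close> is $\phi_D^s(\mathrm{diag}\, b)$: the exponents $1,\dots,1,s-\lfloor s\rfloor,0,\dots,0$ are
  \<open>cap s j\<close>, which makes \<open>phi\<close> visibly multiplicative in \<open>b\<close> and log-Lipschitz in \<open>s\<close>.\<close>

definition cap :: "real \<Rightarrow> nat \<Rightarrow> real" where
  "cap s j = min 1 (max 0 (s - real j))"

definition phi :: "'d list \<Rightarrow> real \<Rightarrow> ('d \<Rightarrow> real) \<Rightarrow> real" where
  "phi D s b = (\<Prod>j<length D. \<bar>b (D ! j)\<bar> powr cap s j)"

lemma cap_bounds: "0 \<le> cap s j" "cap s j \<le> 1"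
  by (auto simp: cap_def)

lemma cap_mono: "s \<le> t \<Longrightarrow> cap s j \<le> cap t j"
  by (auto simp: cap_def)

lemma sum_cap: "0 \<le> s \<Longrightarrow> (\<Sum>j<n. cap s j) = min s (real n)"
  by (induction n) (auto simp: cap_def)

lemma orderings_props:
  assumes "D \<in> (orderings :: 'd::finite list set)"
  shows "distinct D" "set D = UNIV" "length D = CARD('d)"
  using assms by (auto simp: permutations_of_set_def distinct_card[symmetric])

lemma prod_ordering:
  fixes D :: "'d::finite list"
  assumes "D \<in> orderings"
  shows "(\<Prod>c\<in>UNIV. f c) = (\<Prod>j<length D. f (D ! j))"
  using orderings_props[OF assms] bij_betw_nth[of D "{..<length D}" UNIV]
  by (subst prod.reindex_bij_betw[symmetric, of "\<lambda>j. D ! j" "{..<length D}"]) auto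

lemma phi_pos: "(\<And>c. b c \<noteq> 0) \<Longrightarrow> 0 < phi D s b"
  unfolding phi_def by (intro prod_pos) auto

lemma phi_mult: "phi D s (\<lambda>c. b c * b' c) = phi D s b * phi D s b'"
  by (simp add: phi_def abs_mult powr_mult prod.distrib)

lemma phi_wt: "phi D s (\<lambda>c. wt (\<lambda>i. a i c) w) = wt (\<lambda>i. phi D s (a i)) w"
proof (induction w)
  case (Cons i w)
  then show ?case using phi_mult[of D s "a i" "\<lambda>c. wt (\<lambda>i. a i c) w"] by simp
qed (simp add: phi_def)

lemma prod_powr_cap:
  assumes "D \<in> (orderings :: 'd::finite list set)" "0 < r" "0 \<le> s" "s \<le> real CARD('d)"
  shows "(\<Prod>j<length D. r powr cap s j) = r powr s"
  using assms orderings_props(3)[OF assms(1)]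
  by (simp add: powr_sum[symmetric] sum_cap)

text \<open>After scaling by \<open>r\<close> each factor is a power with exponent in [0,1], hence
  at most \<open>max 1\<close> of its base, and the exponents add up to \<open>s\<close>. The bound
  does not involve \<open>D\<close>; with the equality case it shows that a decreasing ordering
  maximises \<open>phi\<close>.\<close>

lemma phi_le_dual:
  fixes b :: "'d::finite \<Rightarrow> real"
  assumes D: "D \<in> orderings" and r: "0 < r" and s: "0 \<le> s" "s \<le> real CARD('d)" and b: "\<And>c. b c \<noteq> 0"
  shows "phi D s b \<le> r powr s * (\<Prod>c\<in>UNIV. max 1 (\<bar>b c\<bar> / r))"
proof -
  have "phi D s b = (\<Prod>j<length D. r powr cap s j * (\<bar>b (D ! j)\<bar> / r) powr cap s j)"
    unfolding phi_def using r by (intro prod.cong refl) (simp add: powr_mult[symmetric])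
  also have "\<dots> \<le> (\<Prod>j<length D. r powr cap s j * max 1 (\<bar>b (D ! j)\<bar> / r))"
  proof (intro prod_mono conjI mult_left_mono)
    fix j
    let ?x = "\<bar>b (D ! j)\<bar> / r"
    have x: "0 < ?x" using b r by simp
    show "?x powr cap s j \<le> max 1 ?x"
    proof (cases "1 \<le> ?x")
      case True
      then have "?x powr cap s j \<le> ?x powr 1" using cap_bounds by (intro powr_mono) auto
      then show ?thesis using x by simp
    next
      case False
      then show ?thesis using x cap_bounds[of s j] by (simp add: powr_le1 max_def)
    qed
  qed auto
  also have "\<dots> = r powr s * (\<Prod>c\<in>UNIV. max 1 (\<bar>b c\<bar> / r))"
    by (simp add: prod.distrib prod_powr_cap[OF D r s] prod_ordering[OF D])
  finally show ?thesis .
qed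

text \<open>Reciprocal form of the same estimate, by min(1, x) <= x^e for 0 <= e <= 1. It converts
  the product of slab widths from \<open>transversality\<close> into a power of the distance over
  \<open>phi\<close>, for any ordering.\<close>

lemma phi_ge_dual:
  fixes b :: "'d::finite \<Rightarrow> real"
  assumes D: "D \<in> orderings" and r: "0 < r" and s: "0 \<le> s" "s \<le> real CARD('d)" and b: "\<And>c. b c \<noteq> 0"
  shows "(\<Prod>c\<in>UNIV. min 1 (r / \<bar>b c\<bar>)) \<le> r powr s / phi D s b"
proof -
  have "(\<Prod>c\<in>UNIV. min 1 (r / \<bar>b c\<bar>)) = (\<Prod>j<length D. min 1 (r / \<bar>b (D ! j)\<bar>))"
    by (rule prod_ordering[OF D])
  also have "\<dots> \<le> (\<Prod>j<length D. r powr cap s j / \<bar>b (D ! j)\<bar> powr cap s j)"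
  proof (intro prod_mono conjI)
    fix j
    let ?x = "r / \<bar>b (D ! j)\<bar>"
    have x: "0 < ?x" using b r by simp
    then show "0 \<le> min 1 ?x" by linarith
    have "min 1 ?x \<le> ?x powr cap s j"
    proof (cases "1 \<le> ?x")
      case True
      then show ?thesis using cap_bounds[of s j] by (simp add: ge_one_powr_ge_zero)
    next
      case False
      then have "?x powr 1 \<le> ?x powr cap s j" using x r cap_bounds[of s j] by (intro powr_mono') auto
      then show ?thesis using x r by simp
    qed
    then show "min 1 ?x \<le> r powr cap s j / \<bar>b (D ! j)\<bar> powr cap s j"
      using r by (simp add: powr_divide)
  qed
  also have "\<dots> = r powr s / phi D s b"
    by (simp add: prod_dividef prod_powr_cap[OF D r s] phi_def)
  finally show ?thesis .
qed

text \<open>The increments \<open>cap t j - cap s j\<close> are nonnegative with sum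
  \<open>t - s\<close>, so the quotient of the two values is a product of powers of total degree
  \<open>t - s\<close>.\<close>

lemma phi_mono_exponent:
  fixes b :: "'d::finite \<Rightarrow> real"
  assumes D: "D \<in> orderings" and s: "0 \<le> s" "s \<le> t" "t \<le> real CARD('d)" and b: "\<And>c. b c \<noteq> 0"
    and lo: "0 < lo" "\<And>c. lo \<le> \<bar>b c\<bar>" and hi: "\<And>c. \<bar>b c\<bar> \<le> hi"
  shows "phi D t b \<le> phi D s b * hi powr (t - s)" "phi D s b * lo powr (t - s) \<le> phi D t b"
proof -
  have hp: "0 < hi" using lo hi by (meson less_le_trans)
  have sum: "(\<Sum>j<length D. cap t j - cap s j) = t - s"
    using s orderings_props(3)[OF D] by (simp add: sum_subtractf sum_cap)
  have e: "phi D t b = phi D s b * (\<Prod>j<length D. \<bar>b (D ! j)\<bar> powr (cap t j - cap s j))"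
    unfolding phi_def prod.distrib[symmetric] by (intro prod.cong refl) (simp add: b powr_add[symmetric])
  have "(\<Prod>j<length D. \<bar>b (D ! j)\<bar> powr (cap t j - cap s j)) \<le> (\<Prod>j<length D. hi powr (cap t j - cap s j))"
    using hi cap_mono[OF s(2)] by (intro prod_mono conjI powr_mono2) auto
  also have "\<dots> = hi powr (t - s)" using hp sum by (simp add: powr_sum[symmetric])
  finally show "phi D t b \<le> phi D s b * hi powr (t - s)"
    unfolding e using phi_pos[of b D s, OF b] by (intro mult_left_mono) auto
  have "lo powr (t - s) = (\<Prod>j<length D. lo powr (cap t j - cap s j))"
    using lo sum by (simp add: powr_sum[symmetric])
  also have "\<dots> \<le> (\<Prod>j<length D. \<bar>b (D ! j)\<bar> powr (cap t j - cap s j))"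
    using lo cap_mono[OF s(2)] by (intro prod_mono conjI powr_mono2) (auto intro: less_imp_le)
  finally show "phi D s b * lo powr (t - s) \<le> phi D t b"
    unfolding e using phi_pos[of b D s, OF b] by (intro mult_left_mono) auto
qed

lemma D_function_eq_phi:
  fixes M :: "real^'d::finite^'d"
  assumes D: "D \<in> orderings" and s: "0 \<le> s" "s \<le> real CARD('d)" and M: "\<And>c. M $ c $ c \<noteq> 0"
  shows "D_function D s M = phi D s (\<lambda>c. M $ c $ c)"
proof -
  define m where "m = nat \<lfloor>s\<rfloor>"
  let ?f = "\<lambda>j. \<bar>M $ (D ! j) $ (D ! j)\<bar>"
  have ms: "real m \<le> s" "s < real m + 1" using s(1) by (auto simp: m_def)
  have fl: "real_of_int \<lfloor>s\<rfloor> = real m" using s(1) by (simp add: m_def)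
  have len: "length D = CARD('d)" using orderings_props[OF D] by simp
  have md: "m \<le> length D" using ms s len by linarith
  have "(\<Prod>i = 1..m. ?f (i - 1)) = (\<Prod>j<m. ?f j)"
    by (rule prod.reindex_bij_witness[where i = Suc and j = "\<lambda>i. i - 1"]) auto
  also have "\<dots> = (\<Prod>j<m. ?f j powr cap s j)"
    using ms by (intro prod.cong refl) (auto simp: cap_def)
  finally have p1: "(\<Prod>i = 1..m. ?f (i - 1)) = (\<Prod>j<m. ?f j powr cap s j)" .
  \<comment> \<open>For integral \<open>s\<close> all exponents from position \<open>m\<close> on
    vanish; \<open>m\<close> may then equal the length of \<open>D\<close>, and the product is
    empty.\<close>
  have p2: "(\<Prod>j\<in>{m..<length D}. ?f j powr cap s j) = (if s \<in> \<int> then 1 else ?f m powr (s - real m))"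
  proof (cases "s \<in> \<int>")
    case True
    then have "s = real m" using fl by (metis Ints_cases floor_of_int)
    then show ?thesis using True M by (auto simp: cap_def intro!: prod.neutral)
  next
    case False
    then have "s \<noteq> real m" by auto
    then have "real m < s" using ms by simp
    then have lt: "m < length D" using s len by linarith
    have "(\<Prod>j\<in>{m..<length D}. ?f j powr cap s j) = ?f m powr cap s m * (\<Prod>j\<in>{Suc m..<length D}. ?f j powr cap s j)"
      using lt by (simp add: prod.atLeast_Suc_lessThan)
    also have "(\<Prod>j\<in>{Suc m..<length D}. ?f j powr cap s j) = 1"
      using ms M by (intro prod.neutral) (auto simp: cap_def)
    also have "cap s m = s - real m" using ms by (simp add: cap_def)
    finally show ?thesis using False by simp
  qed
  have "phi D s (\<lambda>c. M $ c $ c) = (\<Prod>j<m. ?f j powr cap s j) * (\<Prod>j\<in>{m..<length D}. ?f j powr cap s j)"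
  proof -
    have "{..<length D} = {..<m} \<union> {m..<length D}" using md by auto
    then show ?thesis unfolding phi_def by (simp add: prod.union_disjoint[symmetric] ivl_disj_int)
  qed
  then show ?thesis
    unfolding p1[symmetric] p2 by (simp add: D_function_def Let_def fl m_def[symmetric])
qed

lemma exists_sorted_ordering:
  fixes b :: "'d::finite \<Rightarrow> real"
  obtains D where "D \<in> orderings" "\<And>i j. i \<le> j \<Longrightarrow> j < length D \<Longrightarrow> b (D ! j) \<le> b (D ! i)"
proof -
  obtain xs where xs: "set xs = (UNIV :: 'd set)" "distinct xs"
    using finite_distinct_list[of "UNIV :: 'd set"] by auto
  let ?D = "sort_key (\<lambda>c. - b c) xs"
  have "?D \<in> orderings" using xs by (simp add: permutations_of_set_def)
  moreover have "b (?D ! j) \<le> b (?D ! i)" if "i \<le> j" "j < length ?D" for i j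
    using sorted_nth_mono[OF sorted_sort_key[of "\<lambda>c. - b c" xs], of i j] that by simp
  ultimately show ?thesis using that by blast
qed

text \<open>Equality case of the bound \<open>phi_le_dual\<close>: take the threshold \<open>r\<close> to be the entry at position \<open>\<lfloor>s\<rfloor>\<close>
  (capped at the last one) in decreasing order.\<close>

lemma phi_sorted_eq:
  fixes b :: "'d::finite \<Rightarrow> real"
  assumes D: "D \<in> orderings" and sorted: "\<And>i j. i \<le> j \<Longrightarrow> j < length D \<Longrightarrow> \<bar>b (D ! j)\<bar> \<le> \<bar>b (D ! i)\<bar>"
    and s: "0 \<le> s" "s \<le> real CARD('d)" and b: "\<And>c. b c \<noteq> 0"
  obtains c where "phi D s b = \<bar>b c\<bar> powr s * (\<Prod>e\<in>UNIV. max 1 (\<bar>b e\<bar> / \<bar>b c\<bar>))"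
proof -
  have len: "length D = CARD('d)" using orderings_props[OF D] by simp
  define m where "m = min (nat \<lfloor>s\<rfloor>) (length D - 1)"
  have m: "m < length D" 
  proof -
    have "0 < CARD('d)" by simp
    then show ?thesis using len unfolding m_def by linarith
  qed
  have lo: "cap s j = 1" if "j < m" for j
  proof -
    have "j + 1 \<le> nat \<lfloor>s\<rfloor>" using that by (simp add: m_def)
    then have "real j + 1 \<le> s" using s(1) by linarith
    then show ?thesis by (simp add: cap_def)
  qed
  have hi: "cap s j = 0" if "m < j" "j < length D" for j
  proof -
    have "nat \<lfloor>s\<rfloor> < j" using that by (auto simp: m_def min_def split: if_splits)
    then have "s \<le> real j" by linarith
    then show ?thesis by (simp add: cap_def)
  qed
  define r where "r = \<bar>b (D ! m)\<bar>"
  have r: "0 < r" using b by (simp add: r_def)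
  have "phi D s b = (\<Prod>j<length D. r powr cap s j * (\<bar>b (D ! j)\<bar> / r) powr cap s j)"
    unfolding phi_def using r by (intro prod.cong refl) (simp add: powr_mult[symmetric])
  also have "\<dots> = (\<Prod>j<length D. r powr cap s j * max 1 (\<bar>b (D ! j)\<bar> / r))"
  proof (intro prod.cong refl)
    fix j assume j: "j \<in> {..<length D}"
    consider "j < m" | "j = m" | "m < j" by linarith
    then show "r powr cap s j * (\<bar>b (D ! j)\<bar> / r) powr cap s j = r powr cap s j * max 1 (\<bar>b (D ! j)\<bar> / r)"
    proof cases
      case 1
      then have "r \<le> \<bar>b (D ! j)\<bar>" using sorted[of j m] m by (simp add: r_def)
      then show ?thesis using 1 lo r by (simp add: max_def)
    next
      case 2
      then show ?thesis using r by (simp add: r_def[symmetric])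
    next
      case 3
      then have "\<bar>b (D ! j)\<bar> \<le> r" using sorted[of m j] j by (simp add: r_def)
      then show ?thesis using 3 hi[of j] j r b by (simp add: max_def)
    qed
  qed
  also have "\<dots> = r powr s * (\<Prod>c\<in>UNIV. max 1 (\<bar>b c\<bar> / r))"
    by (simp add: prod.distrib prod_powr_cap[OF D r s] prod_ordering[OF D])
  finally show ?thesis using that[of "D ! m"] by (simp add: r_def)
qed

lemma stream_eqI: "(\<And>n. x !! n = y !! n) \<Longrightarrow> x = y"
  using smap_alt[of "\<lambda>i. i" x y] by (simp add: stream.map_ident)

lemma ennreal_le_suminf: "f n \<le> (\<Sum>i. f i)" for f :: "nat \<Rightarrow> ennreal"
  using sum_le_suminf[OF summableI, of "{n}" f] by simp

context diagonal_ifs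
begin

lemma proj_measurable' [measurable (raw)]:
  assumes "f \<in> borel_measurable N" "g \<in> measurable N (stream_space (count_space UNIV))"
  shows "(\<lambda>z. proj (f z) (g z)) \<in> borel_measurable N"
proof -
  have "(\<lambda>z. (f z, g z)) \<in> measurable N (borel \<Otimes>\<^sub>M stream_space (count_space UNIV))"
    using assms by measurable
  from measurable_compose[OF this proj_measurable] show ?thesis by simp
qed

lemma proj_measurable_fst [measurable]: "(\<lambda>v. proj v z) \<in> borel_measurable borel"
  by (rule proj_measurable') (auto simp: space_stream_space)

lemma phi_cf_pos: "0 < phi D s (\<lambda>c. cf c w)"
  by (rule phi_pos) (rule cf_nz)

lemma phi_cf_exponent:
  assumes D: "D \<in> orderings" and s: "0 \<le> s" "s \<le> t" "t \<le> real CARD('d)"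
  shows "phi D t (\<lambda>c. cf c w) \<le> phi D s (\<lambda>c. cf c w) * (\<alpha> powr (t - s)) ^ length w"
proof -
  define lo where "lo = Min (range (\<lambda>c. \<bar>cf c w\<bar>))"
  have lo: "0 < lo" "lo \<le> \<bar>cf c w\<bar>" for c
    unfolding lo_def using cf_nz by (auto simp: Min_gr_iff)
  have "phi D t (\<lambda>c. cf c w) \<le> phi D s (\<lambda>c. cf c w) * (\<alpha> ^ length w) powr (t - s)"
    by (rule phi_mono_exponent(1)[OF D s]) (use cf_nz lo cf_bound in auto)
  also have "(\<alpha> ^ length w) powr (t - s) = (\<alpha> powr (t - s)) ^ length w"
    using \<alpha>_pos by (simp add: powr_powr mult.commute flip: powr_realpow)
  finally show ?thesis .
qed

definition vol :: "real \<Rightarrow> real" where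
  "vol R = measure lborel (cball (0 :: real^'d^'k) (R + real CARD('k) * real CARD('d))) * max 2 (2 / separation) ^ CARD('d)"

lemma vol_nonneg: "0 \<le> vol R"
  by (simp add: vol_def)

text \<open>A common prefix scales coordinate \<open>c\<close> by \<open>cf c (stake n x)\<close>,
  so distance at most \<rho> becomes a slab with radii \<rho> divided by these factors, for streams
  differing in the first letter. Any ordering may be used in the final bound, in particular the one
  governing the measure.\<close>

lemma near_volume:
  fixes x y :: "'k stream"
  assumes D: "D \<in> orderings" and s: "0 \<le> s" "s \<le> real CARD('d)" and \<rho>: "0 < \<rho>"
    and pre: "stake n x = stake n y" and ne: "x !! n \<noteq> y !! n"
  shows "emeasure lborel {v. norm v \<le> R \<and> dist (proj v x) (proj v y) \<le> \<rho>}
    \<le> ennreal (vol R * \<rho> powr s / phi D s (\<lambda>c. cf c (stake n x)))"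
proof -
  let ?w = "stake n x"
  let ?r = "\<lambda>c. \<rho> / \<bar>cf c ?w\<bar>"
  let ?x = "sdrop n x" and ?y = "sdrop n y"
  have sub: "{v. norm v \<le> R \<and> dist (proj v x) (proj v y) \<le> \<rho>}
      \<subseteq> {v. norm v \<le> R \<and> (\<forall>c. \<bar>proj v ?x $ c - proj v ?y $ c\<bar> \<le> ?r c)}"
  proof
    fix v assume "v \<in> {v. norm v \<le> R \<and> dist (proj v x) (proj v y) \<le> \<rho>}"
    then have v: "norm v \<le> R" "dist (proj v x) (proj v y) \<le> \<rho>" by auto
    have "\<bar>proj v ?x $ c - proj v ?y $ c\<bar> \<le> ?r c" for c
    proof -
    have "\<bar>proj v x $ c - proj v y $ c\<bar> \<le> dist (proj v x) (proj v y)"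
      using component_le_norm_cart[of "proj v x - proj v y" c] by (simp add: dist_norm)
    then have "\<bar>cf c ?w\<bar> * \<bar>proj v ?x $ c - proj v ?y $ c\<bar> \<le> \<rho>"
      using v coord_diff_common_prefix[OF pre, of c] by (simp add: proj_def abs_mult)
    then show ?thesis
      using cf_nz[of c ?w] by (simp add: pos_le_divide_eq mult.commute)
    qed
    then show "v \<in> {v. norm v \<le> R \<and> (\<forall>c. \<bar>proj v ?x $ c - proj v ?y $ c\<bar> \<le> ?r c)}"
      using v by simp
  qed
  have meas: "{v. norm v \<le> R \<and> (\<forall>c. \<bar>proj v ?x $ c - proj v ?y $ c\<bar> \<le> ?r c)} \<in> sets lborel"
  proof -
    show ?thesis by measurable
  qed
  have "emeasure lborel {v. norm v \<le> R \<and> dist (proj v x) (proj v y) \<le> \<rho>}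
      \<le> emeasure lborel {v. norm v \<le> R \<and> (\<forall>c. \<bar>proj v ?x $ c - proj v ?y $ c\<bar> \<le> ?r c)}"
    by (rule emeasure_mono[OF sub meas])
  also have "\<dots> \<le> emeasure lborel (cball (0 :: real^'d^'k) (R + real CARD('k) * real CARD('d)))
      * ennreal (\<Prod>c\<in>UNIV. max 2 (2 / separation) * min 1 (?r c))"
    using ne \<rho> by (intro transversality) auto
  also have "\<dots> = ennreal (vol R * (\<Prod>c\<in>UNIV. min 1 (?r c)))"
  proof -
    have "emeasure lborel (cball (0 :: real^'d^'k) r) = ennreal (measure lborel (cball (0 :: real^'d^'k) r))" for r
      using emeasure_lborel_cball_finite[of "0 :: real^'d^'k" r] by (intro emeasure_eq_ennreal_measure) auto
    then show ?thesis by (simp add: vol_def prod.distrib ennreal_mult' mult.assoc)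
  qed
  also have "\<dots> \<le> ennreal (vol R * (\<rho> powr s / phi D s (\<lambda>c. cf c ?w)))"
    by (intro ennreal_leI mult_left_mono phi_ge_dual D \<rho> s cf_nz vol_nonneg)
  finally show ?thesis by simp
qed

section \<open>Energy of a measure dominated by the weights\<close>

context
  fixes M :: "'k stream measure" and D :: "'d list" and t :: real
  assumes prob: "prob_space M" and setsM [measurable_cong]: "sets M = sets (stream_space (count_space UNIV))"
    and D: "D \<in> orderings" and t: "0 < t" "t \<le> real CARD('d)"
    and cyl: "\<And>u. emeasure M (cylinder u) \<le> ennreal (phi D t (\<lambda>c. cf c u))"
begin

text \<open>A point lies in cylinders of mass at most \<open>(\<alpha> powr t) ^ n\<close>, which
  tends to 0 as \<open>t > 0\<close>. Almost every pair of streams therefore has a first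
  difference.\<close>

lemma AE_neq: "AE y in M. y \<noteq> x"
proof -
  have lim: "(\<lambda>n. ennreal ((\<alpha> powr t) ^ n)) \<longlonglongrightarrow> ennreal 0"
  proof (rule tendsto_ennrealI, rule LIMSEQ_realpow_zero)
    have "\<alpha> powr t < \<alpha> powr 0" using t \<alpha>_pos \<alpha>_less by (intro powr_less_mono') auto
    then show "\<alpha> powr t < 1" using \<alpha>_pos by simp
  qed simp
  have b: "emeasure M (cylinder (stake n x)) \<le> ennreal ((\<alpha> powr t) ^ n)" for n
  proof -
    have "phi D 0 (\<lambda>c. cf c u) = 1" for u
      by (simp add: phi_def cap_def cf_nz)
    then have "phi D t (\<lambda>c. cf c (stake n x)) \<le> (\<alpha> powr t) ^ n"
      using phi_cf_exponent[OF D, of 0 t "stake n x"] t by simp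
    then show ?thesis using cyl[of "stake n x"] by (meson ennreal_leI order_trans)
  qed
  let ?N = "\<Inter>n. cylinder (stake n x)"
  have "UNIV \<in> sets M"
    using sets.top[of M] sets_eq_imp_space_eq[OF setsM] by (simp add: space_stream_space)
  then have Nm: "?N \<in> sets M" using cylinder_sets by (intro sets.countable_INT'') (auto simp: setsM)
  have "emeasure M ?N \<le> ennreal 0"
  proof (rule LIMSEQ_le_const[OF lim], intro exI allI impI)
    fix n :: nat
    have "emeasure M ?N \<le> emeasure M (cylinder (stake n x))"
      by (intro emeasure_mono) (auto simp: setsM cylinder_sets)
    then show "emeasure M ?N \<le> ennreal ((\<alpha> powr t) ^ n)" using b[of n] by simp
  qed
  then have "?N \<in> null_sets M" using Nm by (auto simp: null_sets_def)
  then have "AE y in M. y \<notin> ?N" by (rule AE_not_in)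
  then show ?thesis by eventually_elim (auto simp: cylinder_def)
qed

text \<open>The pairs are sorted by their first difference at index n. The volume estimate costs
  1/phi^s of the common prefix and the cylinder mass contributes phi^t of it; their product is at
  most \<alpha>^((t-s)n), a convergent geometric series.\<close>

lemma energy_bound:
  assumes s: "0 \<le> s" "s < t" and \<rho>: "0 < \<rho>"
  shows "(\<integral>\<^sup>+ y. emeasure lborel {v. norm v \<le> R \<and> dist (proj v x) (proj v y) \<le> \<rho>} \<partial>M)
    \<le> ennreal (vol R * \<rho> powr s / (1 - \<alpha> powr (t - s)))"
proof -
  let ?q = "\<alpha> powr (t - s)"
  have q: "0 < ?q" "?q < 1"
  proof -
    have "\<alpha> powr (t - s) < \<alpha> powr 0" using s \<alpha>_pos \<alpha>_less by (intro powr_less_mono') auto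
    then show "?q < 1" using \<alpha>_pos by simp
  qed (use \<alpha>_pos in simp)
  let ?g = "\<lambda>n. vol R * \<rho> powr s / phi D s (\<lambda>c. cf c (stake n x))"
  have g0: "0 \<le> ?g n" for n
    using vol_nonneg phi_cf_pos[of D s "stake n x"] by simp
  have pt: "emeasure lborel {v. norm v \<le> R \<and> dist (proj v x) (proj v y) \<le> \<rho>}
      \<le> (\<Sum>n. ennreal (?g n) * indicator (cylinder (stake n x)) y)" if y: "y \<noteq> x" for y
  proof -
    obtain m where "x !! m \<noteq> y !! m" using y stream_eqI[of x y] by blast
    define n where "n = (LEAST m. x !! m \<noteq> y !! m)"
    have ne: "x !! n \<noteq> y !! n" unfolding n_def by (rule LeastI) fact
    have "x !! j = y !! j" if "j < n" for j using not_less_Least that unfolding n_def by blast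
    then have pre: "stake n x = stake n y" by (simp add: list_eq_iff_nth_eq)
    have "emeasure lborel {v. norm v \<le> R \<and> dist (proj v x) (proj v y) \<le> \<rho>} \<le> ennreal (?g n)"
      using s t by (intro near_volume[OF D _ _ \<rho> pre ne]) auto
    also have "\<dots> = ennreal (?g n) * indicator (cylinder (stake n x)) y"
      using pre by (simp add: cylinder_def)
    also have "\<dots> \<le> (\<Sum>n. ennreal (?g n) * indicator (cylinder (stake n x)) y)"
      by (rule ennreal_le_suminf)
    finally show ?thesis .
  qed
  have "(\<integral>\<^sup>+ y. emeasure lborel {v. norm v \<le> R \<and> dist (proj v x) (proj v y) \<le> \<rho>} \<partial>M)
      \<le> (\<integral>\<^sup>+ y. (\<Sum>n. ennreal (?g n) * indicator (cylinder (stake n x)) y) \<partial>M)"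
    using AE_neq[of x] pt by (intro nn_integral_mono_AE) auto
  also have "\<dots> = (\<Sum>n. \<integral>\<^sup>+ y. ennreal (?g n) * indicator (cylinder (stake n x)) y \<partial>M)"
    by (rule nn_integral_suminf) measurable
  also have "\<dots> = (\<Sum>n. ennreal (?g n) * emeasure M (cylinder (stake n x)))"
    by (simp add: nn_integral_cmult_indicator setsM cylinder_sets)
  also have "\<dots> \<le> (\<Sum>n. ennreal (vol R * \<rho> powr s * ?q ^ n))"
  proof (intro suminf_le)
    fix n
    let ?w = "stake n x"
    have "ennreal (?g n) * emeasure M (cylinder ?w) \<le> ennreal (?g n) * ennreal (phi D t (\<lambda>c. cf c ?w))"
      by (intro mult_left_mono cyl) simp
    also have "\<dots> = ennreal (?g n * phi D t (\<lambda>c. cf c ?w))"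
      by (rule ennreal_mult[OF g0 less_imp_le[OF phi_cf_pos], symmetric])
    also have "\<dots> \<le> ennreal (?g n * (phi D s (\<lambda>c. cf c ?w) * ?q ^ n))"
      using g0[of n] phi_cf_exponent[OF D, of s t ?w] s t by (intro ennreal_leI mult_left_mono) auto
    also have "?g n * (phi D s (\<lambda>c. cf c ?w) * ?q ^ n) = vol R * \<rho> powr s * ?q ^ n"
      using phi_cf_pos[of D s ?w] by simp
    finally show "ennreal (?g n) * emeasure M (cylinder ?w) \<le> ennreal (vol R * \<rho> powr s * ?q ^ n)" .
  qed auto
  also have "\<dots> = ennreal (\<Sum>n. vol R * \<rho> powr s * ?q ^ n)"
    using q vol_nonneg by (intro suminf_ennreal2 summable_mult summable_geometric) auto
  also have "(\<Sum>n. vol R * \<rho> powr s * ?q ^ n) = vol R * \<rho> powr s / (1 - ?q)"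
    using q by (simp add: suminf_mult suminf_geometric)
  finally show ?thesis .
qed

text \<open>Over a bounded set of translations, Fubini exchanges the integral of the ball masses for
  \<open>energy_bound\<close>. Finite expectation of the weighted sum over all dyadic scales bounds
  every scale at once by a finite random constant.\<close>

lemma AE_local_dimension:
  assumes s: "0 \<le> s'" "s' < t"
  shows "AE v in lborel. AE x in M.
    (\<Sum>n. ennreal (2 powr (real n * s')) * emeasure M {y \<in> space M. dist (proj v x) (proj v y) \<le> (1/2) ^ n}) < \<infinity>"
proof -
  interpret M: prob_space M by (rule prob)
  interpret P: pair_sigma_finite "lborel :: (real^'d^'k) measure" M ..
  \<comment> \<open>An exponent strictly between: \<open>s < t\<close> makes the energy finite, and
    \<open>s' < s\<close> makes the sum over scales geometric.\<close>
  define s where "s = (s' + t) / 2"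
  have ss: "s' < s" "0 \<le> s" "s < t" using s by (auto simp: s_def)
  \<comment> \<open>Ball masses are integrals of this kernel over \<open>y\<close>. That gives their
    joint measurability in \<open>(v, x)\<close> and a form to which Fubini applies.\<close>
  define k :: "nat \<Rightarrow> real^'d^'k \<Rightarrow> 'k stream \<Rightarrow> 'k stream \<Rightarrow> ennreal" where
    "k n v x y = indicator {..(1/2) ^ n} (dist (proj v x) (proj v y))" for n v x y
  define g where "g n v x = emeasure M {y \<in> space M. dist (proj v x) (proj v y) \<le> (1/2) ^ n}" for n v x
  have gk: "g n v x = (\<integral>\<^sup>+ y. k n v x y \<partial>M)" if "x \<in> space M" for n v x
  proof -
    have "{y \<in> space M. dist (proj v x) (proj v y) \<le> (1/2) ^ n} \<in> sets M"
      using that by measurable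
    then show ?thesis
      by (simp add: g_def flip: nn_integral_indicator)
        (auto intro!: nn_integral_cong simp: k_def indicator_def simp del: nn_integral_indicator)
  qed
  have km [measurable]: "(\<lambda>z. k n (fst (fst z)) (snd (fst z)) (snd z)) \<in> borel_measurable ((lborel \<Otimes>\<^sub>M M) \<Otimes>\<^sub>M M)" for n
    unfolding k_def by measurable
  have kx: "k n v x \<in> borel_measurable M" if "x \<in> space M" for n v x
  proof -
    have "k n v x = (\<lambda>y. indicator {..(1/2) ^ n} (dist (proj v x) (proj v y)))"
      by (rule ext) (simp add: k_def)
    then show ?thesis using that by simp
  qed
  have gm [measurable]: "(\<lambda>(v, x). g n v x) \<in> borel_measurable (lborel \<Otimes>\<^sub>M M)" for n
  proof -
    have "(\<lambda>z. \<integral>\<^sup>+ y. k n (fst z) (snd z) y \<partial>M) \<in> borel_measurable (lborel \<Otimes>\<^sub>M M)"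
      using km[of n] by (intro M.borel_measurable_nn_integral) (simp add: case_prod_beta)
    then show ?thesis
      by (rule measurable_cong[THEN iffD1, rotated]) (auto simp: gk space_pair_measure)
  qed
  have igm: "(\<lambda>(v, x). indicator (cball 0 R) v * g n v x) \<in> borel_measurable (lborel \<Otimes>\<^sub>M M)" for n R
  proof -
    have "(\<lambda>z. indicator (cball 0 R) (fst z) * g n (fst z) (snd z)) \<in> borel_measurable (lborel \<Otimes>\<^sub>M M)"
      using gm[of n] by (intro borel_measurable_times_ennreal measurable_compose[OF measurable_fst])
        (simp_all add: case_prod_beta borel_measurable_indicator)
    then show ?thesis by (simp add: case_prod_beta)
  qed
  define \<Phi> where "\<Phi> v x = (\<Sum>n. ennreal (2 powr (real n * s')) * g n v x)" for v x
  have \<Phi>m [measurable]: "(\<lambda>(v, x). \<Phi> v x) \<in> borel_measurable (lborel \<Otimes>\<^sub>M M)"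
    unfolding \<Phi>_def case_prod_beta using gm by (simp add: case_prod_beta)
  have fin: "(\<integral>\<^sup>+ v. indicator (cball 0 R) v * (\<integral>\<^sup>+ x. \<Phi> v x \<partial>M) \<partial>lborel) < \<infinity>" for R
  proof -
    define C where "C = vol R / (1 - \<alpha> powr (t - s))"
    have "\<alpha> powr (t - s) < \<alpha> powr 0" using ss \<alpha>_pos \<alpha>_less by (intro powr_less_mono') auto
    then have C0: "0 \<le> C" using \<alpha>_pos vol_nonneg by (simp add: C_def)
    have one: "(\<integral>\<^sup>+ v. (\<integral>\<^sup>+ x. indicator (cball 0 R) v * g n v x \<partial>M) \<partial>lborel) \<le> ennreal (C * ((1/2) ^ n) powr s)" for n
    proof -
      have "(\<integral>\<^sup>+ v. (\<integral>\<^sup>+ x. indicator (cball 0 R) v * g n v x \<partial>M) \<partial>lborel)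
          = (\<integral>\<^sup>+ x. (\<integral>\<^sup>+ v. indicator (cball 0 R) v * g n v x \<partial>lborel) \<partial>M)"
        by (rule P.Fubini'[OF igm, symmetric])
      also have "\<dots> \<le> (\<integral>\<^sup>+ x. ennreal (C * ((1/2) ^ n) powr s) \<partial>M)"
      proof (rule nn_integral_mono)
        fix x assume x: "x \<in> space M"
        have "(\<integral>\<^sup>+ v. indicator (cball 0 R) v * g n v x \<partial>lborel)
            = (\<integral>\<^sup>+ v. (\<integral>\<^sup>+ y. indicator (cball 0 R) v * k n v x y \<partial>M) \<partial>lborel)"
          unfolding gk[OF x] using x
          by (intro nn_integral_cong nn_integral_cmult[symmetric] kx)
        also have "\<dots> = (\<integral>\<^sup>+ y. (\<integral>\<^sup>+ v. indicator (cball 0 R) v * k n v x y \<partial>lborel) \<partial>M)"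
        proof (rule P.Fubini'[symmetric])
          have "(\<lambda>z. ((fst z, x), snd z)) \<in> measurable ((lborel :: (real^'d^'k) measure) \<Otimes>\<^sub>M M) ((lborel \<Otimes>\<^sub>M M) \<Otimes>\<^sub>M M)"
            using x by measurable
          from measurable_compose[OF this km]
          have "(\<lambda>z. indicator (cball 0 R) (fst z) * k n (fst z) x (snd z)) \<in> borel_measurable (lborel \<Otimes>\<^sub>M M)"
            by (intro borel_measurable_times_ennreal measurable_compose[OF measurable_fst])
              (simp_all add: borel_measurable_indicator)
          then show "(\<lambda>(v, y). indicator (cball 0 R) v * k n v x y) \<in> borel_measurable (lborel \<Otimes>\<^sub>M M)"
            by (simp add: case_prod_beta)
        qed
        also have "\<dots> = (\<integral>\<^sup>+ y. emeasure lborel {v. norm v \<le> R \<and> dist (proj v x) (proj v y) \<le> (1/2) ^ n} \<partial>M)"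
        proof (rule nn_integral_cong)
          fix y assume y: "y \<in> space M"
          have "{v. norm v \<le> R \<and> dist (proj v x) (proj v y) \<le> (1/2) ^ n} \<in> sets lborel"
            by measurable
          then show "(\<integral>\<^sup>+ v. indicator (cball 0 R) v * k n v x y \<partial>lborel) = emeasure lborel {v. norm v \<le> R \<and> dist (proj v x) (proj v y) \<le> (1/2) ^ n}"
            by (simp flip: nn_integral_indicator)
              (auto intro!: nn_integral_cong simp: k_def indicator_def simp del: nn_integral_indicator)
        qed
        also have "\<dots> \<le> ennreal (C * ((1/2) ^ n) powr s)"
          using energy_bound[OF ss(2,3), of "(1/2) ^ n" R x] by (simp add: C_def)
        finally show "(\<integral>\<^sup>+ v. indicator (cball 0 R) v * g n v x \<partial>lborel) \<le> ennreal (C * ((1/2) ^ n) powr s)" .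
      qed
      finally show ?thesis by (simp add: M.emeasure_space_1)
    qed
    have "(\<integral>\<^sup>+ v. indicator (cball 0 R) v * (\<integral>\<^sup>+ x. \<Phi> v x \<partial>M) \<partial>lborel)
        = (\<integral>\<^sup>+ v. (\<integral>\<^sup>+ x. (\<Sum>n. ennreal (2 powr (real n * s')) * (indicator (cball 0 R) v * g n v x)) \<partial>M) \<partial>lborel)"
    proof (rule nn_integral_cong)
      fix v :: "real^'d^'k"
      have [measurable]: "g n v \<in> borel_measurable M" for n
        using measurable_compose[OF _ gm[of n], of "\<lambda>x. (v, x)" M] by simp
      show "indicator (cball 0 R) v * (\<integral>\<^sup>+ x. \<Phi> v x \<partial>M)
          = (\<integral>\<^sup>+ x. (\<Sum>n. ennreal (2 powr (real n * s')) * (indicator (cball 0 R) v * g n v x)) \<partial>M)"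
        unfolding \<Phi>_def
        by (subst nn_integral_cmult[symmetric]) (auto intro!: nn_integral_cong simp: ac_simps simp flip: ennreal_suminf_cmult)
    qed
    also have "\<dots> = (\<Sum>n. ennreal (2 powr (real n * s')) * (\<integral>\<^sup>+ v. (\<integral>\<^sup>+ x. indicator (cball 0 R) v * g n v x \<partial>M) \<partial>lborel))"
    proof -
      have gv [measurable]: "g n v \<in> borel_measurable M" for n v
        using measurable_compose[OF _ gm[of n], of "\<lambda>x. (v, x)" M] by simp
      have [measurable]: "(\<lambda>v. \<integral>\<^sup>+ x. indicator (cball 0 R) v * g n v x \<partial>M) \<in> borel_measurable lborel" for n
        by (rule M.borel_measurable_nn_integral[OF igm])
      have "(\<integral>\<^sup>+ x. (\<Sum>n. ennreal (2 powr (real n * s')) * (indicator (cball 0 R) v * g n v x)) \<partial>M)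
          = (\<Sum>n. ennreal (2 powr (real n * s')) * (\<integral>\<^sup>+ x. indicator (cball 0 R) v * g n v x \<partial>M))" for v
        by (subst nn_integral_suminf) (auto intro!: arg_cong[where f = suminf] ext nn_integral_cmult)
      then have "(\<integral>\<^sup>+ v. (\<integral>\<^sup>+ x. (\<Sum>n. ennreal (2 powr (real n * s')) * (indicator (cball 0 R) v * g n v x)) \<partial>M) \<partial>lborel)
          = (\<integral>\<^sup>+ v. (\<Sum>n. ennreal (2 powr (real n * s')) * (\<integral>\<^sup>+ x. indicator (cball 0 R) v * g n v x \<partial>M)) \<partial>lborel)"
        by (simp only:)
      also have "\<dots> = (\<Sum>n. \<integral>\<^sup>+ v. ennreal (2 powr (real n * s')) * (\<integral>\<^sup>+ x. indicator (cball 0 R) v * g n v x \<partial>M) \<partial>lborel)"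
        by (rule nn_integral_suminf) measurable
      also have "\<dots> = (\<Sum>n. ennreal (2 powr (real n * s')) * (\<integral>\<^sup>+ v. (\<integral>\<^sup>+ x. indicator (cball 0 R) v * g n v x \<partial>M) \<partial>lborel))"
        by (intro arg_cong[where f = suminf] ext nn_integral_cmult) measurable
      finally show ?thesis .
    qed
    also have "\<dots> \<le> (\<Sum>n. ennreal (2 powr (real n * s')) * ennreal (C * ((1/2) ^ n) powr s))"
      by (intro suminf_le mult_left_mono one) auto
    also have "\<dots> = (\<Sum>n. ennreal (C * (2 powr (s' - s)) ^ n))"
    proof (rule arg_cong[where f = suminf], rule ext)
      fix n :: nat
      have "((1/2) ^ n) powr s = 2 powr (- (real n * s))"
        by (simp add: powr_minus powr_powr powr_realpow[symmetric] powr_divide inverse_eq_divide)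
      then have "2 powr (real n * s') * ((1/2) ^ n) powr s = (2 powr (s' - s)) ^ n"
        by (simp add: powr_add[symmetric] powr_realpow[symmetric] powr_powr algebra_simps)
      then have "2 powr (real n * s') * (C * ((1/2) ^ n) powr s) = C * (2 powr (s' - s)) ^ n"
        by (simp only: mult.left_commute)
      then show "ennreal (2 powr (real n * s')) * ennreal (C * ((1/2) ^ n) powr s) = ennreal (C * (2 powr (s' - s)) ^ n)"
        using C0 by (subst ennreal_mult[symmetric]) auto
    qed
    also have "\<dots> = ennreal (\<Sum>n. C * (2 powr (s' - s)) ^ n)"
    proof -
      have "2 powr (s' - s) < (2::real) powr 0" using ss by (intro powr_less_mono) auto
      then show ?thesis using C0 by (intro suminf_ennreal2 summable_mult summable_geometric) auto
    qed
    finally show ?thesis by (simp add: ennreal_less_top le_less_trans)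
  qed
  have "AE v in lborel. v \<in> cball 0 (real R) \<longrightarrow> (AE x in M. \<Phi> v x < \<infinity>)" for R :: nat
  proof -
    have "AE v in lborel. indicator (cball 0 (real R)) v * (\<integral>\<^sup>+ x. \<Phi> v x \<partial>M) \<noteq> \<infinity>"
    proof (rule nn_integral_PInf_AE)
      show "(\<lambda>v. indicator (cball 0 (real R)) v * (\<integral>\<^sup>+ x. \<Phi> v x \<partial>M)) \<in> borel_measurable lborel"
        using M.borel_measurable_nn_integral[OF \<Phi>m]
        by (intro borel_measurable_times_ennreal borel_measurable_indicator) auto
    qed (use fin[of "real R"] in auto)
    then show ?thesis
    proof eventually_elim
      case (elim v)
      have [measurable]: "\<Phi> v \<in> borel_measurable M"
        using measurable_compose[OF _ \<Phi>m, of "\<lambda>x. (v, x)" M] by simp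
      show ?case
      proof
        assume "v \<in> cball 0 (real R)"
        then have "(\<integral>\<^sup>+ x. \<Phi> v x \<partial>M) \<noteq> \<infinity>" using elim by simp
        then have "AE x in M. \<Phi> v x \<noteq> \<infinity>" by (intro nn_integral_PInf_AE) auto
        then show "AE x in M. \<Phi> v x < \<infinity>" by eventually_elim (simp add: less_top)
      qed
    qed
  qed
  then have "AE v in lborel. \<forall>R::nat. v \<in> cball 0 (real R) \<longrightarrow> (AE x in M. \<Phi> v x < \<infinity>)"
    unfolding AE_all_countable by blast
  then show ?thesis
  proof eventually_elim
    case (elim v)
    obtain R :: nat where "norm v \<le> real R" using real_arch_simple by blast
    then show ?case using elim by (auto simp: \<Phi>_def g_def)
  qed
qed

text \<open>The null set of translations depends on the exponent, so it is collected over the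
  rationals only; a real \<open>s < t\<close> is handled by a rational strictly between
  \<open>s\<close> and \<open>t\<close>.\<close>

lemma AE_hausdorff_measure_pos:
  assumes X: "AE x in M. x \<in> X"
  shows "AE v in lborel. \<forall>s. 0 \<le> s \<and> s < t \<longrightarrow> hausdorff_measure s (proj v ` X) \<noteq> 0"
proof -
  interpret M: prob_space M by (rule prob)
  have "AE v in lborel. \<forall>s'::rat. 0 \<le> s' \<and> of_rat s' < t \<longrightarrow> (AE x in M.
    (\<Sum>n. ennreal (2 powr (real n * of_rat s')) * emeasure M {y \<in> space M. dist (proj v x) (proj v y) \<le> (1/2) ^ n}) < \<infinity>)"
    unfolding AE_all_countable using AE_local_dimension by auto
  then show ?thesis
  proof eventually_elim
    case (elim v)
    show ?case
    proof (intro allI impI, elim conjE)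
      fix s assume s: "0 \<le> s" "s < t"
      then obtain q :: rat where q: "s < of_rat q" "of_rat q < t" using of_rat_dense by blast
      let ?s = "of_rat q :: real"
      have q0: "0 \<le> q" using q s by (metis less_eq_real_def order.strict_trans1 zero_less_of_rat_iff order_less_imp_le)
      define \<Phi> where "\<Phi> x = (\<Sum>n. ennreal (2 powr (real n * ?s)) * emeasure M {y \<in> space M. dist (proj v x) (proj v y) \<le> (1/2) ^ n})" for x
      have pm [measurable]: "proj v \<in> borel_measurable M" by measurable
      show "hausdorff_measure s (proj v ` X) \<noteq> 0"
      proof (rule mass_distribution[OF prob pm _ _ _ X, of \<Phi> ?s])
        show "\<Phi> \<in> borel_measurable M"
        proof -
          have "(\<lambda>x. emeasure M {y \<in> space M. dist (proj v x) (proj v y) \<le> (1/2) ^ n}) \<in> borel_measurable M" for n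
            by measurable
          then show ?thesis unfolding \<Phi>_def by measurable
        qed
        show "AE x in M. \<Phi> x < \<infinity>" using elim q0 q unfolding \<Phi>_def by auto
        fix x n assume "x \<in> space M"
        let ?e = "emeasure M {y \<in> space M. dist (proj v x) (proj v y) \<le> (1/2) ^ n}"
        have "ennreal (2 powr (real n * ?s)) * ?e \<le> \<Phi> x"
          unfolding \<Phi>_def by (rule ennreal_le_suminf)
        then have "ennreal ((1/2) powr (real n * ?s)) * (ennreal (2 powr (real n * ?s)) * ?e) \<le> ennreal ((1/2) powr (real n * ?s)) * \<Phi> x"
          by (intro mult_left_mono) auto
        moreover have "ennreal ((1/2) powr (real n * ?s)) * (ennreal (2 powr (real n * ?s)) * ?e) = ?e"
          by (simp add: mult.assoc[symmetric] ennreal_mult[symmetric] powr_mult[symmetric])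
        ultimately show "?e \<le> ennreal ((1/2) powr (real n * ?s)) * \<Phi> x" by simp
      qed (use q s in auto)
    qed
  qed
qed

end

end

section \<open>Almost sure dimension\<close>

lemma box_cubes:
  fixes z0 :: "real^'d::finite"
  assumes r: "0 < r" and h: "\<And>c. 0 \<le> h c"
  obtains I :: "('d \<Rightarrow> nat) set" and U :: "('d \<Rightarrow> nat) \<Rightarrow> (real^'d) set"
  where "finite I" "real (card I) \<le> (\<Prod>c\<in>UNIV. 2 * h c / r + 1)"
    "{z. \<forall>c. \<bar>z $ c - z0 $ c\<bar> \<le> h c} \<subseteq> (\<Union>k\<in>I. U k)"
    "\<And>k. bounded (U k)" "\<And>k. diameter (U k) \<le> real CARD('d) * r"
proof -
  define N where "N c = nat \<lfloor>2 * h c / r\<rfloor>" for c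
  define I where "I = PiE UNIV (\<lambda>c. {..N c})"
  define U where "U k = cbox (\<chi> c. z0 $ c - h c + real (k c) * r) (\<chi> c. z0 $ c - h c + (real (k c) + 1) * r)" for k :: "'d \<Rightarrow> nat"
  have q0: "0 \<le> 2 * h c / r" for c using h[of c] r by simp
  show ?thesis
  proof
    show "finite I" unfolding I_def by (intro finite_PiE) auto
    have "real (card I) = (\<Prod>c\<in>UNIV. real (N c) + 1)"
      by (simp add: I_def card_PiE add.commute)
    also have "\<dots> \<le> (\<Prod>c\<in>UNIV. 2 * h c / r + 1)"
      using q0 by (intro prod_mono) (auto simp: N_def)
    finally show "real (card I) \<le> (\<Prod>c\<in>UNIV. 2 * h c / r + 1)" .
    show "{z. \<forall>c. \<bar>z $ c - z0 $ c\<bar> \<le> h c} \<subseteq> (\<Union>k\<in>I. U k)"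
    proof
      fix z assume "z \<in> {z. \<forall>c. \<bar>z $ c - z0 $ c\<bar> \<le> h c}"
      then have z: "\<bar>z $ c - z0 $ c\<bar> \<le> h c" for c by simp
      define y where "y c = (z $ c - z0 $ c + h c) / r" for c
      define k where "k c = nat \<lfloor>y c\<rfloor>" for c
      have y: "0 \<le> y c" "y c \<le> 2 * h c / r" for c
        using z[of c] r by (auto simp: y_def abs_le_iff intro!: divide_nonneg_pos divide_right_mono)
      have k: "real (k c) \<le> y c" "y c \<le> real (k c) + 1" for c
        using y(1)[of c] by (auto simp: k_def)
      have "k c \<le> N c" for c unfolding k_def N_def by (intro nat_mono floor_mono y)
      then have "k \<in> I" by (auto simp: I_def)
      moreover have "z \<in> U k"
      proof -
        have "real (k c) * r \<le> z $ c - z0 $ c + h c" "z $ c - z0 $ c + h c \<le> (real (k c) + 1) * r" for c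
          using k[of c] r by (simp_all add: y_def pos_le_divide_eq pos_divide_le_eq)
        then show ?thesis by (simp add: U_def mem_box_cart algebra_simps)
      qed
      ultimately show "z \<in> (\<Union>k\<in>I. U k)" by blast
    qed
    show "bounded (U k)" for k by (simp add: U_def)
    show "diameter (U k) \<le> real CARD('d) * r" for k
    proof (rule diameter_le)
      fix x y assume xy: "x \<in> U k" "y \<in> U k"
      have "\<bar>(x - y) $ c\<bar> \<le> r" for c
      proof -
        have "z0 $ c - h c + real (k c) * r \<le> x $ c \<and> x $ c \<le> z0 $ c - h c + (real (k c) + 1) * r"
          "z0 $ c - h c + real (k c) * r \<le> y $ c \<and> y $ c \<le> z0 $ c - h c + (real (k c) + 1) * r"
          using xy by (auto simp: U_def mem_box_cart)
        then show ?thesis by (simp add: abs_le_iff algebra_simps)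
      qed
      then have "(\<Sum>c\<in>UNIV. \<bar>(x - y) $ c\<bar>) \<le> (\<Sum>c\<in>(UNIV::'d set). r)" by (intro sum_mono) auto
      then show "norm (x - y) \<le> real CARD('d) * r"
        using norm_le_l1_cart[of "x - y"] by simp
    qed (use r in auto)
  qed
qed

section \<open>Exponential growth of weighted languages\<close>

definition growth :: "('k::finite \<Rightarrow> real) \<Rightarrow> 'k list set \<Rightarrow> real" where
  "growth p V = lim (\<lambda>n. 1 / real n * ln (level_sum p V n))"

lemma level_sum_submult:
  fixes p :: "'k::finite \<Rightarrow> real"
  assumes V: "factorial_language V" and pos: "\<And>i. 0 < p i"
  shows "level_sum p V (m + n) \<le> level_sum p V m * level_sum p V n"
proof -
  have sub: "level V (m + n) \<subseteq> (\<lambda>(u, v). u @ v) ` (level V m \<times> level V n)"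
  proof
    fix x assume "x \<in> level V (m + n)"
    then have x: "x \<in> V" "length x = m + n" by (auto simp: level_def)
    then have "take m x \<in> V" "drop m x \<in> V"
      using factorial_languageD[OF V, of "take m x" "drop m x"] by auto
    then show "x \<in> (\<lambda>(u, v). u @ v) ` (level V m \<times> level V n)"
      using x by (intro image_eqI[of _ _ "(take m x, drop m x)"]) (auto simp: level_def)
  qed
  have inj: "inj_on (\<lambda>(u, v). u @ v) (level V m \<times> level V n)"
    by (auto simp: inj_on_def level_def)
  have "level_sum p V (m + n) \<le> (\<Sum>x\<in>(\<lambda>(u, v). u @ v) ` (level V m \<times> level V n). wt p x)"
    unfolding level_sum_def using sub by (intro sum_mono2) (auto intro!: wt_nonneg less_imp_le[OF pos] mult_nonneg_nonneg)
  also have "\<dots> = level_sum p V m * level_sum p V n"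
    by (subst sum.reindex[OF inj]) (simp add: level_sum_def sum_product sum.cartesian_product case_prod_beta)
  finally show ?thesis .
qed

lemma wt_ge_power:
  assumes "0 \<le> e" "\<And>i. e \<le> p i"
  shows "e ^ length w \<le> wt p w"
proof (induction w)
  case (Cons i w)
  then show ?case using assms mult_mono[OF assms(2)[of i] Cons] by (auto intro: order_trans)
qed simp

text \<open>\<open>fekete\<close> applied to level sums; a single word of each length provides the
  exponential lower bound. With weights phi_D^s(A_i), the growth is the D-pressure for the full
  language and the reduced D-pressure for \<open>avoiding w\<close>.\<close>

lemma growth_exists:
  fixes p :: "'k::finite \<Rightarrow> real"
  assumes V: "factorial_language V" and ne: "\<And>n. level V n \<noteq> {}" and pos: "\<And>i. 0 < p i"
  shows "(\<lambda>n. 1 / real n * ln (level_sum p V n)) \<longlonglongrightarrow> growth p V"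
    and "exp (real n * growth p V) \<le> level_sum p V n"
proof -
  define e where "e = Min (range p)"
  have e: "0 < e" "\<And>i. e \<le> p i" using pos by (auto simp: e_def Min_gr_iff)
  have low: "e ^ n \<le> level_sum p V n" for n
  proof -
    obtain w where w: "w \<in> level V n" using ne[of n] by auto
    have "e ^ n \<le> wt p w" using wt_ge_power[of e p w] e w by (auto simp: level_def)
    also have "\<dots> \<le> level_sum p V n"
      unfolding level_sum_def using w by (intro member_le_sum) (auto intro: wt_nonneg less_imp_le[OF pos])
    finally show ?thesis .
  qed
  obtain L where L: "(\<lambda>n. 1 / real n * ln (level_sum p V n)) \<longlonglongrightarrow> L" "\<And>n. exp (real n * L) \<le> level_sum p V n"
    using fekete[of "level_sum p V" e] level_sum_submult[OF V, of p] pos e(1) low by blast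
  have "growth p V = L" unfolding growth_def using L(1) by (rule limI)
  then show "(\<lambda>n. 1 / real n * ln (level_sum p V n)) \<longlonglongrightarrow> growth p V"
    "exp (real n * growth p V) \<le> level_sum p V n" using L by auto
qed

lemma level_sum_eventually_le_exp:
  fixes p :: "'k::finite \<Rightarrow> real"
  assumes V: "factorial_language V" and ne: "\<And>n. level V n \<noteq> {}" and pos: "\<And>i. 0 < p i"
    and L: "growth p V < L"
  shows "\<forall>\<^sub>F n in sequentially. level_sum p V n \<le> exp L ^ n"
proof -
  have "\<forall>\<^sub>F n in sequentially. 1 / real n * ln (level_sum p V n) < L"
    using growth_exists(1)[OF V ne pos] L by (rule order_tendstoD)
  moreover have "\<forall>\<^sub>F n in sequentially. 0 < n" by (rule eventually_gt_at_top)
  ultimately show ?thesis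
  proof eventually_elim
    case (elim n)
    have "0 < level_sum p V n" using growth_exists(2)[OF V ne pos, of n] by (meson exp_gt_zero less_le_trans)
    moreover have "ln (level_sum p V n) \<le> real n * L" using elim by (simp add: field_simps)
    ultimately have "level_sum p V n \<le> exp (real n * L)" by (metis exp_le_cancel_iff exp_ln)
    then show ?case by (simp add: exp_of_nat_mult)
  qed
qed

lemma level_sum_summable:
  fixes p :: "'k::finite \<Rightarrow> real"
  assumes V: "factorial_language V" and ne: "\<And>n. level V n \<noteq> {}" and pos: "\<And>i. 0 < p i"
    and L: "growth p V \<le> 0" and z: "0 < z" "z < 1"
  shows "summable (\<lambda>n. level_sum p V n * z ^ n)"
proof -
  \<comment> \<open>Half way between 0 and \<open>- ln z\<close>: it exceeds the growth rate and
    still leaves \<open>exp L * z < 1\<close>.\<close>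
  define L where "L = - ln z / 2"
  have "ln z < 0" using z by simp
  then have Lp: "growth p V < L" using \<open>growth p V \<le> 0\<close> by (simp add: L_def)
  have "exp L * z = exp (L + ln z)" using z by (simp add: exp_add)
  also have "\<dots> < 1" using \<open>ln z < 0\<close> by (simp add: L_def)
  finally have lt: "exp L * z < 1" .
  have ev: "\<forall>\<^sub>F n in sequentially. norm (level_sum p V n * z ^ n) \<le> (exp L * z) ^ n"
    using level_sum_eventually_le_exp[OF V ne pos Lp]
  proof eventually_elim
    case (elim n)
    then show ?case using z level_sum_nonneg[of p V n] less_imp_le[OF pos]
      by (simp add: abs_mult power_mult_distrib mult_right_mono)
  qed
  show ?thesis
    by (rule summable_comparison_test_ev[OF ev summable_geometric]) (use z lt in simp)
qed

context diagonal_ifs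
begin

lemma proj_bound: "\<bar>proj v x $ c\<bar> \<le> norm v / (1 - \<alpha>)"
proof -
  have "\<bar>v $ i $ c\<bar> \<le> norm v" for i
    using component_le_norm_cart[of "v $ i" c] Finite_Cartesian_Product.norm_nth_le[of v i] by simp
  then show ?thesis unfolding proj_def by (simp add: coord_bound)
qed

text \<open>The image of a cylinder lies in a box with sides proportional to the
  \<open>cf c w\<close>. Cubes whose side is the critical entry of the decreasing ordering attain
  the equality case of the duality, so their total cost at exponent \<open>t\<close> is a multiple
  of \<open>phi\<close>; the excess \<open>u\<close> supplies a factor decaying in the length of
  \<open>w\<close>.\<close>

lemma cylinder_cover:
  fixes v :: "real^'d^'k" and w :: "'k list"
  assumes t: "0 \<le> t" "t \<le> real CARD('d)" and u: "0 < u"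
  defines "K \<equiv> (4 * (norm v / (1 - \<alpha>)) + 1) ^ CARD('d) * real CARD('d) powr (t + u)"
  obtains I :: "('d \<Rightarrow> nat) set" and U :: "('d \<Rightarrow> nat) \<Rightarrow> (real^'d) set"
  where "finite I" "proj v ` cylinder w \<subseteq> (\<Union>k\<in>I. U k)"
    "\<And>k. bounded (U k)" "\<And>k. diameter (U k) \<le> real CARD('d) * \<alpha> ^ length w"
    "(\<Sum>k\<in>I. diam_pow (t + u) (U k)) \<le> K * (\<Sum>D\<in>orderings. phi D t (\<lambda>c. cf c w)) * (\<alpha> ^ length w) powr u"
proof -
  let ?b = "\<lambda>c. cf c w"
  define B where "B = norm v / (1 - \<alpha>)"
  have B0: "0 \<le> B" using \<alpha>_less by (simp add: B_def)
  have pB: "\<bar>proj v x $ c\<bar> \<le> B" for x c unfolding B_def by (rule proj_bound)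
  obtain D where D: "D \<in> orderings" and srt: "\<And>i j. i \<le> j \<Longrightarrow> j < length D \<Longrightarrow> \<bar>?b (D ! j)\<bar> \<le> \<bar>?b (D ! i)\<bar>"
    using exists_sorted_ordering[of "\<lambda>c. \<bar>?b c\<bar>"] by blast
  obtain e where e: "phi D t ?b = \<bar>?b e\<bar> powr t * (\<Prod>c\<in>UNIV. max 1 (\<bar>?b c\<bar> / \<bar>?b e\<bar>))"
    using phi_sorted_eq[where b = ?b, OF D srt t cf_nz] by blast
  define r where "r = \<bar>?b e\<bar>"
  have r: "0 < r" "r \<le> \<alpha> ^ length w" using cf_nz cf_bound by (auto simp: r_def)
  define x0 where "x0 = w @- sconst undefined"
  have h: "0 \<le> (\<lambda>c. 2 * B * \<bar>?b c\<bar>) c" for c using B0 by simp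
  obtain I :: "('d \<Rightarrow> nat) set" and U where I: "finite I" "real (card I) \<le> (\<Prod>c\<in>UNIV. 2 * (2 * B * \<bar>?b c\<bar>) / r + 1)"
    "{z. \<forall>c. \<bar>z $ c - proj v x0 $ c\<bar> \<le> 2 * B * \<bar>?b c\<bar>} \<subseteq> (\<Union>k\<in>I. U k)"
    "\<And>k. bounded (U k)" "\<And>k. diameter (U k) \<le> real CARD('d) * r"
    by (rule box_cubes[where h = "\<lambda>c. 2 * B * \<bar>?b c\<bar>" and ?z0.0 = "proj v x0", OF r(1) h]) blast
  show ?thesis
  proof
    show "finite I" by fact
    show "proj v ` cylinder w \<subseteq> (\<Union>k\<in>I. U k)"
    proof (rule order_trans[OF _ I(3)], rule image_subsetI, rule CollectI, rule allI)
      fix x c assume "x \<in> cylinder w"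
      then have pre: "stake (length w) x = w" "stake (length w) x = stake (length w) x0"
        by (auto simp: cylinder_def x0_def stake_shift)
      let ?n = "length w"
      have "\<bar>proj v x $ c - proj v x0 $ c\<bar> = \<bar>?b c\<bar> * \<bar>proj v (sdrop ?n x) $ c - proj v (sdrop ?n x0) $ c\<bar>"
        using coord_diff_common_prefix[OF pre(2), of c "\<lambda>i. v $ i $ c"] by (simp add: proj_def abs_mult pre(1))
      also have "\<dots> \<le> \<bar>?b c\<bar> * (2 * B)"
        using pB[of "sdrop ?n x" c] pB[of "sdrop ?n x0" c] by (intro mult_left_mono) linarith+
      finally show "\<bar>proj v x $ c - proj v x0 $ c\<bar> \<le> 2 * B * \<bar>?b c\<bar>" by (simp add: mult.commute)
    qed
    show "bounded (U k)" for k by fact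
    show "diameter (U k) \<le> real CARD('d) * \<alpha> ^ length w" for k
      by (rule order_trans[OF I(5) mult_left_mono[OF r(2)]]) simp
    have "(\<Sum>k\<in>I. diam_pow (t + u) (U k)) \<le> (\<Sum>k\<in>I. (real CARD('d) * r) powr (t + u))"
    proof (rule sum_mono)
      fix k
      have "diameter (U k) powr (t + u) \<le> (real CARD('d) * r) powr (t + u)"
        using t u I(5) by (intro powr_mono2) (auto intro: diameter_ge_0 I(4))
      then show "diam_pow (t + u) (U k) \<le> (real CARD('d) * r) powr (t + u)"
        using t u by (simp add: diam_pow_def)
    qed
    also have "\<dots> = real (card I) * (real CARD('d) powr (t + u) * (r powr t * r powr u))"
      using r by (simp add: powr_mult powr_add)
    also have "\<dots> \<le> ((4 * B + 1) ^ CARD('d) * (\<Prod>c\<in>UNIV. max 1 (\<bar>?b c\<bar> / r)))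
        * (real CARD('d) powr (t + u) * (r powr t * (\<alpha> ^ length w) powr u))"
    proof (intro mult_mono)
      have "(\<Prod>c\<in>UNIV. 2 * (2 * B * \<bar>?b c\<bar>) / r + 1) \<le> (\<Prod>c\<in>UNIV. (4 * B + 1) * max 1 (\<bar>?b c\<bar> / r))"
      proof (intro prod_mono conjI)
        fix c
        have "4 * B * (\<bar>?b c\<bar> / r) \<le> 4 * B * max 1 (\<bar>?b c\<bar> / r)" using B0 by (intro mult_left_mono) auto
        moreover have "1 \<le> max 1 (\<bar>?b c\<bar> / r)" by simp
        moreover have "2 * (2 * B * \<bar>?b c\<bar>) / r + 1 = 4 * B * (\<bar>?b c\<bar> / r) + 1" by simp
        ultimately show "2 * (2 * B * \<bar>?b c\<bar>) / r + 1 \<le> (4 * B + 1) * max 1 (\<bar>?b c\<bar> / r)"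
          unfolding distrib_right by linarith
        show "0 \<le> 2 * (2 * B * \<bar>?b c\<bar>) / r + 1" using B0 r by (intro add_nonneg_nonneg divide_nonneg_pos) auto
      qed
      with I(2) show "real (card I) \<le> (4 * B + 1) ^ CARD('d) * (\<Prod>c\<in>UNIV. max 1 (\<bar>?b c\<bar> / r))"
        by (simp add: prod.distrib)
      show "r powr u \<le> (\<alpha> ^ length w) powr u" using r u by (intro powr_mono2) auto
      show "0 \<le> (4 * B + 1) ^ CARD('d) * (\<Prod>c\<in>UNIV. max 1 (\<bar>?b c\<bar> / r))"
        using B0 by (intro mult_nonneg_nonneg prod_nonneg) (auto simp: le_max_iff_disj)
    qed auto
    also have "\<dots> = K * phi D t ?b * (\<alpha> ^ length w) powr u"
      unfolding e r_def[symmetric] K_def B_def[symmetric] by simp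
    \<comment> \<open>The decreasing ordering depends on \<open>w\<close>. Summing over all
      orderings removes this dependence and costs only a number of terms independent of
      \<open>w\<close>.\<close>
    also have "\<dots> \<le> K * (\<Sum>D\<in>orderings. phi D t ?b) * (\<alpha> ^ length w) powr u"
    proof (intro mult_right_mono mult_left_mono)
      show "phi D t ?b \<le> (\<Sum>D\<in>orderings. phi D t ?b)"
        using D phi_cf_pos[of _ t w] by (intro member_le_sum) (auto intro: less_imp_le)
      show "0 \<le> K" unfolding K_def using B0 by (simp add: B_def)
    qed auto
    finally show "(\<Sum>k\<in>I. diam_pow (t + u) (U k)) \<le> K * (\<Sum>D\<in>orderings. phi D t ?b) * (\<alpha> ^ length w) powr u" .
  qed
qed

text \<open>The cost of the cover of level \<open>n\<close> is a finite sum of terms of generating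
  functions at \<open>z = \<alpha> powr u < 1\<close>. These converge because no ordering has
  positive growth, so their terms tend to 0.\<close>

lemma hausdorff_measure_eq_0:
  fixes v :: "real^'d^'k"
  assumes V: "factorial_language V" and ne: "\<And>n. level V n \<noteq> {}"
    and t: "0 \<le> t" "t \<le> real CARD('d)" and u: "0 < u"
    and le: "\<And>D. D \<in> orderings \<Longrightarrow> growth (\<lambda>i. phi D t (a i)) V \<le> 0"
  shows "hausdorff_measure (t + u) (proj v ` {x. \<forall>n. stake n x \<in> V}) = 0"
proof -
  define X where "X = {x. \<forall>n. stake n x \<in> V}"
  define K where "K = (4 * (norm v / (1 - \<alpha>)) + 1) ^ CARD('d) * real CARD('d) powr (t + u)"
  define E where "E n = K * (\<Sum>D\<in>orderings. level_sum (\<lambda>i. phi D t (a i)) V n * (\<alpha> powr u) ^ n)" for n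
  have lim: "E \<longlonglongrightarrow> K * (\<Sum>D\<in>(orderings :: 'd list set). 0)"
    unfolding E_def
  proof (intro tendsto_intros)
    fix D :: "'d list" assume D: "D \<in> orderings"
    have q: "\<alpha> powr u < 1" using powr_less_mono'[of \<alpha> 0 u] \<alpha>_pos \<alpha>_less u by simp
    have "summable (\<lambda>n. level_sum (\<lambda>i. phi D t (a i)) V n * (\<alpha> powr u) ^ n)"
    proof (rule level_sum_summable[OF V ne _ le[OF D]])
      show "0 < phi D t (a i)" for i by (rule phi_pos) (rule nz)
    qed (use q \<alpha>_pos in auto)
    then show "(\<lambda>n. level_sum (\<lambda>i. phi D t (a i)) V n * (\<alpha> powr u) ^ n) \<longlonglongrightarrow> 0"
      by (rule summable_LIMSEQ_zero)
  qed
  have bound: "hausdorff_premeasure \<delta> (t + u) (proj v ` X) \<le> ennreal (E n)"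
    if n: "real CARD('d) * \<alpha> ^ n \<le> \<delta>" for \<delta> n
  proof -
    have "\<exists>I U. finite (I :: ('d \<Rightarrow> nat) set) \<and> proj v ` cylinder w \<subseteq> (\<Union>k\<in>I. U k) \<and>
      (\<forall>k. bounded (U k)) \<and> (\<forall>k. diameter (U k) \<le> real CARD('d) * \<alpha> ^ length w) \<and>
      (\<Sum>k\<in>I. diam_pow (t + u) (U k)) \<le> K * (\<Sum>D\<in>orderings. phi D t (\<lambda>c. cf c w)) * (\<alpha> ^ length w) powr u" for w :: "'k list"
      unfolding K_def using cylinder_cover[OF t u, of v w] by metis
    then obtain I U where IU: "\<And>w. finite (I w :: ('d \<Rightarrow> nat) set)" "\<And>w. proj v ` cylinder w \<subseteq> (\<Union>k\<in>I w. U w k)"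
      "\<And>w k. bounded (U w k)" "\<And>w k. diameter (U w k) \<le> real CARD('d) * \<alpha> ^ length w"
      "\<And>w. (\<Sum>k\<in>I w. diam_pow (t + u) (U w k)) \<le> K * (\<Sum>D\<in>orderings. phi D t (\<lambda>c. cf c w)) * (\<alpha> ^ length w) powr u"
      by metis
    let ?J = "SIGMA w:level V n. I w"
    have \<delta>: "0 \<le> \<delta>" using n \<alpha>_pos by (meson less_imp_le mult_nonneg_nonneg of_nat_0_le_iff order_trans zero_le_power)
    have "hausdorff_premeasure \<delta> (t + u) (proj v ` X) \<le> (\<Sum>j\<in>?J. ennreal (diam_pow (t + u) (U (fst j) (snd j))))"
    proof (rule hausdorff_premeasure_finite_cover)
      show "finite ?J" using IU(1) by (intro finite_SigmaI) auto
      show "proj v ` X \<subseteq> (\<Union>j\<in>?J. U (fst j) (snd j))"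
      proof (rule image_subsetI)
        fix x assume "x \<in> X"
        then have w: "stake n x \<in> level V n" "x \<in> cylinder (stake n x)" by (auto simp: X_def level_def cylinder_def)
        then obtain k where "k \<in> I (stake n x)" "proj v x \<in> U (stake n x) k" using IU(2)[of "stake n x"] by blast
        then show "proj v x \<in> (\<Union>j\<in>?J. U (fst j) (snd j))"
          using w by (intro UN_I[of "(stake n x, k)"]) auto
      qed
      show "bounded (U (fst j) (snd j)) \<and> diameter (U (fst j) (snd j)) \<le> \<delta>" if "j \<in> ?J" for j
        using IU(3,4)[of "fst j" "snd j"] that n by (auto simp: level_def)
    qed (rule \<delta>)
    also have "\<dots> = ennreal (\<Sum>j\<in>?J. diam_pow (t + u) (U (fst j) (snd j)))"
      by (rule sum_ennreal) (auto simp: diam_pow_def)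
    also have "(\<Sum>j\<in>?J. diam_pow (t + u) (U (fst j) (snd j))) = (\<Sum>w\<in>level V n. \<Sum>k\<in>I w. diam_pow (t + u) (U w k))"
      using IU(1) by (subst sum.Sigma) (auto simp: case_prod_beta)
    also have "ennreal \<dots> \<le> ennreal (\<Sum>w\<in>level V n. K * (\<Sum>D\<in>orderings. phi D t (\<lambda>c. cf c w)) * (\<alpha> ^ length w) powr u)"
      by (intro ennreal_leI sum_mono IU(5))
    also have "(\<Sum>w\<in>level V n. K * (\<Sum>D\<in>orderings. phi D t (\<lambda>c. cf c w)) * (\<alpha> ^ length w) powr u)
        = (\<Sum>w\<in>level V n. \<Sum>D\<in>orderings. K * (wt (\<lambda>i. phi D t (a i)) w * (\<alpha> powr u) ^ n))"
    proof (rule sum.cong[OF refl])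
      fix w assume "w \<in> level V n"
      then have "(\<alpha> ^ length w) powr u = (\<alpha> powr u) ^ n"
        using \<alpha>_pos by (simp add: level_def powr_powr mult.commute flip: powr_realpow)
      then show "K * (\<Sum>D\<in>orderings. phi D t (\<lambda>c. cf c w)) * (\<alpha> ^ length w) powr u
          = (\<Sum>D\<in>orderings. K * (wt (\<lambda>i. phi D t (a i)) w * (\<alpha> powr u) ^ n))"
        by (simp add: phi_wt sum_distrib_left sum_distrib_right mult.assoc)
    qed
    also have "\<dots> = E n"
      by (subst sum.swap) (simp add: E_def level_sum_def sum_distrib_left sum_distrib_right)
    finally show ?thesis .
  qed
  have "hausdorff_premeasure \<delta> (t + u) (proj v ` X) \<le> ennreal 0" if \<delta>: "0 < \<delta>" for \<delta>
  proof (rule LIMSEQ_le_const)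
    show "(\<lambda>n. ennreal (E n)) \<longlonglongrightarrow> ennreal 0" using lim by (intro tendsto_ennrealI) simp
    have "(\<lambda>n. real CARD('d) * \<alpha> ^ n) \<longlonglongrightarrow> real CARD('d) * 0"
      using \<alpha>_pos \<alpha>_less by (intro tendsto_intros LIMSEQ_realpow_zero) auto
    then have "\<forall>\<^sub>F n in sequentially. real CARD('d) * \<alpha> ^ n < \<delta>"
      using \<delta> by (intro order_tendstoD) auto
    then show "\<exists>N. \<forall>n\<ge>N. hausdorff_premeasure \<delta> (t + u) (proj v ` X) \<le> ennreal (E n)"
      unfolding eventually_sequentially using bound by (meson less_imp_le)
  qed
  then have "hausdorff_measure (t + u) (proj v ` X) \<le> 0"
    unfolding hausdorff_measure_def by (intro SUP_least) auto
  then show ?thesis by (simp add: X_def)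
qed

text \<open>As growth decreases in the exponent, the hypotheses single out \<open>t\<close> as the
  largest zero over all orderings. The upper bound consults every ordering, the lower bound only the
  extremal one.\<close>

theorem AE_hausdorff_dim:
  assumes V: "factorial_language V" and ne: "\<And>n. level V n \<noteq> {}"
    and t: "0 \<le> t" "t \<le> real CARD('d)"
    and le: "\<And>D. D \<in> orderings \<Longrightarrow> growth (\<lambda>i. phi D t (a i)) V \<le> 0"
    and D: "D \<in> orderings" and eq: "growth (\<lambda>i. phi D t (a i)) V = 0"
  shows "AE v in (lborel :: (real^'d^'k) measure). hausdorff_dim (proj v ` {x. \<forall>n. stake n x \<in> V}) = t"
proof -
  let ?p = "\<lambda>i. phi D t (a i)"
  let ?X = "{x. \<forall>n. stake n x \<in> V}"
  have pos: "0 < ?p i" for i by (rule phi_pos) (rule nz)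
  have zero: "hausdorff_measure (t + e) (proj v ` ?X) = 0" if "0 < e" for v e
    by (rule hausdorff_measure_eq_0[OF V ne t that le])
  have "AE v in (lborel :: (real^'d^'k) measure). \<forall>s. 0 \<le> s \<and> s < t \<longrightarrow> hausdorff_measure s (proj v ` ?X) \<noteq> 0"
  \<comment> \<open>The energy argument requires a positive exponent; for \<open>t = 0\<close> the
    claim is vacuous.\<close>
  proof (cases "t = 0")
    case False
    have ge1: "1 \<le> level_sum ?p V n" for n
      using growth_exists(2)[where p = ?p, OF V ne pos, of n] by (simp add: eq)
    have sm: "summable (\<lambda>n. level_sum ?p V n * z ^ n)" if "0 < z" "z < 1" for z
      using level_sum_summable[where p = ?p, OF V ne pos _ that] by (simp add: eq)
    obtain M where M: "prob_space M" "sets M = sets (stream_space (count_space UNIV))"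
      "\<And>u. emeasure M (cylinder u) \<le> ennreal (wt ?p u)" "AE x in M. \<forall>n. stake n x \<in> V"
      using conformal_measure[OF V pos ge1 sm] by blast
    show ?thesis
      using False t M by (intro AE_hausdorff_measure_pos[OF M(1,2) D]) (auto simp: phi_wt)
  next
    case True
    then show ?thesis by (intro AE_I2) auto
  qed
  then show ?thesis
  proof eventually_elim
    case (elim v)
    show ?case
    proof (rule antisym)
      show "hausdorff_dim (proj v ` ?X) \<le> t" by (rule hausdorff_dim_le[OF t(1) zero])
      show "t \<le> hausdorff_dim (proj v ` ?X)"
        using elim t by (intro hausdorff_dim_ge[OF _ zero[of 1]]) auto
    qed
  qed
qed

end

section \<open>The pressure with a hole\<close>

text \<open>A letter different from the last letter of \<open>w\<close> cannot complete an
  occurrence. Two letters are essential here: over one letter no stream survives.\<close>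

lemma avoiding_extend:
  fixes w :: "'k::finite list"
  assumes k: "2 \<le> CARD('k)" and w: "w \<noteq> []" and u: "u \<in> avoiding w"
  shows "\<exists>i. u @ [i] \<in> avoiding w"
proof -
  have "\<exists>i::'k. i \<noteq> last w"
  proof (rule ccontr)
    assume "\<not> ?thesis"
    then have "(UNIV :: 'k set) = {last w}" by auto
    then have "CARD('k) = 1" by (metis card.empty card_insert_disjoint empty_iff finite.emptyI One_nat_def)
    then show False using k by simp
  qed
  then obtain i where i: "i \<noteq> last w" ..
  have "\<not> sublist w (u @ [i])"
  proof
    assume "sublist w (u @ [i])"
    then have "suffix w (u @ [i])" using u by (auto simp: avoiding_def sublist_snoc)
    then show False using i w by (auto simp: suffix_def) (metis last_appendR last_snoc)
  qed
  then show ?thesis by (auto simp: avoiding_def)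
qed

lemma survivors_eq: "survivors (cylinder w) = {x. \<forall>n. stake n x \<in> avoiding w}"
proof (intro set_eqI iffI)
  fix x assume x: "x \<in> survivors (cylinder w)"
  have "\<not> sublist w (stake n x)" for n
  proof
    assume "sublist w (stake n x)"
    then obtain ps ss where e: "stake n x = ps @ w @ ss" by (auto simp: sublist_def)
    have len: "n = length ps + length w + length ss" using arg_cong[OF e, of length] by simp
    have "w = take (length w) (drop (length ps) (stake n x))" by (simp add: e)
    also have "\<dots> = stake (length w) (sdrop (length ps) x)"
      using len by (simp add: drop_stake take_stake)
    finally have "stake (length w) (sdrop (length ps) x) = w" ..
    then show False using x by (auto simp: survivors_def cylinder_def)
  qed
  then show "x \<in> {x. \<forall>n. stake n x \<in> avoiding w}" by (simp add: avoiding_def)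
next
  fix x assume x: "x \<in> {x. \<forall>n. stake n x \<in> avoiding w}"
  have "stake (length w) (sdrop j x) \<noteq> w" for j
  proof
    assume "stake (length w) (sdrop j x) = w"
    then have "stake (j + length w) x = stake j x @ w @ []" by (simp add: stake_add[symmetric])
    then have "sublist w (stake (j + length w) x)" unfolding sublist_def by blast
    then show False using x by (auto simp: avoiding_def)
  qed
  then show "x \<in> survivors (cylinder w)" by (auto simp: survivors_def cylinder_def)
qed

text \<open>The avoiding language has no dead ends, so prefixes of survivors and avoiding words
  coincide. This identifies the sums in the reduced pressure with level sums.\<close>

lemma stake_survivors:
  fixes w :: "'k::finite list"
  assumes k: "2 \<le> CARD('k)" and w: "w \<noteq> []"
  shows "stake n ` survivors (cylinder w) = level (avoiding w) n"
proof (intro set_eqI iffI)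
  fix u assume "u \<in> stake n ` survivors (cylinder w)"
  then show "u \<in> level (avoiding w) n" by (auto simp: survivors_eq level_def)
next
  fix u assume "u \<in> level (avoiding w) n"
  then have u: "u \<in> avoiding w" "length u = n" by (auto simp: level_def)
  obtain ext where ext: "\<And>u. u \<in> avoiding w \<Longrightarrow> u @ [ext u] \<in> avoiding w"
    using avoiding_extend[OF k w] by metis
  \<comment> \<open>The path follows \<open>u\<close> as long as it can and from then on appends
    safe letters.\<close>
  define \<omega> where "\<omega> u' = (if strict_prefix u' u then u ! length u' else ext u')" for u'
  have \<omega>_ext: "\<omega> v = ext v" if "\<not> strict_prefix v u" for v using that by (simp add: \<omega>_def)
  have \<omega>_u: "\<omega> v = u ! length v" if "strict_prefix v u" for v using that by (simp add: \<omega>_def)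
  have "tree_path \<omega> \<in> cylinder u"
    unfolding tree_path_in_cylinder
  proof
    fix u' assume "u' \<in> (\<lambda>j. take j u) ` {..<length u}"
    then have "strict_prefix u' u" by (auto simp: strict_prefix_def take_is_prefix)
    then show "\<omega> u' = u ! length u'" by (simp add: \<omega>_u)
  qed
  moreover have "tree_prefix \<omega> m \<in> avoiding w" for m
  proof (induction m)
    case 0
    then show ?case using w by (simp add: avoiding_def)
  next
    case (Suc m)
    show ?case
    proof (cases "strict_prefix (tree_prefix \<omega> m) u")
      case True
      then obtain i v where "u = tree_prefix \<omega> m @ i # v" by (rule strict_prefixE')
      then have "tree_prefix \<omega> (Suc m) @ v = u" using True by (simp add: \<omega>_u nth_append)
      then show ?thesis
        using factorial_languageD(1)[OF factorial_language_avoiding[OF w]] u by metis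
    next
      case False
      then show ?thesis using ext[OF Suc] \<omega>_ext[of "tree_prefix \<omega> m"] by simp
    qed
  qed
  then have "tree_path \<omega> \<in> survivors (cylinder w)" by (simp add: survivors_eq stake_tree_path)
  ultimately show "u \<in> stake n ` survivors (cylinder w)"
    using u(2) by (intro image_eqI[of _ _ "tree_path \<omega>"]) (auto simp: cylinder_def)
qed

lemma level_avoiding_nonempty:
  fixes w :: "'k::finite list"
  assumes k: "2 \<le> CARD('k)" and w: "w \<noteq> []"
  shows "level (avoiding w) n \<noteq> {}"
proof (induction n)
  case 0
  then show ?case using w by (auto simp: level_def avoiding_def)
next
  case (Suc n)
  then obtain u where "u \<in> avoiding w" "length u = n" by (auto simp: level_def)
  then show ?case using avoiding_extend[OF k w, of u] by (auto simp: level_def)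
qed

lemma growth_UNIV:
  fixes p :: "'k::finite \<Rightarrow> real"
  assumes "\<And>i. 0 < p i"
  shows "growth p UNIV = ln (sum p UNIV)"
proof -
  have pos: "0 < sum p UNIV" using assms by (intro sum_pos) auto
  have "(\<lambda>n. 1 / real n * ln (level_sum p UNIV n)) \<longlonglongrightarrow> ln (sum p UNIV)"
  proof (rule tendsto_eventually)
    show "\<forall>\<^sub>F n in sequentially. 1 / real n * ln (level_sum p UNIV n) = ln (sum p UNIV)"
      using eventually_gt_at_top[of 0]
      by eventually_elim (use pos in \<open>simp add: level_sum_UNIV ln_realpow\<close>)
  qed
  then show ?thesis unfolding growth_def by (rule limI)
qed

lemma level_UNIV_nonempty: "level UNIV n \<noteq> {}"
proof -
  have "replicate n undefined \<in> level UNIV n" by (simp add: level_def)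
  then show ?thesis by blast
qed

lemma growth_le_of_psum_le:
  fixes p p' :: "'k::finite \<Rightarrow> real"
  assumes V: "factorial_language V" "\<And>n. level V n \<noteq> {}" and V': "factorial_language V'" "\<And>n. level V' n \<noteq> {}"
    and pos: "\<And>i. 0 < p i" "\<And>i. 0 < p' i" and c: "0 < c"
    and le: "\<And>n. level_sum p V n \<le> level_sum p' V' n * c ^ n"
  shows "growth p V \<le> growth p' V' + ln c"
proof (rule LIMSEQ_le)
  show "(\<lambda>n. 1 / real n * ln (level_sum p V n)) \<longlonglongrightarrow> growth p V" by (rule growth_exists(1)[OF V pos(1)])
  show "(\<lambda>n. 1 / real n * ln (level_sum p' V' n) + ln c) \<longlonglongrightarrow> growth p' V' + ln c"
    by (intro tendsto_add growth_exists(1)[OF V' pos(2)] tendsto_const)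
  show "\<exists>N. \<forall>n\<ge>N. 1 / real n * ln (level_sum p V n) \<le> 1 / real n * ln (level_sum p' V' n) + ln c"
  proof (intro exI[of _ 1] allI impI)
    fix n :: nat assume n: "1 \<le> n"
    have p0: "0 < level_sum p V n" "0 < level_sum p' V' n"
      using growth_exists(2)[where p = p, OF V pos(1), of n] growth_exists(2)[where p = p', OF V' pos(2), of n]
      by (meson exp_gt_zero less_le_trans)+
    have "ln (level_sum p V n) \<le> ln (level_sum p' V' n * c ^ n)" using le p0 by (intro ln_mono)
    also have "\<dots> = ln (level_sum p' V' n) + real n * ln c" using p0 c by (simp add: ln_mult ln_realpow)
    finally show "1 / real n * ln (level_sum p V n) \<le> 1 / real n * ln (level_sum p' V' n) + ln c"
      using n by (simp add: field_simps)
  qed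
qed

context diagonal_ifs
begin

abbreviation "pw D s \<equiv> (\<lambda>i. phi D s (a i))"

lemma pw_pos: "0 < pw D s i"
  by (rule phi_pos) (rule nz)

lemma wt_pw_0 [simp]: "wt (pw D 0) w = 1"
proof -
  have "pw D 0 i = 1" for i using nz by (simp add: phi_def cap_def)
  then show ?thesis by (induction w) auto
qed

definition min_entry :: real where "min_entry = Min (range (\<lambda>(i, c). \<bar>a i c\<bar>))"

lemma min_entry: "0 < min_entry" "min_entry \<le> \<bar>a i c\<bar>" "min_entry \<le> \<alpha>"
proof -
  show "0 < min_entry" unfolding min_entry_def using nz by (auto simp: Min_gr_iff)
  show "min_entry \<le> \<bar>a i c\<bar>" for i c unfolding min_entry_def by (rule Min_le) auto
  then show "min_entry \<le> \<alpha>" using bound order_trans by blast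
qed

lemma pw_exponent:
  assumes D: "D \<in> orderings" and s: "0 \<le> s" "s \<le> t" "t \<le> real CARD('d)"
  shows "pw D t i \<le> pw D s i * \<alpha> powr (t - s)" "pw D s i * min_entry powr (t - s) \<le> pw D t i"
  using phi_mono_exponent[OF D s, of "a i" min_entry \<alpha>] nz min_entry bound by auto

lemma wt_pw_exponent:
  assumes D: "D \<in> orderings" and s: "0 \<le> s" "s \<le> t" "t \<le> real CARD('d)"
  shows "wt (pw D t) w \<le> wt (pw D s) w * (\<alpha> powr (t - s)) ^ length w"
    "wt (pw D s) w * (min_entry powr (t - s)) ^ length w \<le> wt (pw D t) w"
proof -
  show "wt (pw D t) w \<le> wt (pw D s) w * (\<alpha> powr (t - s)) ^ length w"
    using phi_cf_exponent[OF D s, of w] by (simp add: phi_wt)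
  show "wt (pw D s) w * (min_entry powr (t - s)) ^ length w \<le> wt (pw D t) w"
  proof (induction w)
    case (Cons i w)
    have "(pw D s i * min_entry powr (t - s)) * (wt (pw D s) w * (min_entry powr (t - s)) ^ length w) \<le> pw D t i * wt (pw D t) w"
      using pw_exponent(2)[OF D s] Cons min_entry pw_pos
      by (intro mult_mono) (auto intro!: mult_nonneg_nonneg wt_nonneg less_imp_le[OF pw_pos])
    then show ?case by (simp add: ac_simps)
  qed simp
qed

definition Q :: "'d list \<Rightarrow> real \<Rightarrow> real" where
  "Q D s = sum (pw D s) UNIV"

lemma Q_pos: "0 < Q D s"
  unfolding Q_def by (intro sum_pos) (auto intro: pw_pos)

lemma Q_exponent:
  assumes D: "D \<in> orderings" and s: "0 \<le> s" "s \<le> t" "t \<le> real CARD('d)"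
  shows "Q D t \<le> Q D s * \<alpha> powr (t - s)" "Q D s * min_entry powr (t - s) \<le> Q D t"
  unfolding Q_def sum_distrib_right using pw_exponent[OF D s] by (auto intro: sum_mono)

text \<open>Raising the exponent multiplies each letter weight by a factor between the powers of
  \<open>min_entry\<close> and \<alpha>. The growth is thus Lipschitz and strictly decreasing in the
  exponent, for existence and uniqueness of its zero.\<close>

lemma pressure_slope:
  assumes V: "factorial_language V" "\<And>n. level V n \<noteq> {}" and D: "D \<in> orderings"
    and s: "0 \<le> s" "s \<le> t" "t \<le> real CARD('d)"
  shows "growth (pw D t) V \<le> growth (pw D s) V + (t - s) * ln \<alpha>"
    "growth (pw D s) V + (t - s) * ln min_entry \<le> growth (pw D t) V"
proof -
  have "growth (pw D t) V \<le> growth (pw D s) V + ln (\<alpha> powr (t - s))"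
  proof (rule growth_le_of_psum_le[OF V V pw_pos pw_pos])
    show "level_sum (pw D t) V n \<le> level_sum (pw D s) V n * (\<alpha> powr (t - s)) ^ n" for n
      unfolding level_sum_def sum_distrib_right
      using wt_pw_exponent(1)[OF D s] by (intro sum_mono) (auto simp: level_def)
  qed (use \<alpha>_pos in simp)
  then show "growth (pw D t) V \<le> growth (pw D s) V + (t - s) * ln \<alpha>" using \<alpha>_pos by (simp add: ln_powr)
  have "growth (pw D s) V \<le> growth (pw D t) V + ln (min_entry powr (s - t))"
  proof (rule growth_le_of_psum_le[OF V V pw_pos pw_pos])
    show "level_sum (pw D s) V n \<le> level_sum (pw D t) V n * (min_entry powr (s - t)) ^ n" for n
      unfolding level_sum_def sum_distrib_right
    proof (rule sum_mono)
      fix w assume "w \<in> level V n"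
      then have n: "length w = n" by (simp add: level_def)
      have "wt (pw D s) w = wt (pw D s) w * (min_entry powr (t - s)) ^ n * (min_entry powr (s - t)) ^ n"
        using min_entry(1) by (simp add: mult.assoc power_mult_distrib[symmetric] powr_add[symmetric])
      also have "\<dots> \<le> wt (pw D t) w * (min_entry powr (s - t)) ^ n"
        using wt_pw_exponent(2)[OF D s, of w] n by (intro mult_right_mono) auto
      finally show "wt (pw D s) w \<le> wt (pw D t) w * (min_entry powr (s - t)) ^ n" .
    qed
  qed (use min_entry in simp)
  then show "growth (pw D s) V + (t - s) * ln min_entry \<le> growth (pw D t) V" using min_entry(1) by (simp add: ln_powr algebra_simps)
qed

text \<open>At exponent 0 every word has weight 1, so a nonempty language has nonnegative growth
  there; continuity does the rest.\<close>

lemma pressure_zero: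
  assumes V: "factorial_language V" "\<And>n. level V n \<noteq> {}" and D: "D \<in> orderings"
    and T: "0 \<le> T" "T \<le> real CARD('d)" "growth (pw D T) V \<le> 0"
  obtains t where "0 \<le> t" "t \<le> T" "growth (pw D t) V = 0"
proof -
  let ?L = "\<lambda>s. growth (pw D s) V"
  have L0: "0 \<le> ?L 0"
  proof (rule LIMSEQ_le_const[OF growth_exists(1)[where p = "pw D 0", OF V pw_pos]], intro exI allI impI)
    fix n :: nat
    obtain w where w: "w \<in> level V n" using V(2)[of n] by auto
    have "wt (pw D 0) w \<le> level_sum (pw D 0) V n"
      unfolding level_sum_def using w by (intro member_le_sum) (auto intro: wt_nonneg less_imp_le[OF pw_pos])
    then show "0 \<le> 1 / real n * ln (level_sum (pw D 0) V n)" by simp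
  qed
  have cont: "continuous_on {0..T} ?L"
  proof -
    define M where "M = \<bar>ln min_entry\<bar> + \<bar>ln \<alpha>\<bar>"
    have lip: "\<bar>?L t - ?L s\<bar> \<le> M * (t - s)" if st: "0 \<le> s" "s \<le> t" "t \<le> T" for s t
    proof -
      have "?L t - ?L s \<le> (t - s) * ln \<alpha>" "(t - s) * ln min_entry \<le> ?L t - ?L s"
        using pressure_slope[OF V D st(1,2)] st T by auto
      moreover have "(t - s) * ln \<alpha> \<le> (t - s) * M" "(t - s) * (- M) \<le> (t - s) * ln min_entry"
        using st by (auto simp: M_def intro!: mult_left_mono)
      ultimately show ?thesis by (simp add: abs_le_iff algebra_simps)
    qed
    have "M-lipschitz_on {0..T} ?L"
    proof (rule lipschitz_onI)
      fix s t assume st: "s \<in> {0..T}" "t \<in> {0..T}"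
      show "dist (?L s) (?L t) \<le> M * dist s t"
        using lip[of s t] lip[of t s] st by (cases "s \<le> t") (auto simp: dist_real_def abs_minus_commute)
    qed (simp add: M_def)
    then show ?thesis by (rule lipschitz_on_continuous_on)
  qed
  obtain t where "0 \<le> t" "t \<le> T" "?L t = 0"
    using IVT2'[of ?L T 0 0] T L0 cont by auto
  then show ?thesis using that by blast
qed

lemma pressure_zero_unique:
  assumes V: "factorial_language V" "\<And>n. level V n \<noteq> {}" and D: "D \<in> orderings"
    and "0 \<le> s" "s \<le> real CARD('d)" "growth (pw D s) V = 0"
    and "0 \<le> t" "t \<le> real CARD('d)" "growth (pw D t) V = 0"
  shows "s = t"
proof -
  have "ln \<alpha> < 0" using \<alpha>_pos \<alpha>_less by simp
  have *: "t \<le> s" if "0 \<le> s" "s \<le> t" "t \<le> real CARD('d)" "growth (pw D s) V = 0" "growth (pw D t) V = 0" for s t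
  proof -
    have "0 \<le> (t - s) * ln \<alpha>" using pressure_slope(1)[OF V D that(1-3)] that by simp
    then show ?thesis using \<open>ln \<alpha> < 0\<close> by (simp add: zero_le_mult_iff)
  qed
  show ?thesis using *[of s t] *[of t s] assms by (cases "s \<le> t") auto
qed

lemma critical_hole:
  assumes k: "2 \<le> CARD('k)" and w: "w \<noteq> []" and D: "D \<in> orderings"
    and t: "0 \<le> t" "t \<le> real CARD('d)" "growth (pw D t) (avoiding w) = 0"
  shows "(Q D t - 1) * correlation (pw D t) w 1 = wt (pw D t) w"
    and "0 < z \<Longrightarrow> z < 1 \<Longrightarrow> z * Q D t < 1 + z ^ length w"
proof -
  note V = factorial_language_avoiding[OF w] level_avoiding_nonempty[OF k w]
  have ge1: "1 \<le> level_sum (pw D t) (avoiding w) n" for n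
    using growth_exists(2)[where p = "pw D t", OF V pw_pos, of n] t by simp
  have sm: "summable (\<lambda>n. level_sum (pw D t) (avoiding w) n * z ^ n)" if "0 < z" "z < 1" for z
    using level_sum_summable[where p = "pw D t", OF V pw_pos _ that] t by simp
  show "(Q D t - 1) * correlation (pw D t) w 1 = wt (pw D t) w"
    unfolding Q_def by (rule avoiding_critical_equation[OF w pw_pos ge1 sm])
  have "(\<alpha> powr t) ^ length w \<le> 1"
    using \<alpha>_pos \<alpha>_less t by (intro power_le_one powr_le1) auto
  then have "wt (pw D t) w \<le> 1" using wt_pw_exponent(1)[OF D, of 0 t w] t by simp
  then show "z * Q D t < 1 + z ^ length w" if "0 < z" "z < 1"
    unfolding Q_def by (intro avoiding_critical_bound[OF w pw_pos ge1 sm[OF that] that])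
qed

end

section \<open>Shrinking holes\<close>

lemma overlaps_stake:
  assumes "j < q"
  shows "j \<in> overlaps (stake q x) \<longleftrightarrow> stake (q - j) (sdrop j x) = stake (q - j) x"
  using assms by (simp add: overlaps_def drop_stake take_stake min_def)

text \<open>If the stream and its shift by \<open>j\<close> differ, they differ at some index
  \<open>i\<close>, and this becomes visible in the prefix once \<open>q > i + j\<close>.\<close>

lemma overlaps_stake_eventually:
  "\<forall>\<^sub>F q in sequentially. j \<in> overlaps (stake q x) \<longleftrightarrow> sdrop j x = x"
proof (cases "sdrop j x = x")
  case True
  have "\<forall>\<^sub>F q in sequentially. j < q" by (rule eventually_gt_at_top)
  then show ?thesis by eventually_elim (simp add: True overlaps_stake)
next
  case False
  then obtain i where i: "sdrop j x !! i \<noteq> x !! i" using stream_eqI by blast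
  have "\<forall>\<^sub>F q in sequentially. i + j < q" by (rule eventually_gt_at_top)
  then show ?thesis
  proof eventually_elim
    case (elim q)
    have "stake (q - j) (sdrop j x) ! i \<noteq> stake (q - j) x ! i" using i elim by simp
    then have "stake (q - j) (sdrop j x) \<noteq> stake (q - j) x" by metis
    then show ?case using False elim by (simp add: overlaps_stake)
  qed
qed

lemma sdrop_eq_iff_period:
  assumes p: "has_period x l"
  shows "sdrop j x = x \<longleftrightarrow> l dvd j"
proof -
  have l: "1 \<le> l" "sdrop l x = x" "\<And>m. 1 \<le> m \<Longrightarrow> m < l \<Longrightarrow> sdrop m x \<noteq> x"
    using p by (auto simp: has_period_def)
  have mult: "sdrop (n * l) x = x" for n
  proof (induction n)
    case (Suc n)
    have "sdrop (l + n * l) x = sdrop (n * l) (sdrop l x)" by (simp add: sdrop_add)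
    then show ?case using Suc l(2) by (simp add: add.commute)
  qed simp
  have "sdrop j x = sdrop (j mod l) x"
  proof -
    have "sdrop j x = sdrop ((j div l) * l + j mod l) x" by simp
    also have "\<dots> = sdrop (j mod l) (sdrop ((j div l) * l) x)" by (simp only: sdrop_add)
    finally show ?thesis by (simp only: mult)
  qed
  moreover have "j mod l < l" using l(1) by simp
  ultimately show ?thesis using l(3)[of "j mod l"] by (cases "j mod l = 0") (auto simp: dvd_eq_mod_eq_0)
qed

lemma sdrop_neq_if_not_periodic:
  assumes "\<nexists>l. has_period x l" "1 \<le> j"
  shows "sdrop j x \<noteq> x"
proof
  assume eq: "sdrop j x = x"
  define l where "l = (LEAST m. 1 \<le> m \<and> sdrop m x = x)"
  have "1 \<le> l \<and> sdrop l x = x" unfolding l_def by (rule LeastI[of _ j]) (use eq assms in auto)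
  moreover have "\<not> (1 \<le> m \<and> sdrop m x = x)" if "m < l" for m
    using that not_less_Least unfolding l_def by blast
  ultimately have "has_period x l" by (auto simp: has_period_def)
  then show False using assms by blast
qed

context diagonal_ifs
begin

context
  fixes D :: "'d list" and s0 :: real
  assumes D: "D \<in> orderings" and s0: "0 < s0" "s0 \<le> real CARD('d)" and Q1: "Q D s0 = 1"
begin

text \<open>The list position, counted from 0, of the entry e_{\<lceil>s_0\<rceil>}. Its exponent is
  the only one that moves when s_0 is slightly decreased, also if s_0 is an integer.\<close>

definition last_index :: nat where "last_index = nat \<lceil>s0\<rceil> - 1"

text \<open>Minus the inner product in the formula for Z(D): since the weights
  \<open>pw D s0\<close> sum to 1, they are the maximising probability vector there. Hence Z(D) =
  1/slope.\<close>

definition slope :: real where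
  "slope = (\<Sum>i\<in>UNIV. - ln \<bar>a i (D ! last_index)\<bar> * pw D s0 i)"

lemma last_index: "real last_index < s0" "s0 \<le> real last_index + 1" "last_index < length D"
proof -
  have "1 \<le> nat \<lceil>s0\<rceil>" using s0 by linarith
  then have "real last_index = real_of_int \<lceil>s0\<rceil> - 1" using s0 by (simp add: last_index_def of_nat_diff)
  then show *: "real last_index < s0" "s0 \<le> real last_index + 1" by linarith+
  have "real last_index < real (length D)" using * s0 orderings_props(3)[OF D] by simp
  then show "last_index < length D" by simp
qed

text \<open>On this unit interval the exponents before \<open>last_index\<close> are all 1 and those
  after it all 0, so only one factor varies.\<close>

lemma phi_local:
  fixes b :: "'d \<Rightarrow> real"
  assumes s: "real last_index \<le> s" "s \<le> real last_index + 1" and b: "\<And>c. b c \<noteq> 0"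
  shows "phi D s b = phi D s0 b * \<bar>b (D ! last_index)\<bar> powr (s - s0)"
proof -
  let ?m = last_index
  have split: "phi D r b = \<bar>b (D ! ?m)\<bar> powr cap r ?m * (\<Prod>j\<in>{..<length D} - {?m}. \<bar>b (D ! j)\<bar> powr cap r j)" for r
    unfolding phi_def using last_index(3) by (intro prod.remove) auto
  have "cap s j = cap s0 j" if "j \<noteq> ?m" for j
  proof -
    have "real j + 1 \<le> real ?m \<or> real ?m + 1 \<le> real j" using that by linarith
    then consider "real j + 1 \<le> real ?m" | "real ?m + 1 \<le> real j" by blast
    then show ?thesis using s last_index by cases (auto simp: cap_def)
  qed
  then have "(\<Prod>j\<in>{..<length D} - {?m}. \<bar>b (D ! j)\<bar> powr cap s j) = (\<Prod>j\<in>{..<length D} - {?m}. \<bar>b (D ! j)\<bar> powr cap s0 j)"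
    by (intro prod.cong) auto
  moreover have "\<bar>b (D ! ?m)\<bar> powr cap s ?m = \<bar>b (D ! ?m)\<bar> powr cap s0 ?m * \<bar>b (D ! ?m)\<bar> powr (s - s0)"
    using s last_index b by (simp add: cap_def powr_add[symmetric])
  ultimately show ?thesis unfolding split[of s] split[of s0] by simp
qed

lemma slope_pos: "0 < slope"
  unfolding slope_def
proof (intro sum_pos mult_pos_pos pw_pos)
  fix i
  have "0 < \<bar>a i (D ! last_index)\<bar>" "\<bar>a i (D ! last_index)\<bar> < 1" using nz bound[of i "D ! last_index"] \<alpha>_less by auto
  then show "0 < - ln \<bar>a i (D ! last_index)\<bar>" by simp
qed auto

text \<open>To the left of \<open>s0\<close> the sum of weights agrees with a combination of
  exponentials that is smooth on both sides of \<open>h = 0\<close>, which can then be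
  differentiated. At an integral \<open>s0\<close> a different entry would start to move to the
  right, so only the one-sided limit is available for \<open>Q\<close>.\<close>

lemma Q_local:
  shows "\<forall>\<^sub>F h in at_right 0. Q D (s0 - h) = (\<Sum>i\<in>UNIV. pw D s0 i * \<bar>a i (D ! last_index)\<bar> powr (- h))"
proof -
  have "\<forall>\<^sub>F h in at_right 0. h \<in> {0<..<s0 - real last_index}"
    by (rule eventually_at_right_real) (use last_index in simp)
  then show ?thesis
  proof eventually_elim
    case (elim h)
    then show ?case unfolding Q_def using last_index
      by (intro sum.cong refl) (subst phi_local, auto simp: nz)
  qed
qed

lemma Q_deriv:
  "((\<lambda>h. \<Sum>i\<in>UNIV. pw D s0 i * \<bar>a i (D ! last_index)\<bar> powr (- h)) has_real_derivative slope) (at 0)"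
  unfolding slope_def
  by (auto intro!: derivative_eq_intros sum.cong simp: nz)

lemma Q_slope: "((\<lambda>h. (Q D (s0 - h) - 1) / h) \<longlongrightarrow> slope) (at_right 0)"
proof -
  let ?q = "\<lambda>h. \<Sum>i\<in>UNIV. pw D s0 i * \<bar>a i (D ! last_index)\<bar> powr (- h)"
  have q0: "?q 0 = 1" using Q1 nz by (simp add: Q_def)
  have "((\<lambda>h. (?q h - 1) / h) \<longlongrightarrow> slope) (at 0)"
    using Q_deriv q0 unfolding has_field_derivative_iff by simp
  then have "((\<lambda>h. (?q h - 1) / h) \<longlongrightarrow> slope) (at_right 0)"
    by (rule tendsto_mono[OF at_le[OF subset_UNIV]])
  then show ?thesis
    by (rule Lim_transform_eventually) (use Q_local in \<open>eventually_elim, simp\<close>)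
qed

lemma ln_Q_slope: "((\<lambda>h. 1 / h * (ln (Q D s0) - ln (Q D (s0 - h)))) \<longlongrightarrow> - slope) (at_right 0)"
proof -
  let ?q = "\<lambda>h. \<Sum>i\<in>UNIV. pw D s0 i * \<bar>a i (D ! last_index)\<bar> powr (- h)"
  have q0: "?q 0 = 1" using Q1 nz by (simp add: Q_def)
  have "((\<lambda>h. ln (?q h)) has_real_derivative slope) (at 0)"
    using DERIV_chain2[OF DERIV_ln_divide[of "?q 0"] Q_deriv] q0 by simp
  then have "((\<lambda>h. ln (?q h) / h) \<longlongrightarrow> slope) (at 0)"
    unfolding has_field_derivative_iff using q0 by simp
  then have "((\<lambda>h. - (ln (?q h) / h)) \<longlongrightarrow> - slope) (at_right 0)"
    by (intro tendsto_minus) (rule tendsto_mono[OF at_le[OF subset_UNIV]])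
  then show ?thesis
    by (rule Lim_transform_eventually) (use Q_local in \<open>eventually_elim, simp add: Q1\<close>)
qed

context
  fixes qs :: "'k stream" and t :: "nat \<Rightarrow> real"
  assumes k: "2 \<le> CARD('k)"
    and t: "\<And>q. 1 \<le> q \<Longrightarrow> 0 \<le> t q" "\<And>q. 1 \<le> q \<Longrightarrow> t q \<le> real CARD('d)"
      "\<And>q. 1 \<le> q \<Longrightarrow> growth (pw D (t q)) (avoiding (stake q qs)) = 0"
begin

lemma stake_ne: "1 \<le> q \<Longrightarrow> stake q qs \<noteq> []"
  by (cases q) auto

lemma corr_ge_1: "1 \<le> q \<Longrightarrow> 1 \<le> correlation (pw D (t q)) (stake q qs) 1"
  using stake_ne pw_pos by (intro correlation_ge_1) auto

lemma crit: "1 \<le> q \<Longrightarrow> (Q D (t q) - 1) * correlation (pw D (t q)) (stake q qs) 1 = wt (pw D (t q)) (stake q qs)"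
  by (rule critical_hole(1)[OF k stake_ne D t])

lemma Q_gt_1: "1 \<le> q \<Longrightarrow> 1 < Q D (t q)"
proof -
  assume q: "1 \<le> q"
  have "0 < (Q D (t q) - 1) * correlation (pw D (t q)) (stake q qs) 1"
    unfolding crit[OF q] by (rule wt_pos) (rule pw_pos)
  then show ?thesis using corr_ge_1[OF q] by (simp add: zero_less_mult_iff)
qed

lemma t_less: "1 \<le> q \<Longrightarrow> t q < s0"
proof (rule ccontr)
  assume q: "1 \<le> q" and "\<not> t q < s0"
  then have "Q D (t q) \<le> Q D s0 * \<alpha> powr (t q - s0)"
    using s0 t(2)[OF q] by (intro Q_exponent D) auto
  also have "\<dots> \<le> 1" using \<open>\<not> t q < s0\<close> \<alpha>_pos \<alpha>_less by (simp add: Q1 powr_le1)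
  finally show False using Q_gt_1[OF q] by simp
qed

text \<open>From Q(t) >= \<alpha>^(-(s_0-t)) and exp x >= 1 + x. An upper bound for
  \<open>Q D (t q) - 1\<close> thereby becomes a linear bound for the gap.\<close>

lemma Q_growth: "1 \<le> q \<Longrightarrow> 1 + (s0 - t q) * (- ln \<alpha>) \<le> Q D (t q)"
proof -
  assume q: "1 \<le> q"
  have "1 \<le> Q D (t q) * \<alpha> powr (s0 - t q)"
    using Q_exponent(1)[OF D t(1)[OF q] less_imp_le[OF t_less[OF q]] s0(2)] by (simp add: Q1)
  then have "\<alpha> powr (- (s0 - t q)) \<le> Q D (t q)"
    using \<alpha>_pos by (simp only: powr_minus_divide) (simp add: pos_divide_le_eq)
  moreover have "1 + (s0 - t q) * (- ln \<alpha>) \<le> \<alpha> powr (- (s0 - t q))"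
    using exp_ge_add_one_self[of "(s0 - t q) * (- ln \<alpha>)"] \<alpha>_pos by (simp add: powr_def algebra_simps)
  ultimately show ?thesis by simp
qed

lemma ln_\<alpha>_neg: "ln \<alpha> < 0"
  using \<alpha>_pos \<alpha>_less by simp

text \<open>The equation \<open>crit\<close> at \<open>z = 1\<close> alone does not exclude that \<open>t q\<close> stays away from \<open>s0\<close>; the positivity
  of the denominator at a fixed \<open>z < 1\<close>, where \<open>z ^ q\<close> is small, does.\<close>

lemma t_lim: "t \<longlonglongrightarrow> s0"
proof (rule order_tendstoI)
  fix b assume b: "b < s0"
  define \<beta> where "\<beta> = 1 + (s0 - b) * (- ln \<alpha>)"
  have \<beta>: "1 < \<beta>" using b ln_\<alpha>_neg by (simp add: \<beta>_def mult_pos_neg)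
  \<comment> \<open>With \<beta> > 1 this choice satisfies both \<open>z < 1\<close> and
    \<open>1 < z * \<beta>\<close>, leaving room for \<open>z ^ q\<close>.\<close>
  define z where "z = 2 / (1 + \<beta>)"
  have z: "0 < z" "z < 1" "1 < z * \<beta>" using \<beta> by (auto simp: z_def field_simps)
  have "(\<lambda>q. z ^ q) \<longlonglongrightarrow> 0" using z by (intro LIMSEQ_realpow_zero) auto
  then have "\<forall>\<^sub>F q in sequentially. z ^ q < z * \<beta> - 1" by (rule order_tendstoD) (use z in simp)
  moreover have "\<forall>\<^sub>F q in sequentially. 1 \<le> (q::nat)" by (rule eventually_ge_at_top)
  ultimately show "\<forall>\<^sub>F q in sequentially. b < t q"
  proof eventually_elim
    case (elim q)
    have "z * Q D (t q) < 1 + z ^ length (stake q qs)"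
      by (rule critical_hole(2)[OF k stake_ne D t z(1,2)]) (use elim in auto)
    then have "z * Q D (t q) < z * \<beta>" using elim by simp
    then have "Q D (t q) < \<beta>" using z by simp
    then have "(s0 - t q) * (- ln \<alpha>) < (s0 - b) * (- ln \<alpha>)"
      using Q_growth[of q] elim by (simp add: \<beta>_def)
    then show "b < t q" using ln_\<alpha>_neg by (simp add: mult_less_cancel_right)
  qed
next
  fix b assume "s0 < b"
  have "\<forall>\<^sub>F q in sequentially. 1 \<le> (q::nat)" by (rule eventually_ge_at_top)
  then show "\<forall>\<^sub>F q in sequentially. t q < b"
    by eventually_elim (use t_less \<open>s0 < b\<close> in fastforce)
qed

text \<open>Once \<open>t q \<ge> s0 / 2\<close>, this bounds the weight of a letter uniformly in
  \<open>q\<close>; it serves as geometric majorant below.\<close>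

definition decay :: real where "decay = \<alpha> powr (s0 / 2)"

lemma decay: "0 < decay" "decay < 1"
  using \<alpha>_pos \<alpha>_less s0 powr_less_mono'[of \<alpha> 0 "s0 / 2"] by (auto simp: decay_def)

lemma ev_half: "\<forall>\<^sub>F q in sequentially. 1 \<le> q \<and> s0 / 2 \<le> t q"
proof -
  have "\<forall>\<^sub>F q in sequentially. s0 / 2 < t q" using t_lim s0 by (intro order_tendstoD) auto
  moreover have "\<forall>\<^sub>F q in sequentially. 1 \<le> (q::nat)" by (rule eventually_ge_at_top)
  ultimately show ?thesis by eventually_elim simp
qed

lemma wt_le_decay:
  assumes "1 \<le> q" "s0 / 2 \<le> t q"
  shows "wt (pw D (t q)) u \<le> decay ^ length u"
proof -
  have "wt (pw D (t q)) u \<le> (\<alpha> powr t q) ^ length u"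
    using wt_pw_exponent(1)[OF D, of 0 "t q" u] t[OF assms(1)] by simp
  also have "\<dots> \<le> decay ^ length u"
    unfolding decay_def using assms \<alpha>_pos \<alpha>_less by (intro power_mono powr_mono') auto
  finally show ?thesis .
qed

text \<open>A crude bootstrap: with the correlation estimated by 1, the critical equation makes the
  gap exponentially small in \<open>q\<close>. The factor \<open>q\<close> matters because the
  weights of a word of length \<open>q\<close> at exponents \<open>t q\<close> and \<open>s0\<close>
  differ by at most a power of \<open>min_entry\<close> with exponent \<open>q\<close> times the
  gap.\<close>

lemma q_gap_lim: "(\<lambda>q. real q * (s0 - t q)) \<longlonglongrightarrow> 0"
proof (rule tendsto_sandwich[where f = "\<lambda>_. 0" and h = "\<lambda>q. real q * decay ^ q / (- ln \<alpha>)"])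
  show "\<forall>\<^sub>F q in sequentially. 0 \<le> real q * (s0 - t q)"
    using ev_half by eventually_elim (use t_less in \<open>force intro!: mult_nonneg_nonneg\<close>)
  show "\<forall>\<^sub>F q in sequentially. real q * (s0 - t q) \<le> real q * decay ^ q / (- ln \<alpha>)"
    using ev_half
  proof eventually_elim
    case (elim q)
    then have q: "1 \<le> q" by simp
    have "(Q D (t q) - 1) * 1 \<le> (Q D (t q) - 1) * correlation (pw D (t q)) (stake q qs) 1"
      using Q_gt_1[OF q] corr_ge_1[OF q] by (intro mult_left_mono) auto
    also have "\<dots> \<le> decay ^ q" unfolding crit[OF q] using wt_le_decay[of q "stake q qs"] elim by simp
    finally have "(s0 - t q) * (- ln \<alpha>) \<le> decay ^ q" using Q_growth[OF q] by simp
    then have "s0 - t q \<le> decay ^ q / (- ln \<alpha>)" using ln_\<alpha>_neg by (subst pos_le_divide_eq) auto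
    then have "real q * (s0 - t q) \<le> real q * (decay ^ q / (- ln \<alpha>))" by (intro mult_left_mono) auto
    then show ?case by simp
  qed
  have "(\<lambda>q. real q * decay ^ q) \<longlonglongrightarrow> 0" using decay by (intro powser_times_n_limit_0) simp
  from tendsto_divide[OF this tendsto_const, of "- ln \<alpha>"] ln_\<alpha>_neg
  show "(\<lambda>q. real q * decay ^ q / (- ln \<alpha>)) \<longlonglongrightarrow> 0" by simp
qed simp

lemma wt_ratio:
  assumes "1 \<le> q"
  shows "wt (pw D s0) u \<le> wt (pw D (t q)) u"
    "wt (pw D (t q)) u \<le> wt (pw D s0) u * min_entry powr (- (real (length u) * (s0 - t q)))"
proof -
  note e = wt_pw_exponent[OF D t(1)[OF assms] less_imp_le[OF t_less[OF assms]] s0(2), of u]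
  have p: "0 \<le> wt (pw D (t q)) u" by (intro wt_nonneg less_imp_le[OF pw_pos])
  have "(\<alpha> powr (s0 - t q)) ^ length u \<le> 1"
    using t_less[OF assms] \<alpha>_pos \<alpha>_less by (intro power_le_one powr_le1) auto
  then show "wt (pw D s0) u \<le> wt (pw D (t q)) u"
    using e(1) mult_left_mono[OF _ p, of "(\<alpha> powr (s0 - t q)) ^ length u" 1] by simp
  have "(min_entry powr (s0 - t q)) ^ length u = min_entry powr (real (length u) * (s0 - t q))"
    using min_entry(1) by (simp add: powr_powr mult.commute flip: powr_realpow)
  then show "wt (pw D (t q)) u \<le> wt (pw D s0) u * min_entry powr (- (real (length u) * (s0 - t q)))"
    using e(2) min_entry(1) by (simp only: powr_minus_divide) (simp add: pos_le_divide_eq)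
qed

lemma wt_ratio_lim:
  assumes "(\<lambda>q. real (length (u q)) * (s0 - t q)) \<longlonglongrightarrow> 0"
  shows "(\<lambda>q. wt (pw D (t q)) (u q) / wt (pw D s0) (u q)) \<longlonglongrightarrow> 1"
proof (rule tendsto_sandwich[where f = "\<lambda>_. 1" and h = "\<lambda>q. min_entry powr (- (real (length (u q)) * (s0 - t q)))"])
  have p: "0 < wt (pw D s0) w" for w by (intro wt_pos pw_pos)
  show "\<forall>\<^sub>F q in sequentially. 1 \<le> wt (pw D (t q)) (u q) / wt (pw D s0) (u q)"
    using ev_half by eventually_elim (use wt_ratio(1) p in \<open>simp add: pos_le_divide_eq\<close>)
  show "\<forall>\<^sub>F q in sequentially. wt (pw D (t q)) (u q) / wt (pw D s0) (u q) \<le> min_entry powr (- (real (length (u q)) * (s0 - t q)))"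
    using ev_half
  proof eventually_elim
    case (elim q)
    then show ?case using wt_ratio(2)[of q "u q"] p[of "u q"] by (subst pos_divide_le_eq) (auto simp: mult.commute)
  qed
  have "(\<lambda>q. min_entry powr (- (real (length (u q)) * (s0 - t q)))) \<longlonglongrightarrow> min_entry powr (- 0)"
    using min_entry(1) by (intro tendsto_powr tendsto_minus tendsto_const assms) simp
  then show "(\<lambda>q. min_entry powr (- (real (length (u q)) * (s0 - t q)))) \<longlonglongrightarrow> 1" using min_entry(1) by simp
qed simp

text \<open>Tannery's theorem: each overlap condition stabilises to invariance of the stream under
  the shift by \<open>j\<close>, each weight converges, and \<open>decay ^ j\<close> dominates for
  all large \<open>q\<close>. The limit sums over the exact return times of the stream to
  itself.\<close>

lemma correlation_lim:
  "(\<lambda>q. correlation (pw D (t q)) (stake q qs) 1) \<longlonglongrightarrow>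
     (\<Sum>j. if sdrop j qs = qs then wt (pw D s0) (stake j qs) else 0)"
proof -
  define f where "f j q = (if j \<in> overlaps (stake q qs) then wt (pw D (t q)) (stake j qs) else 0)" for j q
  have cf: "correlation (pw D (t q)) (stake q qs) 1 = (\<Sum>j. f j q)" for q
  proof -
    have "(\<Sum>j. f j q) = (\<Sum>j\<in>overlaps (stake q qs). f j q)"
      by (rule suminf_finite) (auto simp: f_def)
    also have "\<dots> = correlation (pw D (t q)) (stake q qs) 1"
      unfolding correlation_def
      by (rule sum.cong) (auto simp: f_def take_stake overlaps_def min_def)
    finally show ?thesis ..
  qed
  have "((\<lambda>q. \<Sum>j. f j q) \<longlongrightarrow> (\<Sum>j. if sdrop j qs = qs then wt (pw D s0) (stake j qs) else 0)) sequentially"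
  proof (rule tannerys_theorem[THEN conjunct2, THEN conjunct2])
    fix j
    have "(\<lambda>q. wt (pw D (t q)) (stake j qs) / wt (pw D s0) (stake j qs)) \<longlonglongrightarrow> 1"
    proof (rule wt_ratio_lim)
      have "(\<lambda>q. real (length (stake j qs)) * (s0 - t q)) \<longlonglongrightarrow> real (length (stake j qs)) * (s0 - s0)"
        by (intro tendsto_intros t_lim)
      then show "(\<lambda>q. real (length (stake j qs)) * (s0 - t q)) \<longlonglongrightarrow> 0" by simp
    qed
    from tendsto_mult_right[OF this, of "wt (pw D s0) (stake j qs)"]
    have lim: "(\<lambda>q. wt (pw D (t q)) (stake j qs)) \<longlonglongrightarrow> wt (pw D s0) (stake j qs)"
      using wt_pos[of "pw D s0" "stake j qs"] pw_pos by simp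
    show "(f j \<longlongrightarrow> (if sdrop j qs = qs then wt (pw D s0) (stake j qs) else 0)) sequentially"
    proof (rule Lim_transform_eventually)
      show "(\<lambda>q. if sdrop j qs = qs then wt (pw D (t q)) (stake j qs) else 0) \<longlonglongrightarrow> (if sdrop j qs = qs then wt (pw D s0) (stake j qs) else 0)"
        using lim by simp
      show "\<forall>\<^sub>F q in sequentially. (if sdrop j qs = qs then wt (pw D (t q)) (stake j qs) else 0) = f j q"
        using overlaps_stake_eventually[of j qs] by eventually_elim (simp add: f_def)
    qed
  next
    show "\<forall>\<^sub>F (j, q) in at_top \<times>\<^sub>F sequentially. norm (f j q) \<le> decay ^ j"
      unfolding eventually_prod_filter
    proof (intro exI conjI allI impI)
      show "\<forall>\<^sub>F j in at_top. True" by simp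
      show "\<forall>\<^sub>F q in sequentially. 1 \<le> q \<and> s0 / 2 \<le> t q" by (rule ev_half)
      fix j q assume "1 \<le> q \<and> s0 / 2 \<le> t q"
      then show "case (j, q) of (j, q) \<Rightarrow> norm (f j q) \<le> decay ^ j"
        using wt_le_decay[of q "stake j qs"] wt_nonneg[of "pw D (t q)" "stake j qs"] less_imp_le[OF pw_pos] decay
        by (auto simp: f_def)
    qed
    show "summable (\<lambda>j. decay ^ j)" using decay by (intro summable_geometric) simp
  qed simp
  then show ?thesis by (simp add: cf)
qed

text \<open>The critical equation writes the quotient as a ratio of weights, tending to 1, over the
  product of the correlation and the difference quotient of \<open>Q\<close> at \<open>s0\<close>,
  which tends to \<open>slope\<close>.\<close>

lemma gap_asymptotics:
  "(\<lambda>q. (s0 - t q) / wt (pw D s0) (stake q qs)) \<longlonglongrightarrow>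
     1 / (slope * (\<Sum>j. if sdrop j qs = qs then wt (pw D s0) (stake j qs) else 0))"
proof -
  let ?c = "\<lambda>q. correlation (pw D (t q)) (stake q qs) 1"
  let ?C = "\<Sum>j. if sdrop j qs = qs then wt (pw D s0) (stake j qs) else 0"
  let ?r = "\<lambda>q. wt (pw D (t q)) (stake q qs) / wt (pw D s0) (stake q qs)"
  have C: "1 \<le> ?C"
    by (rule LIMSEQ_le_const[OF correlation_lim]) (use corr_ge_1 in blast)
  have r: "?r \<longlonglongrightarrow> 1" by (rule wt_ratio_lim) (use q_gap_lim in simp)
  have "filterlim (\<lambda>q. s0 - t q) (at_right 0) sequentially"
    unfolding filterlim_at
  proof
    show "\<forall>\<^sub>F q in sequentially. s0 - t q \<in> {0<..} \<and> s0 - t q \<noteq> 0"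
      using ev_half by eventually_elim (use t_less in fastforce)
    show "(\<lambda>q. s0 - t q) \<longlonglongrightarrow> 0" using tendsto_diff[OF tendsto_const t_lim, of s0] by simp
  qed
  from filterlim_compose[OF Q_slope this]
  have sl: "(\<lambda>q. (Q D (t q) - 1) / (s0 - t q)) \<longlonglongrightarrow> slope" by simp
  have "(\<lambda>q. ?r q / (?c q * ((Q D (t q) - 1) / (s0 - t q)))) \<longlonglongrightarrow> 1 / (?C * slope)"
    using C slope_pos by (intro tendsto_divide tendsto_mult r sl correlation_lim) auto
  then have "(\<lambda>q. ?r q / (?c q * ((Q D (t q) - 1) / (s0 - t q)))) \<longlonglongrightarrow> 1 / (slope * ?C)"
    by (simp add: mult.commute)
  then show ?thesis
  proof (rule Lim_transform_eventually)
    show "\<forall>\<^sub>F q in sequentially. ?r q / (?c q * ((Q D (t q) - 1) / (s0 - t q))) = (s0 - t q) / wt (pw D s0) (stake q qs)"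
      using ev_half
    proof eventually_elim
      case (elim q)
      then have q: "1 \<le> q" by simp
      have "Q D (t q) - 1 \<noteq> 0" "?c q \<noteq> 0" "s0 - t q \<noteq> 0" "wt (pw D s0) (stake q qs) \<noteq> 0"
        using Q_gt_1[OF q] corr_ge_1[OF q] t_less[OF q] wt_pos[of "pw D s0" "stake q qs"] pw_pos by auto
      then show ?case unfolding crit[OF q, symmetric] by (simp add: field_simps)
    qed
  qed
qed

end

lemma return_sum_aperiodic:
  assumes "\<nexists>l. has_period qs l"
  shows "(\<Sum>j. if sdrop j qs = qs then wt (pw D s0) (stake j qs) else 0) = 1"
proof -
  have "(\<lambda>j. if sdrop j qs = qs then wt (pw D s0) (stake j qs) else 0) = (\<lambda>j. if j = 0 then 1 else 0)"
    using sdrop_neq_if_not_periodic[OF assms] by (auto simp: fun_eq_iff)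
  then show ?thesis using sums_single[of 0 "\<lambda>_. 1::real"] by (simp add: sums_iff)
qed

text \<open>The return times are the multiples of the period, and the prefix of length
  \<open>n * l\<close> repeats one block \<open>n\<close> times, so the sum is geometric.\<close>

lemma return_sum_periodic:
  assumes p: "has_period qs l"
  shows "wt (pw D s0) (stake l qs) < 1"
    "(\<Sum>j. if sdrop j qs = qs then wt (pw D s0) (stake j qs) else 0) = 1 / (1 - wt (pw D s0) (stake l qs))"
proof -
  have l: "1 \<le> l" "sdrop l qs = qs" using p by (auto simp: has_period_def)
  let ?x = "wt (pw D s0) (stake l qs)"
  have "?x \<le> (\<alpha> powr s0) ^ l"
    using wt_pw_exponent(1)[OF D, of 0 s0 "stake l qs"] s0 by simp
  also have "\<dots> < 1"
    using l s0 \<alpha>_pos \<alpha>_less powr_less_mono'[of \<alpha> 0 s0] by (intro power_less_one_iff[THEN iffD2]) auto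
  finally show x1: "?x < 1" .
  have x0: "0 < ?x" by (intro wt_pos pw_pos)
  have pow: "wt (pw D s0) (stake (n * l) qs) = ?x ^ n" for n
  proof (induction n)
    case (Suc n)
    have "stake (Suc n * l) qs = stake l qs @ stake (n * l) (sdrop l qs)" by simp
    then show ?case using Suc l(2) by (simp del: stake_add)
  qed simp
  have "(\<lambda>n. ?x ^ n) sums (1 / (1 - ?x))" using x0 x1 by (intro Series.geometric_sums) simp
  then have "(\<lambda>n. (\<lambda>j. if l dvd j then wt (pw D s0) (stake j qs) else 0) (n * l)) sums (1 / (1 - ?x))"
    by (simp add: pow)
  moreover have "strict_mono (\<lambda>n. n * l)" using l(1) by (simp add: strict_mono_def)
  ultimately have "(\<lambda>j. if l dvd j then wt (pw D s0) (stake j qs) else 0) sums (1 / (1 - ?x))"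
    by (subst (asm) sums_mono_reindex) (auto simp: dvd_def mult.commute)
  then show "(\<Sum>j. if sdrop j qs = qs then wt (pw D s0) (stake j qs) else 0) = 1 / (1 - ?x)"
    unfolding sdrop_eq_iff_period[OF p] by (rule sums_unique[symmetric])
qed

end

end

section \<open>Diagonal matrices\<close>

context diagonal_ifs
begin

fun compose_maps :: "real^'d^'k \<Rightarrow> 'k list \<Rightarrow> real^'d \<Rightarrow> real^'d" where
  "compose_maps v [] z = z"
| "compose_maps v (i # w) z = (\<chi> c. a i c * compose_maps v w z $ c + v $ i $ c)"

lemma proj_Stream: "proj v (i ## x) = compose_maps v [i] (proj v x)"
proof (rule vec_eq_iff[THEN iffD2], rule allI)
  fix c
  show "proj v (i ## x) $ c = compose_maps v [i] (proj v x) $ c"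
    using coord_step[of c "\<lambda>i. v $ i $ c" "i ## x"] by (simp add: proj_def)
qed

lemma compose_maps_diff:
  "compose_maps v (stake n x) z $ c - proj v x $ c = cf c (stake n x) * (z $ c - proj v (sdrop n x) $ c)"
proof (induction n arbitrary: x)
  case (Suc n)
  have "proj v x $ c = v $ shd x $ c + a (shd x) c * proj v (stl x) $ c"
    using coord_step[of c "\<lambda>i. v $ i $ c" x] by (simp add: proj_def)
  then have "compose_maps v (stake (Suc n) x) z $ c - proj v x $ c =
      a (shd x) c * (compose_maps v (stake n (stl x)) z $ c - proj v (stl x) $ c)"
    by (simp add: algebra_simps)
  then show ?case using Suc[of "stl x"] by simp
qed simp

lemma compose_maps_lim:
  assumes z: "\<And>n. norm (z n) \<le> B"
  shows "(\<lambda>n. compose_maps v (stake n x) (z n)) \<longlonglongrightarrow> proj v x"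
proof (rule vec_tendstoI)
  fix c
  have "(\<lambda>n. compose_maps v (stake n x) (z n) $ c - proj v x $ c) \<longlonglongrightarrow> 0"
  proof (rule tendsto_0_le[where K = 1])
    show "(\<lambda>n. \<alpha> ^ n * (B + norm v / (1 - \<alpha>))) \<longlonglongrightarrow> 0"
      using \<alpha>_pos \<alpha>_less by (intro tendsto_mult_left_zero LIMSEQ_realpow_zero) auto
    show "\<forall>\<^sub>F n in sequentially. norm (compose_maps v (stake n x) (z n) $ c - proj v x $ c) \<le> norm (\<alpha> ^ n * (B + norm v / (1 - \<alpha>))) * 1"
    proof (intro always_eventually allI)
      fix n
      have "\<bar>z n $ c - proj v (sdrop n x) $ c\<bar> \<le> B + norm v / (1 - \<alpha>)"
        using component_le_norm_cart[of "z n" c] z[of n] proj_bound[of v "sdrop n x" c] by linarith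
      then have "\<bar>cf c (stake n x)\<bar> * \<bar>z n $ c - proj v (sdrop n x) $ c\<bar> \<le> \<alpha> ^ n * (B + norm v / (1 - \<alpha>))"
        using cf_bound[of c "stake n x"] \<alpha>_pos by (intro mult_mono) auto
      then show "norm (compose_maps v (stake n x) (z n) $ c - proj v x $ c) \<le> norm (\<alpha> ^ n * (B + norm v / (1 - \<alpha>))) * 1"
        using abs_ge_self[of "\<alpha> ^ n * (B + norm v / (1 - \<alpha>))"] unfolding compose_maps_diff abs_mult real_norm_def by linarith
    qed
  qed
  then show "(\<lambda>n. compose_maps v (stake n x) (z n) $ c) \<longlonglongrightarrow> proj v x $ c"
    by (simp add: LIM_zero_iff)
qed

text \<open>A point of an invariant set can be pulled back through the maps forever; its itinerary
  codes it, as compositions of bounded points converge to the projection. Conversely, compositions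
  applied to one point stay in the closed set and converge to every projected stream.\<close>

lemma invariant_set_unique:
  assumes L: "compact L" "L \<noteq> {}" "L = (\<Union>i. compose_maps v [i] ` L)"
  shows "L = range (proj v)"
proof (intro subset_antisym subsetI)
  obtain B where B: "\<And>z. z \<in> L \<Longrightarrow> norm z \<le> B"
    using compact_imp_bounded[OF L(1)] by (auto simp: bounded_iff)
  {
    fix z assume z: "z \<in> L"
    \<comment> \<open>Invariance supplies a letter and a preimage for each point; iterating this
      choice yields the itinerary.\<close>
    have "\<forall>z\<in>L. \<exists>i z'. z' \<in> L \<and> z = compose_maps v [i] z'" using L(3) by blast
    then obtain idx nxt where nx: "\<And>z. z \<in> L \<Longrightarrow> nxt z \<in> L \<and> z = compose_maps v [idx z] (nxt z)"
      by metis
    define x where "x z = smap idx (siterate nxt z)" for z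
    have it: "(nxt ^^ n) z \<in> L \<and> z = compose_maps v (stake n (x z)) ((nxt ^^ n) z)" if "z \<in> L" for z n
      using that
    proof (induction n arbitrary: z)
      case (Suc n)
      have xs: "x z = idx z ## x (nxt z)" by (simp add: x_def siterate.code[of nxt z])
      have "nxt z \<in> L" using nx Suc.prems by blast
      note IH = Suc.IH[OF this]
      have "z = compose_maps v [idx z] (nxt z)" using nx Suc.prems by blast
      also have "\<dots> = compose_maps v (stake (Suc n) (x z)) ((nxt ^^ n) (nxt z))"
        unfolding xs using IH by simp
      finally show ?case using IH by (simp only: funpow_Suc_right o_apply)
    qed simp
    have "(\<lambda>n. compose_maps v (stake n (x z)) ((nxt ^^ n) z)) \<longlonglongrightarrow> proj v (x z)"
      by (rule compose_maps_lim[of _ B]) (use it[OF z] B in blast)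
    moreover have "(\<lambda>n. compose_maps v (stake n (x z)) ((nxt ^^ n) z)) = (\<lambda>n. z)"
      using it[OF z] by metis
    ultimately have "z = proj v (x z)" by (simp add: LIMSEQ_const_iff)
    then show "z \<in> range (proj v)" by blast
  next
    fix z assume "z \<in> range (proj v)"
    then obtain x where x: "z = proj v x" by blast
    obtain z0 where z0: "z0 \<in> L" using L(2) by blast
    have "compose_maps v w z0 \<in> L" for w
    proof (induction w)
      case (Cons i w)
      then have "compose_maps v [i] (compose_maps v w z0) \<in> L" by (subst L(3)) blast
      then show ?case by simp
    qed (use z0 in simp)
    then have mem: "compose_maps v (stake n x) z0 \<in> L" for n .
    have lim: "(\<lambda>n. compose_maps v (stake n x) z0) \<longlonglongrightarrow> proj v x"
      by (rule compose_maps_lim[of _ B]) (use z0 B in blast)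
    show "z \<in> L"
      unfolding x by (rule closed_sequentially[OF compact_imp_closed[OF L(1)] mem lim])
  }
qed

text \<open>The closure of the range of \<open>proj v\<close> is compact for free, and its
  invariance passes over from the range. Uniqueness afterwards shows that the range was closed
  already.\<close>

lemma invariant_set_exists:
  obtains L where "compact L" "L \<noteq> {}" "L = (\<Union>i. compose_maps v [i] ` L)"
proof -
  let ?R = "range (proj v)"
  have "bounded ?R"
  proof (rule boundedI)
    fix z assume "z \<in> ?R"
    then obtain x where x: "z = proj v x" by blast
    have "norm z \<le> (\<Sum>c\<in>UNIV. \<bar>z $ c\<bar>)" by (rule norm_le_l1_cart)
    also have "\<dots> \<le> (\<Sum>c\<in>(UNIV::'d set). norm v / (1 - \<alpha>))" unfolding x by (intro sum_mono proj_bound)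
    finally show "norm z \<le> (\<Sum>c\<in>(UNIV::'d set). norm v / (1 - \<alpha>))" .
  qed
  then have cpt: "compact (closure ?R)" by (simp add: compact_closure)
  have R: "?R = (\<Union>i. compose_maps v [i] ` ?R)"
  proof (intro subset_antisym subsetI)
    fix z assume "z \<in> ?R"
    then obtain x where "z = proj v x" by blast
    then have "z = compose_maps v [shd x] (proj v (stl x))" using proj_Stream[of v "shd x" "stl x"] by simp
    then show "z \<in> (\<Union>i. compose_maps v [i] ` ?R)" by blast
  next
    fix z assume "z \<in> (\<Union>i. compose_maps v [i] ` ?R)"
    then obtain i x where "z = compose_maps v [i] (proj v x)" by blast
    then have "z = proj v (i ## x)" by (simp only: proj_Stream)
    then show "z \<in> ?R" by blast
  qed
  have cont: "continuous_on S (compose_maps v [i])" for S i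
    by (simp, intro continuous_on_vec_lambda continuous_intros)
  have "closure ?R = (\<Union>i. compose_maps v [i] ` closure ?R)"
  proof (rule subset_antisym)
    have "compact (\<Union>i. compose_maps v [i] ` closure ?R)"
      by (intro compact_UN compact_continuous_image cont cpt) auto
    then have "closed (\<Union>i. compose_maps v [i] ` closure ?R)" by (rule compact_imp_closed)
    moreover have "?R \<subseteq> (\<Union>i. compose_maps v [i] ` closure ?R)"
      by (subst R) (intro UN_mono image_mono closure_subset order_refl)
    ultimately show "closure ?R \<subseteq> (\<Union>i. compose_maps v [i] ` closure ?R)" by (rule closure_minimal[rotated])
    show "(\<Union>i. compose_maps v [i] ` closure ?R) \<subseteq> closure ?R"
    proof (rule UN_least)
      fix i
      show "compose_maps v [i] ` closure ?R \<subseteq> closure ?R"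
      proof (rule image_closure_subset[OF cont closed_closure])
        have "compose_maps v [i] ` ?R \<subseteq> ?R" by (subst (2) R) blast
        then show "compose_maps v [i] ` ?R \<subseteq> closure ?R" using closure_subset by blast
      qed
    qed
  qed
  moreover have "closure ?R \<noteq> {}" by simp
  ultimately show ?thesis using that[OF cpt] by blast
qed

end

section \<open>Singular values of diagonal matrices\<close>

lemma diagonal_matrix_vector_mult:
  fixes M :: "real^'d::finite^'d"
  assumes "\<And>r c. r \<noteq> c \<Longrightarrow> M $ r $ c = 0"
  shows "(M *v x) $ c = M $ c $ c * x $ c"
proof -
  have "(M *v x) $ c = (\<Sum>j\<in>UNIV. M $ c $ j * x $ j)" by (simp add: matrix_vector_mult_def)
  also have "\<dots> = (\<Sum>j\<in>UNIV. if j = c then M $ c $ c * x $ c else 0)"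
    using assms by (intro sum.cong) auto
  finally show ?thesis by simp
qed

lemma diagonal_word_matrix:
  fixes A :: "'k \<Rightarrow> real^'d::finite^'d"
  assumes "\<And>i r c. r \<noteq> c \<Longrightarrow> A i $ r $ c = 0"
  shows "word_matrix A w $ r $ c = (if r = c then wt (\<lambda>i. A i $ c $ c) w else 0)"
proof (induction w arbitrary: r c)
  case Nil
  then show ?case by (simp add: word_matrix_def mat_def)
next
  case (Cons i w)
  have "word_matrix A (i # w) $ r $ c = (\<Sum>j\<in>UNIV. A i $ r $ j * word_matrix A w $ j $ c)"
    by (simp add: word_matrix_def matrix_matrix_mult_def)
  also have "\<dots> = (\<Sum>j\<in>UNIV. if j = c then A i $ r $ c * wt (\<lambda>i. A i $ c $ c) w else 0)"
    unfolding Cons by (intro sum.cong) auto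
  finally show ?case using assms by simp
qed

text \<open>The product of \<open>M\<close> with its transpose is diagonal with squared entries, so
  each eigenspace is spanned by the coordinate axes whose entry has the given absolute value; its
  dimension counts them.\<close>

lemma dim_diagonal_eigenspace:
  fixes M :: "real^'d::finite^'d"
  assumes diag: "\<And>r c. r \<noteq> c \<Longrightarrow> M $ r $ c = 0" and r: "0 \<le> r"
  shows "dim {x. (transpose M ** M) *v x = r\<^sup>2 *\<^sub>R x} = card {c. \<bar>M $ c $ c\<bar> = r}"
    "{x. (transpose M ** M) *v x = r\<^sup>2 *\<^sub>R x} \<noteq> {0} \<longleftrightarrow> {c. \<bar>M $ c $ c\<bar> = r} \<noteq> {}"
proof -
  let ?C = "{c. \<bar>M $ c $ c\<bar> = r}"
  have tr: "transpose M $ r $ c = 0" if "r \<noteq> c" for r c using diag that by (simp add: transpose_def)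
  have ev: "((transpose M ** M) *v x) $ c = (M $ c $ c)\<^sup>2 * x $ c" for x c
  proof -
    have "((transpose M ** M) *v x) $ c = (transpose M *v (M *v x)) $ c"
      by (simp only: matrix_vector_mul_assoc)
    also have "\<dots> = transpose M $ c $ c * (M *v x) $ c"
      by (rule diagonal_matrix_vector_mult[OF tr])
    also have "(M *v x) $ c = M $ c $ c * x $ c"
      by (rule diagonal_matrix_vector_mult[OF diag])
    finally have "((transpose M ** M) *v x) $ c = transpose M $ c $ c * (M $ c $ c * x $ c)" .
    also have "transpose M $ c $ c = M $ c $ c" by (simp add: transpose_def)
    finally show ?thesis by (simp add: power2_eq_square)
  qed
  have E: "{x. (transpose M ** M) *v x = r\<^sup>2 *\<^sub>R x} = {x. \<forall>c. c \<notin> ?C \<longrightarrow> x $ c = 0}"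
  proof (intro set_eqI iffI)
    fix x assume "x \<in> {x. (transpose M ** M) *v x = r\<^sup>2 *\<^sub>R x}"
    then have eq: "(transpose M ** M) *v x = r\<^sup>2 *\<^sub>R x" by simp
    have "x $ c = 0" if "c \<notin> ?C" for c
    proof -
      have "(M $ c $ c)\<^sup>2 * x $ c = ((transpose M ** M) *v x) $ c" by (rule ev[symmetric])
      also have "\<dots> = r\<^sup>2 * x $ c" unfolding eq by simp
      finally have "x $ c = 0 \<or> (M $ c $ c)\<^sup>2 = r\<^sup>2" unfolding mult_cancel_right by blast
      moreover have "\<bar>M $ c $ c\<bar>\<^sup>2 \<noteq> r\<^sup>2"
        using power2_eq_iff_nonneg[OF abs_ge_zero r, of "M $ c $ c"] that by blast
      ultimately show ?thesis unfolding power2_abs by blast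
    qed
    then show "x \<in> {x. \<forall>c. c \<notin> ?C \<longrightarrow> x $ c = 0}" by simp
  next
    fix x :: "real^'d" assume x: "x \<in> {x. \<forall>c. c \<notin> ?C \<longrightarrow> x $ c = 0}"
    have "(M $ c $ c)\<^sup>2 * x $ c = r\<^sup>2 * x $ c" for c
    proof (cases "c \<in> ?C")
      case True
      then have "\<bar>M $ c $ c\<bar> = r" by simp
      then have "\<bar>M $ c $ c\<bar>\<^sup>2 = r\<^sup>2" by (rule arg_cong)
      then show ?thesis by (simp only: power2_abs)
    qed (use x in simp)
    then show "x \<in> {x. (transpose M ** M) *v x = r\<^sup>2 *\<^sub>R x}" by (simp add: vec_eq_iff ev)
  qed
  have "{x :: real^'d. \<forall>c. c \<notin> ?C \<longrightarrow> x $ c = 0} = {x. \<forall>i\<in>Basis. i \<notin> (\<lambda>c. axis c 1) ` ?C \<longrightarrow> x \<bullet> i = 0}"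
    by (auto simp: Basis_vec_def inner_axis axis_eq_axis image_iff)
  moreover have "dim {x :: real^'d. \<forall>i\<in>Basis. i \<notin> (\<lambda>c. axis c 1) ` ?C \<longrightarrow> x \<bullet> i = 0} = card ((\<lambda>c. axis c 1 :: real^'d) ` ?C)"
    by (rule dim_substandard) (auto simp: Basis_vec_def)
  moreover have "card ((\<lambda>c. axis c 1 :: real^'d) ` ?C) = card ?C"
    by (rule card_image) (auto simp: inj_on_def axis_eq_axis)
  ultimately show "dim {x. (transpose M ** M) *v x = r\<^sup>2 *\<^sub>R x} = card ?C" unfolding E by simp
  show "{x. (transpose M ** M) *v x = r\<^sup>2 *\<^sub>R x} \<noteq> {0} \<longleftrightarrow> ?C \<noteq> {}"
  proof
    assume "?C \<noteq> {}"
    then obtain c where c: "c \<in> ?C" by blast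
    have "axis c 1 \<in> {x :: real^'d. \<forall>c. c \<notin> ?C \<longrightarrow> x $ c = 0}" using c by (auto simp: axis_def)
    then show "{x. (transpose M ** M) *v x = r\<^sup>2 *\<^sub>R x} \<noteq> {0}" unfolding E
      by (metis axis_eq_0_iff singletonD zero_neq_one)
  next
    assume ne: "{x. (transpose M ** M) *v x = r\<^sup>2 *\<^sub>R x} \<noteq> {0}"
    show "?C \<noteq> {}"
    proof
      assume "?C = {}"
      then have "{x :: real^'d. \<forall>c. c \<notin> ?C \<longrightarrow> x $ c = 0} = {0}" by (auto simp: vec_eq_iff)
      then show False using ne unfolding E by blast
    qed
  qed
qed

lemma singular_values_diagonal:
  fixes M :: "real^'d::finite^'d"
  assumes diag: "\<And>r c. r \<noteq> c \<Longrightarrow> M $ r $ c = 0" and D: "D \<in> orderings"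
    and srt: "\<And>i j. i \<le> j \<Longrightarrow> j < length D \<Longrightarrow> \<bar>M $ (D ! j) $ (D ! j)\<bar> \<le> \<bar>M $ (D ! i) $ (D ! i)\<bar>"
  shows "singular_values M = map (\<lambda>c. \<bar>M $ c $ c\<bar>) D"
proof -
  let ?f = "\<lambda>c. \<bar>M $ c $ c\<bar>"
  let ?E = "\<lambda>r. {x. (transpose M ** M) *v x = r\<^sup>2 *\<^sub>R x}"
  let ?R = "{r. 0 \<le> r \<and> ?E r \<noteq> {0}}"
  have R: "?R = range ?f"
  proof (rule set_eqI)
    fix r
    have "?E r \<noteq> {0} \<longleftrightarrow> {c. ?f c = r} \<noteq> {}" if "0 \<le> r"
      by (rule dim_diagonal_eigenspace(2)[OF diag that])
    then have "r \<in> ?R \<longleftrightarrow> 0 \<le> r \<and> {c. ?f c = r} \<noteq> {}" by (simp only: mem_Collect_eq cong: conj_cong)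
    also have "\<dots> \<longleftrightarrow> r \<in> range ?f" by auto
    finally show "r \<in> ?R \<longleftrightarrow> r \<in> range ?f" .
  qed
  have "(\<Sum>r\<in>?R. replicate_mset (dim (?E r)) r) = mset (map ?f D)"
  proof (rule multiset_eqI)
    fix r0
    have "count (\<Sum>r\<in>?R. replicate_mset (dim (?E r)) r) r0 = (\<Sum>r\<in>range ?f. if r = r0 then dim (?E r) else 0)"
      unfolding R count_sum by (intro sum.cong refl) auto
    also have "\<dots> = (if r0 \<in> range ?f then dim (?E r0) else 0)" by (subst sum.delta) auto
    also have "\<dots> = card {c. ?f c = r0}"
      using dim_diagonal_eigenspace(1)[OF diag, of r0] by (auto simp: card_eq_0_iff)
    also have "\<dots> = count (mset (map ?f D)) r0"
    proof -
      have "mset D = mset_set UNIV" using orderings_props[OF D] by (metis mset_set_set)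
      then have "count (mset (map ?f D)) r0 = sum (count (mset_set UNIV)) (?f -` {r0} \<inter> UNIV)"
        by (simp add: count_image_mset)
      also have "\<dots> = card (?f -` {r0})" by simp
      also have "?f -` {r0} = {c. ?f c = r0}" by auto
      finally show ?thesis ..
    qed
    finally show "count (\<Sum>r\<in>?R. replicate_mset (dim (?E r)) r) r0 = count (mset (map ?f D)) r0" .
  qed
  then have "singular_values M = rev (sorted_list_of_multiset (mset (map ?f D)))"
    by (simp add: singular_values_def Let_def)
  also have "mset (map ?f D) = mset (rev (map ?f D))" by simp
  also have "sorted_list_of_multiset \<dots> = sort (rev (map ?f D))" by (rule sorted_list_of_multiset_mset)
  also have "\<dots> = rev (map ?f D)"
  proof (rule sorted_sort_id)
    show "sorted (rev (map ?f D))"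
      unfolding sorted_rev_iff_nth_mono using srt by auto
  qed
  finally show ?thesis by simp
qed

text \<open>The decreasing ordering lists the singular values and realises the singular value
  function; the duality bound shows that no other ordering exceeds it.\<close>

lemma sv_function_diagonal:
  fixes M :: "real^'d::finite^'d"
  assumes diag: "\<And>r c. r \<noteq> c \<Longrightarrow> M $ r $ c = 0" and nz: "\<And>c. M $ c $ c \<noteq> 0" and s: "0 \<le> s" "s \<le> real CARD('d)"
  shows "\<exists>D\<in>orderings. sv_function s M = phi D s (\<lambda>c. M $ c $ c)"
    "D \<in> orderings \<Longrightarrow> phi D s (\<lambda>c. M $ c $ c) \<le> sv_function s M"
proof -
  let ?b = "\<lambda>c. M $ c $ c"
  obtain D' where D': "D' \<in> orderings" and srt: "\<And>i j. i \<le> j \<Longrightarrow> j < length D' \<Longrightarrow> \<bar>?b (D' ! j)\<bar> \<le> \<bar>?b (D' ! i)\<bar>"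
    using exists_sorted_ordering[of "\<lambda>c. \<bar>?b c\<bar>"] by blast
  have len: "length D' = CARD('d)" using orderings_props[OF D'] by simp
  have sv: "singular_value M i = \<bar>?b (D' ! (i - 1))\<bar>" if "1 \<le> i" "i \<le> CARD('d)" for i
    using that len by (simp add: singular_value_def singular_values_diagonal[OF diag D' srt])
  have "sv_function s M = D_function D' s M"
  proof -
    have "(\<Prod>i = 1..nat \<lfloor>s\<rfloor>. singular_value M i) = (\<Prod>i = 1..nat \<lfloor>s\<rfloor>. \<bar>?b (D' ! (i - 1))\<bar>)"
    proof (rule prod.cong[OF refl])
      fix i assume "i \<in> {1..nat \<lfloor>s\<rfloor>}"
      then have "1 \<le> i" "i \<le> CARD('d)" using s by (auto, linarith)
      then show "singular_value M i = \<bar>?b (D' ! (i - 1))\<bar>" by (rule sv)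
    qed
    \<comment> \<open>For nonintegral \<open>s\<close>, position \<lceil>s\<rceil> counted from 1 is
      index \<lfloor>s\<rfloor> counted from 0.\<close>
    moreover have "singular_value M (nat \<lceil>s\<rceil>) = \<bar>?b (D' ! nat \<lfloor>s\<rfloor>)\<bar>" if "s \<notin> \<int>"
    proof -
      have c: "\<lceil>s\<rceil> = \<lfloor>s\<rfloor> + 1" using that by (simp add: ceiling_altdef) (metis Ints_of_int)
      have "s \<noteq> real CARD('d)" using that by auto
      then have "nat \<lceil>s\<rceil> \<le> CARD('d)" using s by linarith
      moreover have "nat \<lceil>s\<rceil> = Suc (nat \<lfloor>s\<rfloor>)" using c s(1) zero_le_floor[of s] by linarith
      ultimately show ?thesis using sv[of "nat \<lceil>s\<rceil>"] by simp
    qed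
    ultimately show ?thesis by (simp add: sv_function_def D_function_def Let_def)
  qed
  then have eq: "sv_function s M = phi D' s ?b" using D_function_eq_phi[OF D' s nz] by simp
  then show "\<exists>D\<in>orderings. sv_function s M = phi D s ?b" using D' by blast
  show "phi D s ?b \<le> sv_function s M" if D: "D \<in> orderings"
  proof -
    obtain c where c: "phi D' s ?b = \<bar>?b c\<bar> powr s * (\<Prod>e\<in>UNIV. max 1 (\<bar>?b e\<bar> / \<bar>?b c\<bar>))"
      using phi_sorted_eq[where b = ?b, OF D' srt s nz] by blast
    show ?thesis unfolding eq c by (rule phi_le_dual[OF D _ s nz]) (use nz in simp)
  qed
qed

text \<open>The two minima may be attained at different indices and the indices may change with
  \<open>q\<close>. Each minimum is compared with the other family at its own minimiser, with ratios
  uniformly close to 1 over the finite index set.\<close>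

lemma Min_ratio_tendsto:
  fixes x y :: "'a \<Rightarrow> nat \<Rightarrow> real"
  assumes P: "finite P" "P \<noteq> {}" and y: "\<And>D q. D \<in> P \<Longrightarrow> 0 < y D q"
    and lim: "\<And>D. D \<in> P \<Longrightarrow> (\<lambda>q. x D q / y D q) \<longlonglongrightarrow> 1"
  shows "(\<lambda>q. Min ((\<lambda>D. x D q) ` P) / Min ((\<lambda>D. y D q) ` P)) \<longlonglongrightarrow> 1"
proof (rule LIMSEQ_I)
  fix r :: real assume r: "0 < r"
  define e where "e = min r 1 / 2"
  have e: "0 < e" "e < r" "e < 1" using r by (auto simp: e_def)
  have "\<forall>\<^sub>F q in sequentially. \<forall>D\<in>P. 1 - e < x D q / y D q \<and> x D q / y D q < 1 + e"
    using P(1) lim e by (intro eventually_ball_finite ballI eventually_conj order_tendstoD) auto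
  then obtain N where N: "\<And>q D. N \<le> q \<Longrightarrow> D \<in> P \<Longrightarrow> 1 - e < x D q / y D q \<and> x D q / y D q < 1 + e"
    by (auto simp: eventually_sequentially)
  have "norm (Min ((\<lambda>D. x D q) ` P) / Min ((\<lambda>D. y D q) ` P) - 1) < r" if q: "N \<le> q" for q
  proof -
    let ?X = "Min ((\<lambda>D. x D q) ` P)" and ?Y = "Min ((\<lambda>D. y D q) ` P)"
    have "?X \<in> (\<lambda>D. x D q) ` P" "?Y \<in> (\<lambda>D. y D q) ` P" using P by (auto intro!: Min_in)
    then obtain D1 D2 where D1: "D1 \<in> P" "?X = x D1 q" and D2: "D2 \<in> P" "?Y = y D2 q" by blast
    have le: "?X \<le> x D2 q" "?Y \<le> y D1 q"
      by (rule Min_le[OF finite_imageI[OF P(1)] imageI[OF D2(1)]], rule Min_le[OF finite_imageI[OF P(1)] imageI[OF D1(1)]])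
    have Y: "0 < ?Y" using y D2 by simp
    have "x D2 q \<le> (1 + e) * y D2 q" using N[OF q D2(1)] y[OF D2(1), of q] by (simp add: pos_divide_less_eq)
    then have u: "?X / ?Y \<le> 1 + e" using le D2 Y by (simp add: pos_divide_le_eq)
    have "(1 - e) * ?Y \<le> (1 - e) * y D1 q" using le e by (intro mult_left_mono) auto
    also have "\<dots> \<le> x D1 q" using N[OF q D1(1)] y[OF D1(1), of q] by (simp add: pos_less_divide_eq)
    finally have "1 - e \<le> ?X / ?Y" using D1 Y by (simp add: pos_le_divide_eq)
    with u e show ?thesis by (simp add: abs_less_iff)
  qed
  then show "\<exists>no. \<forall>q\<ge>no. norm (Min ((\<lambda>D. x D q) ` P) / Min ((\<lambda>D. y D q) ` P) - 1) < r" by blast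
qed

text \<open>Restricts the maximum over all orderings to the critical ones, once these dominate, and
  turns it into a minimum of gaps.\<close>

lemma diff_Max_eq_Min_diff:
  fixes f :: "'a \<Rightarrow> real"
  assumes S: "finite S" and P: "P \<subseteq> S" "P \<noteq> {}"
    and dom: "\<And>D D0. D \<in> S - P \<Longrightarrow> D0 \<in> P \<Longrightarrow> f D \<le> f D0"
  shows "s - Max (f ` S) = Min ((\<lambda>D. s - f D) ` P)"
proof -
  have fP: "finite P" using S P finite_subset by blast
  have ne: "S \<noteq> {}" using P by blast
  obtain D where D: "D \<in> P" "Max (f ` P) = f D"
    using Max_in[of "f ` P"] fP P by (metis (no_types, lifting) finite_imageI image_iff image_is_empty)
  have le: "f D' \<le> f D" if "D' \<in> S" for D'
  proof (cases "D' \<in> P")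
    case True
    then have "f D' \<le> Max (f ` P)" using fP by (intro Max_ge) auto
    then show ?thesis by (simp only: D(2))
  next
    case False
    then show ?thesis using dom that D(1) by blast
  qed
  have "Max (f ` S) = f D" using S D P le by (intro Max_eqI) auto
  moreover have "Min ((\<lambda>D. s - f D) ` P) = s - f D" using fP D P le by (intro Min_eqI) auto
  ultimately show ?thesis by simp
qed

section \<open>Transfer to the matrix notions\<close>

locale diagonal_matrix_ifs =
  fixes A :: "'k::finite \<Rightarrow> real^'d::finite^'d"
  assumes inv: "\<And>i. invertible (A i)"
    and norm_less: "\<And>i. onorm (\<lambda>x. A i *v x) < 1 / 2"
    and diag: "\<And>i r c. r \<noteq> c \<Longrightarrow> A i $ r $ c = 0"
begin

lemma entry_nonzero: "A i $ c $ c \<noteq> 0"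
proof -
  have "det (A i) = (\<Prod>c\<in>UNIV. A i $ c $ c)" using diag by (rule det_diagonal)
  moreover have "det (A i) \<noteq> 0" using inv invertible_det_nz by blast
  ultimately show ?thesis by auto
qed

lemma entry_le_onorm: "\<bar>A i $ c $ c\<bar> \<le> onorm (\<lambda>x. A i *v x)"
proof -
  have "\<bar>A i $ c $ c\<bar> = \<bar>(A i *v axis c 1) $ c\<bar>"
    using diagonal_matrix_vector_mult[of "A i"] diag by simp
  also have "\<dots> \<le> norm (A i *v axis c 1)" by (rule component_le_norm_cart)
  also have "\<dots> \<le> onorm (\<lambda>x. A i *v x) * norm (axis c 1 :: real^'d)"
    by (rule onorm) (rule matrix_vector_mul_bounded_linear)
  finally show ?thesis by simp
qed

text \<open>The common bound is the largest operator norm; over a finite alphabet it is still below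
  1/2.\<close>

sublocale diagonal_ifs "\<lambda>i c. A i $ c $ c" "Max (range (\<lambda>i. onorm (\<lambda>x. A i *v x)))"
proof
  show "A i $ c $ c \<noteq> 0" for i c by (rule entry_nonzero)
  show "\<bar>A i $ c $ c\<bar> \<le> Max (range (\<lambda>i. onorm (\<lambda>x. A i *v x)))" for i c
    by (rule order_trans[OF entry_le_onorm Max_ge]) auto
  show "Max (range (\<lambda>i. onorm (\<lambda>x. A i *v x))) < 1 / 2"
    by (subst Max_less_iff) (use norm_less in auto)
qed

lemma word_entry: "word_matrix A w $ r $ c = (if r = c then cf c w else 0)"
  by (rule diagonal_word_matrix) (rule diag)

lemma projection_eq: "projection A v x = proj v x"
proof -
  have "(\<lambda>m. word_matrix A (stake m x) *v (v $ (x !! m))) sums proj v x"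
    unfolding sums_def
  proof (rule vec_tendstoI)
    fix c
    have "(word_matrix A (stake m x) *v (v $ (x !! m))) $ c = cf c (stake m x) * v $ (x !! m) $ c" for m
      by (subst diagonal_matrix_vector_mult) (simp_all add: word_entry)
    then show "(\<lambda>n. (\<Sum>m<n. word_matrix A (stake m x) *v (v $ (x !! m))) $ c) \<longlonglongrightarrow> proj v x $ c"
      using coord_sums[of c x "\<lambda>i. v $ i $ c"] by (simp add: sums_def proj_def)
  qed
  then show ?thesis unfolding projection_def by (rule sums_unique[symmetric])
qed

lemma self_affine_set_eq: "self_affine_set A v = range (proj v)"
proof -
  have m: "(\<lambda>x. A i *v x + v $ i) = compose_maps v [i]" for i
    by (rule ext) (simp add: vec_eq_iff diagonal_matrix_vector_mult diag)
  obtain L where L: "compact L" "L \<noteq> {}" "L = (\<Union>i. compose_maps v [i] ` L)"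
    by (rule invariant_set_exists)
  show ?thesis
    unfolding self_affine_set_def m
  proof (rule the_equality)
    have eq: "L = range (proj v)" by (rule invariant_set_unique[OF L])
    show "compact (range (proj v)) \<and> range (proj v) \<noteq> {} \<and>
        range (proj v) = (\<Union>i. compose_maps v [i] ` range (proj v))"
      using L unfolding eq by blast
    show "L' = range (proj v)"
      if "compact L' \<and> L' \<noteq> {} \<and> L' = (\<Union>i. compose_maps v [i] ` L')" for L'
      by (rule invariant_set_unique) (use that in blast)+
  qed
qed

lemma survivor_set_eq: "survivor_set A v qs q = proj v ` {x. \<forall>n. stake n x \<in> avoiding (stake q qs)}"
  unfolding survivor_set_def survivors_eq by (simp add: projection_eq cong: image_cong)

lemma D_function_word:
  assumes "D \<in> orderings" "0 \<le> s" "s \<le> real CARD('d)"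
  shows "D_function D s (word_matrix A w) = wt (pw D s) w"
proof -
  have "D_function D s (word_matrix A w) = phi D s (\<lambda>c. word_matrix A w $ c $ c)"
    by (rule D_function_eq_phi[OF assms]) (simp add: word_entry cf_nz)
  also have "\<dots> = phi D s (\<lambda>c. cf c w)" by (simp add: word_entry)
  also have "\<dots> = wt (pw D s) w" by (rule phi_wt)
  finally show ?thesis .
qed

lemma D_function_letter:
  assumes "D \<in> orderings" "0 \<le> s" "s \<le> real CARD('d)"
  shows "D_function D s (A i) = pw D s i"
  using D_function_eq_phi[OF assms entry_nonzero] .

lemma words_eq_level: "words n = level UNIV n"
  by (simp add: words_def level_def)

lemma D_pressure_eq:
  assumes "D \<in> orderings" "0 \<le> s" "s \<le> real CARD('d)"
  shows "D_pressure A D s = ln (Q D s)"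
proof -
  have "D_pressure A D s = growth (pw D s) UNIV"
    by (simp add: D_pressure_def growth_def level_sum_def words_eq_level D_function_word[OF assms])
  then show ?thesis using growth_UNIV[of "pw D s"] pw_pos by (simp add: Q_def)
qed

lemma reduced_D_pressure_eq:
  assumes "D \<in> orderings" "0 \<le> s" "s \<le> real CARD('d)" and k: "2 \<le> CARD('k)" and q: "1 \<le> q"
  shows "reduced_D_pressure A D qs q s = growth (pw D s) (avoiding (stake q qs))"
proof -
  have "stake q qs \<noteq> []" using q by (cases q) auto
  then show ?thesis
    by (simp add: reduced_D_pressure_def growth_def level_sum_def survivor_words_def
        stake_survivors[OF k] D_function_word[OF assms(1-3)])
qed

text \<open>The partition sum lies between M^n and d! M^n, where M is the largest one-letter sum
  over all orderings; the factorial is lost in the limit.\<close>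

lemma pressure_eq:
  assumes s: "0 \<le> s" "s \<le> real CARD('d)"
  shows "pressure A s = ln (Max ((\<lambda>D. Q D s) ` orderings))"
proof -
  define M where "M = Max ((\<lambda>D. Q D s) ` orderings)"
  define S where "S n = (\<Sum>w\<in>words n. sv_function s (word_matrix A w))" for n
  have ne: "(orderings :: 'd list set) \<noteq> {}" by simp
  have "M \<in> (\<lambda>D. Q D s) ` orderings" unfolding M_def by (intro Max_in) auto
  then obtain D where D: "D \<in> orderings" "M = Q D s" by blast
  have M: "0 < M" using Q_pos[of D s] D(2) by simp
  have Qle: "Q D' s \<le> M" if "D' \<in> orderings" for D' using that unfolding M_def by (intro Max_ge) auto
  define N where "N = real (card (orderings :: 'd list set))"
  have N: "0 < N" by (simp add: N_def card_gt_0_iff)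
  have wd: "word_matrix A w $ r $ c = 0" if "r \<noteq> c" for w r c using that by (simp add: word_entry)
  have wn: "word_matrix A w $ c $ c \<noteq> 0" for w c using cf_nz by (simp add: word_entry)
  have we: "phi D' s (\<lambda>c. word_matrix A w $ c $ c) = wt (pw D' s) w" for D' w
    by (simp add: word_entry phi_wt)
  have lo: "M ^ n \<le> S n" for n
  proof -
    have "M ^ n = Q D s ^ n" by (simp only: D(2))
    also have "\<dots> = level_sum (pw D s) UNIV n" by (simp only: Q_def level_sum_UNIV)
    also have "\<dots> = (\<Sum>w\<in>words n. wt (pw D s) w)" by (simp only: level_sum_def words_eq_level)
    also have "\<dots> \<le> S n"
      unfolding S_def using sv_function_diagonal(2)[OF wd wn s D(1)] we by (intro sum_mono) simp
    finally show ?thesis .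
  qed
  have hi: "S n \<le> N * M ^ n" for n
  proof -
    have "S n \<le> (\<Sum>w\<in>words n. \<Sum>D'\<in>orderings. wt (pw D' s) w)"
      unfolding S_def
    proof (rule sum_mono)
      fix w :: "'k list"
      obtain D' where D': "D' \<in> orderings" "sv_function s (word_matrix A w) = wt (pw D' s) w"
        using sv_function_diagonal(1)[OF wd wn s, of w] we by auto
      have "wt (pw D' s) w \<le> (\<Sum>D'\<in>orderings. wt (pw D' s) w)"
        using D' by (intro member_le_sum) (auto intro: wt_nonneg less_imp_le[OF pw_pos])
      then show "sv_function s (word_matrix A w) \<le> (\<Sum>D'\<in>orderings. wt (pw D' s) w)" using D' by simp
    qed
    also have "\<dots> = (\<Sum>D'\<in>orderings. level_sum (pw D' s) UNIV n)"
      by (subst sum.swap) (simp add: level_sum_def words_eq_level)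
    also have "\<dots> = (\<Sum>D'\<in>orderings. Q D' s ^ n)"
      by (simp add: level_sum_UNIV Q_def)
    also have "\<dots> \<le> (\<Sum>D'\<in>(orderings :: 'd list set). M ^ n)"
      using Qle by (intro sum_mono power_mono) (auto intro: less_imp_le[OF Q_pos])
    finally show ?thesis by (simp add: N_def)
  qed
  have "(\<lambda>n. 1 / real n * ln (S n)) \<longlonglongrightarrow> ln M"
  proof (rule tendsto_sandwich[where f = "\<lambda>n. ln M" and h = "\<lambda>n. ln N / real n + ln M"])
    show "\<forall>\<^sub>F n in sequentially. ln M \<le> 1 / real n * ln (S n)"
      using eventually_gt_at_top[of 0]
    proof eventually_elim
      case (elim n)
      have "ln (M ^ n) \<le> ln (S n)" using lo[of n] M by (intro ln_mono) auto
      then have "real n * ln M \<le> ln (S n)" using M by (simp add: ln_realpow)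
      then show ?case using elim by (simp add: field_simps)
    qed
    show "\<forall>\<^sub>F n in sequentially. 1 / real n * ln (S n) \<le> ln N / real n + ln M"
      using eventually_gt_at_top[of 0]
    proof eventually_elim
      case (elim n)
      have "0 < S n" using lo[of n] M by (meson less_le_trans zero_less_power)
      then have "ln (S n) \<le> ln (N * M ^ n)" using hi[of n] by (intro ln_mono)
      also have "\<dots> = ln N + real n * ln M" using N M by (simp add: ln_mult ln_realpow)
      finally show ?case using elim by (simp add: field_simps)
    qed
    have "(\<lambda>n. ln N / real n + ln M) \<longlonglongrightarrow> 0 + ln M"
      by (intro tendsto_add lim_const_over_n tendsto_const)
    then show "(\<lambda>n. ln N / real n + ln M) \<longlonglongrightarrow> ln M" by simp
  qed simp
  then show ?thesis unfolding pressure_def S_def[symmetric] M_def[symmetric] by (rule limI)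
qed

lemma bernoulli_measure_cylinder:
  assumes D: "D \<in> orderings" and s: "0 \<le> s" "s \<le> real CARD('d)" and Q1: "Q D s = 1"
  shows "measure (bernoulli_measure A s D) (cylinder w) = wt (pw D s) w"
proof -
  let ?p = "\<lambda>i. ennreal (D_function D s (A i))"
  let ?M = "point_measure UNIV ?p"
  have pw: "D_function D s (A i) = pw D s i" for i by (rule D_function_letter[OF D s])
  have "emeasure ?M (space ?M) = ennreal (\<Sum>i\<in>UNIV. pw D s i)"
    by (simp add: space_point_measure emeasure_point_measure_finite pw sum_ennreal less_imp_le[OF pw_pos])
  then have "prob_space ?M" using Q1 by (intro prob_spaceI) (simp add: Q_def)
  then interpret prob_space ?M .
  have sets: "sets (stream_space ?M) = sets (stream_space (count_space UNIV))"
    by (rule sets_stream_space_cong) (simp add: sets_point_measure)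
  have sp: "space (stream_space ?M) = UNIV" by (simp add: space_stream_space space_point_measure)
  have "emeasure (stream_space ?M) (cylinder w) = ennreal (wt (pw D s) w)"
  proof (induction w)
    case Nil
    have "cylinder [] = space (stream_space ?M)" by (simp add: cylinder_def sp)
    then show ?case by (simp add: prob_space.emeasure_space_1[OF prob_space_stream_space])
  next
    case (Cons i w)
    have "emeasure (stream_space ?M) (cylinder (i # w)) =
        (\<integral>\<^sup>+ t. emeasure (stream_space ?M) {x \<in> space (stream_space ?M). t ## x \<in> cylinder (i # w)} \<partial>?M)"
      by (rule emeasure_stream_space) (simp add: sets cylinder_sets)
    also have "\<dots> = (\<integral>\<^sup>+ t. (if t = i then ennreal (wt (pw D s) w) else 0) \<partial>?M)"
    proof (rule nn_integral_cong)
      fix t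
      have "{x \<in> space (stream_space ?M). t ## x \<in> cylinder (i # w)} = (if t = i then cylinder w else {})"
        by (auto simp: sp cylinder_def)
      then show "emeasure (stream_space ?M) {x \<in> space (stream_space ?M). t ## x \<in> cylinder (i # w)} =
          (if t = i then ennreal (wt (pw D s) w) else 0)" using Cons by simp
    qed
    also have "\<dots> = (\<Sum>t\<in>UNIV. ?p t * (if t = i then ennreal (wt (pw D s) w) else 0))"
      by (rule nn_integral_point_measure_finite) simp
    also have "\<dots> = (\<Sum>t\<in>UNIV. if t = i then ?p i * ennreal (wt (pw D s) w) else 0)"
      by (intro sum.cong) auto
    also have "\<dots> = ?p i * ennreal (wt (pw D s) w)" by simp
    also have "\<dots> = ennreal (wt (pw D s) (i # w))"
      by (simp add: pw ennreal_mult' less_imp_le[OF pw_pos])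
    finally show ?case .
  qed
  then show ?thesis
    by (simp add: bernoulli_measure_def measure_def wt_nonneg less_imp_le[OF pw_pos])
qed

lemma Z_const_eq:
  assumes D: "D \<in> orderings" and s0: "0 < s0" "s0 \<le> real CARD('d)" and Q1: "Q D s0 = 1"
  shows "Z_const A s0 D = 1 / slope D s0"
proof -
  have "((\<lambda>h. 1 / h * (D_pressure A D s0 - D_pressure A D (s0 - h))) \<longlongrightarrow> - slope D s0) (at_right 0)"
  proof (rule Lim_transform_eventually[OF ln_Q_slope[OF D s0 Q1]])
    have "\<forall>\<^sub>F h in at_right 0. h \<in> {0<..<s0}"
      by (rule eventually_at_right_real) (use s0 in simp)
    then show "\<forall>\<^sub>F h in at_right 0. 1 / h * (ln (Q D s0) - ln (Q D (s0 - h))) =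
        1 / h * (D_pressure A D s0 - D_pressure A D (s0 - h))"
      by eventually_elim (use s0 in \<open>simp add: D_pressure_eq[OF D]\<close>)
  qed
  then have "Lim (at_right 0) (\<lambda>h. 1 / h * (D_pressure A D s0 - D_pressure A D (s0 - h))) = - slope D s0"
    by (intro tendsto_Lim) auto
  then show ?thesis by (simp add: Z_const_def divide_inverse)
qed

context
  fixes s0 :: real and qs :: "'k stream"
  assumes k: "2 \<le> CARD('k)" and s0: "0 \<le> s0" "s0 \<le> real CARD('d)" and P0: "pressure A s0 = 0"
begin

lemma Q_le_1: "D \<in> orderings \<Longrightarrow> Q D s0 \<le> 1"
  and exists_critical: "\<exists>D\<in>orderings. Q D s0 = 1"
proof -
  let ?M = "Max ((\<lambda>D. Q D s0) ` orderings)"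
  have "?M \<in> (\<lambda>D. Q D s0) ` orderings" by (intro Max_in) auto
  then obtain D where D: "D \<in> orderings" "?M = Q D s0" by blast
  then have "0 < ?M" using Q_pos by simp
  moreover have "ln ?M = 0" using P0 pressure_eq[OF s0] by simp
  ultimately have M: "?M = 1" by simp
  then show "\<exists>D\<in>orderings. Q D s0 = 1" using D by auto
  show "Q D s0 \<le> 1" if "D \<in> orderings" for D
    using that unfolding M[symmetric] by (intro Max_ge) auto
qed

text \<open>At exponent 0 each of the at least two letters has weight 1, so the pressure would be
  positive.\<close>

lemma s0_pos: "0 < s0"
proof (rule ccontr)
  assume "\<not> 0 < s0"
  then have "s0 = 0" using s0 by simp
  moreover have "Q D 0 = real CARD('k)" for D
    by (simp add: Q_def phi_def cap_def entry_nonzero)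
  ultimately show False using exists_critical k by auto
qed

text \<open>The hole only removes words, so the growth at \<open>T\<close> is at most
  \<open>ln (Q D T)\<close>, and the reduced zero lies at or below \<open>T\<close> as soon as this
  is not positive. The last claim bounds the zero by that of the full D-pressure, uniformly in
  \<open>q\<close>.\<close>

lemma reduced_zero:
  assumes D: "D \<in> orderings" and q: "1 \<le> q"
  defines "t \<equiv> reduced_D_zero A D qs q"
  shows "0 \<le> t" "t \<le> s0" "growth (pw D t) (avoiding (stake q qs)) = 0"
    "\<And>T. 0 \<le> T \<Longrightarrow> T \<le> s0 \<Longrightarrow> Q D T = 1 \<Longrightarrow> t \<le> T"
proof -
  have w: "stake q qs \<noteq> []" using q by (cases q) auto
  note V = factorial_language_avoiding[OF w] level_avoiding_nonempty[OF k w]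
  have ex: "\<exists>r. 0 \<le> r \<and> r \<le> T \<and> growth (pw D r) (avoiding (stake q qs)) = 0"
    if T: "0 \<le> T" "T \<le> s0" "Q D T \<le> 1" for T
  proof -
    have "growth (pw D T) (avoiding (stake q qs)) \<le> growth (pw D T) UNIV + ln 1"
    proof (rule growth_le_of_psum_le[OF V factorial_language_UNIV level_UNIV_nonempty pw_pos pw_pos])
      show "level_sum (pw D T) (avoiding (stake q qs)) n \<le> level_sum (pw D T) UNIV n * 1 ^ n" for n
        unfolding level_sum_def power_one mult_1_right
        by (intro sum_mono2) (auto simp: level_def intro: finite_words_length wt_nonneg less_imp_le[OF pw_pos])
    qed simp
    also have "\<dots> = ln (Q D T)" using growth_UNIV[of "pw D T"] pw_pos by (simp add: Q_def)
    also have "\<dots> \<le> 0" using T(3) Q_pos[of D T] by simp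
    finally have "growth (pw D T) (avoiding (stake q qs)) \<le> 0" .
    with order_trans[OF T(2) s0(2)] show ?thesis
      using pressure_zero[OF V D T(1)] by blast
  qed
  have uniq: "reduced_D_zero A D qs q = r"
    if r: "0 \<le> r" "r \<le> real CARD('d)" "growth (pw D r) (avoiding (stake q qs)) = 0" for r
    unfolding reduced_D_zero_def
  proof (rule the_equality)
    show "0 \<le> r \<and> r \<le> real CARD('d) \<and> reduced_D_pressure A D qs q r = 0"
      using r reduced_D_pressure_eq[OF D r(1,2) k q] by simp
    show "x = r" if "0 \<le> x \<and> x \<le> real CARD('d) \<and> reduced_D_pressure A D qs q x = 0" for x
    proof -
      have x: "0 \<le> x" "x \<le> real CARD('d)" "reduced_D_pressure A D qs q x = 0" using that by auto
      then have "growth (pw D x) (avoiding (stake q qs)) = 0"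
        using reduced_D_pressure_eq[OF D x(1,2) k q] by simp
      then show ?thesis by (rule pressure_zero_unique[OF V D x(1,2) _ r])
    qed
  qed
  obtain r where r: "0 \<le> r" "r \<le> s0" "growth (pw D r) (avoiding (stake q qs)) = 0"
    using ex[OF s0(1) order_refl Q_le_1[OF D]] by blast
  then have "t = r" unfolding t_def using s0 by (intro uniq) auto
  then show "0 \<le> t" "t \<le> s0" "growth (pw D t) (avoiding (stake q qs)) = 0" using r by auto
  show "t \<le> T" if T: "0 \<le> T" "T \<le> s0" "Q D T = 1" for T
  proof -
    obtain r where r: "0 \<le> r" "r \<le> T" "growth (pw D r) (avoiding (stake q qs)) = 0"
      using ex[of T] T by auto
    then have "t = r" unfolding t_def using s0 T by (intro uniq) auto
    then show ?thesis using r by simp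
  qed
qed

lemma AE_dim_survivor_set:
  assumes q: "1 \<le> q"
  shows "AE v in (lborel :: (real^'d^'k) measure).
    hausdorff_dim (survivor_set A v qs q) = Max ((\<lambda>D. reduced_D_zero A D qs q) ` orderings)"
proof -
  let ?t = "\<lambda>D. reduced_D_zero A D qs q"
  let ?T = "Max (?t ` orderings)"
  have w: "stake q qs \<noteq> []" using q by (cases q) auto
  note V = factorial_language_avoiding[OF w] level_avoiding_nonempty[OF k w]
  have "?T \<in> ?t ` orderings" by (intro Max_in) auto
  then obtain D0 where D0: "D0 \<in> orderings" "?T = ?t D0" by blast
  have T: "0 \<le> ?T" "?T \<le> real CARD('d)" using reduced_zero(1,2)[OF D0(1) q] s0 D0(2) by auto
  have "growth (pw D ?T) (avoiding (stake q qs)) \<le> 0" if D: "D \<in> orderings" for D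
  proof -
    have le: "?t D \<le> ?T" using D by (intro Max_ge) auto
    have "growth (pw D ?T) (avoiding (stake q qs)) \<le> growth (pw D (?t D)) (avoiding (stake q qs)) + (?T - ?t D) * ln (Max (range (\<lambda>i. onorm (\<lambda>x. A i *v x))))"
      by (rule pressure_slope(1)[OF V D reduced_zero(1)[OF D q] le T(2)])
    also have "\<dots> \<le> 0"
    proof -
      have "ln (Max (range (\<lambda>i. onorm (\<lambda>x. A i *v x)))) \<le> 0"
        by (rule ln_le_zero_iff[OF \<alpha>_pos, THEN iffD2]) (use \<alpha>_less in linarith)
      then show ?thesis
        using mult_nonneg_nonpos[of "?T - ?t D"] le reduced_zero(3)[OF D q] by simp
    qed
    finally show ?thesis .
  qed
  then show ?thesis
    unfolding survivor_set_eq
    by (intro AE_hausdorff_dim[OF V T _ D0(1)]) (use D0 reduced_zero(3)[OF D0(1) q] in auto)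
qed

lemma AE_dim_self_affine_set:
  "AE v in (lborel :: (real^'d^'k) measure). hausdorff_dim (self_affine_set A v) = s0"
proof -
  obtain D0 where D0: "D0 \<in> orderings" "Q D0 s0 = 1" using exists_critical by blast
  have pr: "growth (pw D s0) UNIV = ln (Q D s0)" for D
    using growth_UNIV[of "pw D s0"] pw_pos by (simp add: Q_def)
  have "AE v in (lborel :: (real^'d^'k) measure). hausdorff_dim (proj v ` {x. \<forall>n. stake n x \<in> UNIV}) = s0"
    by (rule AE_hausdorff_dim[OF factorial_language_UNIV level_UNIV_nonempty s0 _ D0(1)])
      (use Q_le_1 Q_pos D0 in \<open>auto simp: pr\<close>)
  then show ?thesis by (simp add: self_affine_set_eq)
qed

text \<open>Treats both cases of the theorem at once: \<open>R D\<close> is the reciprocal of the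
  return sum, namely 1 for an aperiodic stream and one minus the mass of the period block
  otherwise.\<close>

lemma gap_ratio_lim:
  fixes R :: "'d list \<Rightarrow> real"
  assumes R: "\<And>D. D \<in> orderings \<Longrightarrow> Q D s0 = 1 \<Longrightarrow> 0 < R D \<and>
      (\<Sum>j. if sdrop j qs = qs then wt (pw D s0) (stake j qs) else 0) = 1 / R D"
  shows "(\<lambda>q. (s0 - Max ((\<lambda>D. reduced_D_zero A D qs q) ` orderings)) /
      Min ((\<lambda>D. Z_const A s0 D * R D * measure (bernoulli_measure A s0 D) (cylinder (stake q qs))) `
        {D \<in> orderings. D_pressure A D s0 = 0})) \<longlonglongrightarrow> 1"
proof -
  let ?t = "\<lambda>D q. reduced_D_zero A D qs q"
  define P where "P = {D \<in> (orderings :: 'd list set). Q D s0 = 1}"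
  have P: "finite P" "P \<noteq> {}" "P \<subseteq> orderings" using exists_critical by (auto simp: P_def)
  have Peq: "{D \<in> orderings. D_pressure A D s0 = 0} = P"
    using Q_pos by (auto simp: P_def D_pressure_eq s0)
  let ?y = "\<lambda>D q. Z_const A s0 D * R D * measure (bernoulli_measure A s0 D) (cylinder (stake q qs))"
  have DP: "D \<in> orderings" "Q D s0 = 1" if "D \<in> P" for D using that by (auto simp: P_def)
  have y: "?y D q = R D / slope D s0 * wt (pw D s0) (stake q qs)" if "D \<in> P" for D q
    using bernoulli_measure_cylinder[OF DP(1) s0 DP(2)] Z_const_eq[OF DP(1) s0_pos s0(2) DP(2)] that by simp
  have ypos: "0 < ?y D q" if "D \<in> P" for D q
    using that R[OF DP] slope_pos[OF DP(1) s0_pos s0(2) DP(2)] wt_pos[of "pw D s0"] pw_pos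
    unfolding y[OF that] by (intro mult_pos_pos divide_pos_pos) auto
  have lim: "(\<lambda>q. (s0 - ?t D q) / ?y D q) \<longlonglongrightarrow> 1" if D: "D \<in> P" for D
  proof -
    note DD = DP[OF D]
    have sl: "0 < slope D s0" by (rule slope_pos[OF DD(1) s0_pos s0(2) DD(2)])
    have Rp: "0 < R D" using R[OF DD] by simp
    have "(\<lambda>q. (s0 - ?t D q) / wt (pw D s0) (stake q qs)) \<longlonglongrightarrow>
        1 / (slope D s0 * (\<Sum>j. if sdrop j qs = qs then wt (pw D s0) (stake j qs) else 0))"
      by (rule gap_asymptotics[OF DD(1) s0_pos s0(2) DD(2) k])
        (use reduced_zero[OF DD(1)] s0 order_trans in blast)+
    then have "(\<lambda>q. (s0 - ?t D q) / wt (pw D s0) (stake q qs)) \<longlonglongrightarrow> R D / slope D s0"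
      using R[OF DD] by simp
    from tendsto_divide[OF this tendsto_const, of "R D / slope D s0"]
    have "(\<lambda>q. (s0 - ?t D q) / wt (pw D s0) (stake q qs) / (R D / slope D s0)) \<longlonglongrightarrow> 1"
      using sl Rp by simp
    moreover have "(s0 - ?t D q) / wt (pw D s0) (stake q qs) / (R D / slope D s0) = (s0 - ?t D q) / ?y D q" for q
      unfolding y[OF D] by (simp add: mult.commute)
    ultimately show ?thesis by simp
  qed
  have main: "(\<lambda>q. Min ((\<lambda>D. s0 - ?t D q) ` P) / Min ((\<lambda>D. ?y D q) ` P)) \<longlonglongrightarrow> 1"
    by (rule Min_ratio_tendsto[OF P(1,2) ypos lim])
  have tlim: "(\<lambda>q. ?t D q) \<longlonglongrightarrow> s0" if D: "D \<in> P" for D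
    by (rule t_lim[OF DP(1)[OF D] s0_pos s0(2) DP(2)[OF D] k])
      (use reduced_zero[OF DP(1)[OF D]] s0 order_trans in blast)+
  \<comment> \<open>A noncritical ordering has its full zero \<open>T\<close> strictly below
    \<open>s0\<close>, which bounds its reduced zeros, whereas those of a critical ordering tend to
    \<open>s0\<close> and overtake \<open>T\<close>.\<close>
  have ev: "\<forall>\<^sub>F q in sequentially. \<forall>D\<in>orderings - P. \<forall>D0\<in>P. ?t D q \<le> ?t D0 q"
  proof (intro eventually_ball_finite ballI)
    fix D D0 assume D: "D \<in> orderings - P" and D0: "D0 \<in> P"
    have "ln (Q D s0) \<le> 0" using Q_le_1[of D] Q_pos[of D s0] D by simp
    then have "growth (pw D s0) UNIV \<le> 0" using growth_UNIV[of "pw D s0"] pw_pos by (simp add: Q_def)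
    then obtain T where T: "0 \<le> T" "T \<le> s0" "growth (pw D T) UNIV = 0"
      using pressure_zero[OF factorial_language_UNIV level_UNIV_nonempty _ s0] D by blast
    then have "ln (Q D T) = 0" using growth_UNIV[of "pw D T"] pw_pos by (simp add: Q_def)
    then have QT: "Q D T = 1" using Q_pos[of D T] by simp
    then have "T \<noteq> s0" using D by (auto simp: P_def)
    then have "T < s0" using T by simp
    then have "\<forall>\<^sub>F q in sequentially. T < ?t D0 q" using tlim[OF D0] by (rule order_tendstoD(1)[rotated])
    moreover have "\<forall>\<^sub>F q in sequentially. 1 \<le> (q::nat)" by (rule eventually_ge_at_top)
    ultimately show "\<forall>\<^sub>F q in sequentially. ?t D q \<le> ?t D0 q"
    proof eventually_elim
      case (elim q)
      then show ?case using reduced_zero(4)[of D q T] D T QT by simp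
    qed
  qed (use P in auto)
  show ?thesis
    unfolding Peq
  proof (rule Lim_transform_eventually[OF main])
    show "\<forall>\<^sub>F q in sequentially. Min ((\<lambda>D. s0 - ?t D q) ` P) / Min ((\<lambda>D. ?y D q) ` P) =
        (s0 - Max ((\<lambda>D. ?t D q) ` orderings)) / Min ((\<lambda>D. ?y D q) ` P)"
      using ev
    proof eventually_elim
      case (elim q)
      have "s0 - Max ((\<lambda>D. ?t D q) ` orderings) = Min ((\<lambda>D. s0 - ?t D q) ` P)"
        by (rule diff_Max_eq_Min_diff) (use P elim in auto)
      then show ?case by simp
    qed
  qed
qed

end

end

theorem theorem4p11:
  fixes A :: "'k::finite \<Rightarrow> real^'d::finite^'d"
    and qs :: "'k stream"
    and s0 :: real
  assumes "2 \<le> CARD('k)"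
    and "\<And>i. invertible (A i)"
    and "\<And>i. onorm (\<lambda>x. A i *v x) < 1 / 2"
    and "\<And>i r c. r \<noteq> c \<Longrightarrow> A i $ r $ c = 0"
    and "0 \<le> s0" and "s0 \<le> real CARD('d)" and "pressure A s0 = 0"
  shows "AE v in (lebesgue :: (real^'d^'k) measure).
      (\<forall>q\<ge>1. hausdorff_dim (survivor_set A v qs q) =
               Max ((\<lambda>D. reduced_D_zero A D qs q) ` orderings)) \<and>
      ((\<nexists>l. has_period qs l) \<longrightarrow>
        (\<lambda>q. (hausdorff_dim (self_affine_set A v) - hausdorff_dim (survivor_set A v qs q)) /
              Min ((\<lambda>D. Z_const A s0 D *
                          measure (bernoulli_measure A s0 D) (cylinder (stake q qs))) `
                   {D \<in> orderings. D_pressure A D s0 = 0}))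
          \<longlonglongrightarrow> 1) \<and>
      (\<forall>l. has_period qs l \<longrightarrow>
        (\<lambda>q. (hausdorff_dim (self_affine_set A v) - hausdorff_dim (survivor_set A v qs q)) /
              Min ((\<lambda>D. Z_const A s0 D *
                          (1 - measure (bernoulli_measure A s0 D) (cylinder (stake l qs))) *
                          measure (bernoulli_measure A s0 D) (cylinder (stake q qs))) `
                   {D \<in> orderings. D_pressure A D s0 = 0}))
          \<longlonglongrightarrow> 1)"
proof -
  interpret diagonal_matrix_ifs A
    using assms(2-4) by unfold_locales
  note hyps = assms(1,5-7)
  have s0p: "0 < s0" by (rule s0_pos[OF hyps])
  have aperiodic: "(\<lambda>q. (s0 - Max ((\<lambda>D. reduced_D_zero A D qs q) ` orderings)) /
      Min ((\<lambda>D. Z_const A s0 D * measure (bernoulli_measure A s0 D) (cylinder (stake q qs))) `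
        {D \<in> orderings. D_pressure A D s0 = 0})) \<longlonglongrightarrow> 1"
    if "\<nexists>l. has_period qs l"
    using gap_ratio_lim[OF hyps, where qs = qs and R = "\<lambda>_. 1"] return_sum_aperiodic[OF _ s0p assms(6) _ that] by simp
  have periodic: "(\<lambda>q. (s0 - Max ((\<lambda>D. reduced_D_zero A D qs q) ` orderings)) /
      Min ((\<lambda>D. Z_const A s0 D * (1 - measure (bernoulli_measure A s0 D) (cylinder (stake l qs))) *
          measure (bernoulli_measure A s0 D) (cylinder (stake q qs))) `
        {D \<in> orderings. D_pressure A D s0 = 0})) \<longlonglongrightarrow> 1"
    if p: "has_period qs l" for l
  proof (rule gap_ratio_lim[OF hyps])
    fix D :: "'d list" assume D: "D \<in> orderings" "Q D s0 = 1"
    then show "0 < 1 - measure (bernoulli_measure A s0 D) (cylinder (stake l qs)) \<and>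
        (\<Sum>j. if sdrop j qs = qs then wt (pw D s0) (stake j qs) else 0) =
        1 / (1 - measure (bernoulli_measure A s0 D) (cylinder (stake l qs)))"
      using return_sum_periodic[OF D(1) s0p assms(6) D(2) p] bernoulli_measure_cylinder[OF D(1) assms(5,6) D(2)] by simp
  qed
  \<comment> \<open>Countably many \<open>q\<close> share one null set, so the limits below hold
    along all holes for the same translation.\<close>
  have "AE v in (lborel :: (real^'d^'k) measure). \<forall>q. 1 \<le> q \<longrightarrow>
      hausdorff_dim (survivor_set A v qs q) = Max ((\<lambda>D. reduced_D_zero A D qs q) ` orderings)"
    unfolding AE_all_countable using AE_dim_survivor_set[OF hyps] by auto
  with AE_dim_self_affine_set[OF hyps]
  have "AE v in (lborel :: (real^'d^'k) measure). hausdorff_dim (self_affine_set A v) = s0 \<and>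
      (\<forall>q. 1 \<le> q \<longrightarrow> hausdorff_dim (survivor_set A v qs q) = Max ((\<lambda>D. reduced_D_zero A D qs q) ` orderings))"
    by eventually_elim blast
  then have "AE v in (lebesgue :: (real^'d^'k) measure). hausdorff_dim (self_affine_set A v) = s0 \<and>
      (\<forall>q. 1 \<le> q \<longrightarrow> hausdorff_dim (survivor_set A v qs q) = Max ((\<lambda>D. reduced_D_zero A D qs q) ` orderings))"
    by (rule AE_completion)
  then show ?thesis
  proof eventually_elim
    case (elim v)
    \<comment> \<open>The dimension formula holds from \<open>q = 1\<close> on; the value at
      \<open>q = 0\<close> does not affect the limit.\<close>
    have ev: "\<forall>\<^sub>F q in sequentially. (s0 - Max ((\<lambda>D. reduced_D_zero A D qs q) ` orderings)) / Y q =
        (hausdorff_dim (self_affine_set A v) - hausdorff_dim (survivor_set A v qs q)) / Y q" for Y :: "nat \<Rightarrow> real"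
      using eventually_ge_at_top[of 1] by eventually_elim (use elim in simp)
    show ?case
      using elim Lim_transform_eventually[OF aperiodic ev] Lim_transform_eventually[OF periodic ev] by blast
  qed
qed

end
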